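(* Let $\Omega\subset\mathbb{R}^{d+1}$ be the closure of an open, connected, bounded $C^2$-domain. There exists a number $\varepsilon_0\in(0,1)$, depending only on $\Omega$ and $d$, with the following property: if $n\in\mathbb{N}$, $\varepsilon\in(0,\varepsilon_0)$ and $\Lambda$ is a maximal $\frac{\varepsilon}{n}$-separated subset of $\Omega$ with respect to the metric $\rho_\Omega$, then there exist positive numbers $\{\lambda_\xi:\xi\in\Lambda\}$ such that $$c^{-1}\bigl|U(\xi,\tfrac\varepsilon n)\bigr|\le\lambda_\xi\le c\,\bigl|U(\xi,\tfrac\varepsilon n)\bigr|\quad\text{for all }\xi\in\Lambda,$$ where $c\ge1$ is a constant independent of $\xi$ and $n$, and $$\int_\Omega f(\eta)\,d\eta=\sum_{\xi\in\Lambda}\lambda_\xi f(\xi)\quad\text{for every polynomial } f \text{ on }\mathbb{R}^{d+1}\text{ of total degree at most } n.$$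
   Context: Here $d\ge1$, $\Gamma=\partial\Omega$, $\|\cdot\|$ is the Euclidean norm, $|E|$ is Lebesgue measure, $\rho_\Omega(\xi,\eta)=\|\xi-\eta\|+\bigl|\sqrt{\mathrm{dist}(\xi,\Gamma)}-\sqrt{\mathrm{dist}(\eta,\Gamma)}\bigr|$ for $\xi,\eta\in\Omega$, and $U(\xi,t)=\{\eta\in\Omega:\rho_\Omega(\xi,\eta)\le t\}$. A set $\Lambda$ in a metric space $(X,\rho)$ is $\varepsilon$-separated if $\rho(\omega,\omega')\ge\varepsilon$ for any two distinct $\omega,\omega'\in\Lambda$; an $\varepsilon$-separated $\Lambda$ is called maximal if $\inf_{\omega\in\Lambda}\rho(x,\omega)<\varepsilon$ for every $x\in X$. $C^2$-domain: a bounded domain for which there are $\delta>0$, $M>0$ and a finite cover of the boundary by connected open sets $U_1,\dots,U_J$ such that (i) every $x$ in the domain with distance $<\delta$ to the boundary lies in some $U_j$ with $\mathrm{dist}(x,\partial U_j)>\delta$; (ii) for each $j$ there is a Cartesian coordinate system $(\xi_{j,1},\dots,\xi_{j,d+1})$ in $U_j$ in which the part of the domain in $U_j$ is given by $\xi_{j,d+1}\le f_j(\xi_{j,1},\dots,\xi_{j,d})$ with $f_j\in C^2(\mathbb{R}^d)$ and $\max_{i,k}\|\partial_i\partial_kf_j\|_\infty\le M$. *)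

theory Defs
  imports "HOL-Analysis.Analysis"
begin

text \<open>
  The ambient space of dimension d + 1 is \<open>(real ^ 'd) \<times> real\<close>, whose library norm and
  Lebesgue measure are the Euclidean ones; d = \<open>CARD('d)\<close> is at least 1.
\<close>

definition partial :: "'d \<Rightarrow> (real ^ 'd \<Rightarrow> real) \<Rightarrow> real ^ 'd \<Rightarrow> real" where
  "partial i f = (\<lambda>x. frechet_derivative f (at x) (axis i 1))"

text \<open>Continuity of \<open>f\<close> and of its first partial derivatives follows from differentiability.\<close>

definition C2_function :: "(real ^ 'd \<Rightarrow> real) \<Rightarrow> bool" where
  "C2_function f \<longleftrightarrow>
     f differentiable_on UNIV \<and>
     (\<forall>i. partial i f differentiable_on UNIV) \<and>
     (\<forall>i k. continuous_on UNIV (partial i (partial k f)))"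

text \<open>A Cartesian coordinate system is given by its coordinate map: a choice of origin
  followed by an orthogonal change of basis.\<close>

definition cartesian_coordinates :: "((real ^ 'd) \<times> real \<Rightarrow> (real ^ 'd) \<times> real) \<Rightarrow> bool" where
  "cartesian_coordinates T \<longleftrightarrow>
     (\<exists>Q b. orthogonal_transformation Q \<and> T = (\<lambda>x. Q (x - b)))"

text \<open>
  The non-strict inequality in the local representation forces \<open>G\<close> to contain its boundary: a
  nonempty bounded open \<open>G\<close> never satisfies it, since \<open>G \<inter> U j\<close> would be open and closed in the
  connected set \<open>U j\<close>. The predicate is therefore meant for the closed domain \<open>G = closure D\<close>.
  For \<open>D = interior G\<close> the representation becomes the one with strict inequality.
\<close>

definition C2_domain :: "((real ^ 'd) \<times> real) set \<Rightarrow> bool" where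
  "C2_domain G \<longleftrightarrow> bounded G \<and>
     (\<exists>\<delta>>0. \<exists>M>0. \<exists>(J::nat) U.
        (\<forall>j\<in>{1..J}. open (U j) \<and> connected (U j)) \<and>
        frontier G \<subseteq> (\<Union>j\<in>{1..J}. U j) \<and>
        (\<forall>x\<in>G. infdist x (frontier G) < \<delta> \<longrightarrow>
           (\<exists>j\<in>{1..J}. x \<in> U j \<and> infdist x (frontier (U j)) > \<delta>)) \<and>
        (\<forall>j\<in>{1..J}. \<exists>T f.
           cartesian_coordinates T \<and> C2_function f \<and>
           (\<forall>i k x. \<bar>partial i (partial k f) x\<bar> \<le> M) \<and>
           G \<inter> U j = {x \<in> U j. snd (T x) \<le> f (fst (T x))}))"

definition rho :: "((real ^ 'd) \<times> real) set \<Rightarrow> (real ^ 'd) \<times> real \<Rightarrow> (real ^ 'd) \<times> real \<Rightarrow> real" where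
  "rho \<Omega> \<xi> \<eta> = norm (\<xi> - \<eta>) +
     \<bar>sqrt (infdist \<xi> (frontier \<Omega>)) - sqrt (infdist \<eta> (frontier \<Omega>))\<bar>"

definition rho_ball :: "((real ^ 'd) \<times> real) set \<Rightarrow> (real ^ 'd) \<times> real \<Rightarrow> real \<Rightarrow> ((real ^ 'd) \<times> real) set" where
  "rho_ball \<Omega> \<xi> t = {\<eta> \<in> \<Omega>. rho \<Omega> \<xi> \<eta> \<le> t}"

definition separated_set :: "('a \<Rightarrow> 'a \<Rightarrow> real) \<Rightarrow> real \<Rightarrow> 'a set \<Rightarrow> bool" where
  "separated_set \<rho> \<epsilon> \<Lambda> \<longleftrightarrow> (\<forall>\<omega>\<in>\<Lambda>. \<forall>\<omega>'\<in>\<Lambda>. \<omega> \<noteq> \<omega>' \<longrightarrow> \<rho> \<omega> \<omega>' \<ge> \<epsilon>)"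

text \<open>The infimum is taken in \<open>ereal\<close> so that it is \<open>\<infinity>\<close> for empty \<open>\<Lambda>\<close>.\<close>

definition maximal_separated_set :: "'a set \<Rightarrow> ('a \<Rightarrow> 'a \<Rightarrow> real) \<Rightarrow> real \<Rightarrow> 'a set \<Rightarrow> bool" where
  "maximal_separated_set X \<rho> \<epsilon> \<Lambda> \<longleftrightarrow>
     \<Lambda> \<subseteq> X \<and> separated_set \<rho> \<epsilon> \<Lambda> \<and>
     (\<forall>x\<in>X. (INF \<omega>\<in>\<Lambda>. ereal (\<rho> x \<omega>)) < ereal \<epsilon>)"

definition multi_indices :: "nat \<Rightarrow> (('d::finite \<Rightarrow> nat) \<times> nat) set" where
  "multi_indices n = {(\<alpha>, m). (\<Sum>i\<in>UNIV. \<alpha> i) + m \<le> n}"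

lemma finite_multi_indices: "finite (multi_indices n :: (('d::finite \<Rightarrow> nat) \<times> nat) set)"
proof (rule finite_subset)
  have "\<alpha> i \<le> (\<Sum>i\<in>UNIV. \<alpha> i)" for \<alpha> :: "'d \<Rightarrow> nat" and i
    by (rule member_le_sum) auto
  then have "\<alpha> i \<le> n" if "(\<Sum>i\<in>UNIV. \<alpha> i) + m \<le> n" for \<alpha> :: "'d \<Rightarrow> nat" and i m
    using that by (meson add_leD1 le_trans)
  then show "multi_indices n \<subseteq> PiE (UNIV :: 'd set) (\<lambda>_. {..n}) \<times> {..n}"
    by (auto simp: multi_indices_def)
  show "finite (PiE (UNIV :: 'd set) (\<lambda>_. {..n}) \<times> {..n})"
    by (intro finite_cartesian_product finite_PiE) auto
qed

definition polynomial_of_degree_le :: "nat \<Rightarrow> ((real ^ 'd) \<times> real \<Rightarrow> real) \<Rightarrow> bool" where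
  "polynomial_of_degree_le n f \<longleftrightarrow>
     (\<exists>a. \<forall>x. f x = (\<Sum>(\<alpha>, m)\<in>multi_indices n.
        a (\<alpha>, m) * ((\<Prod>i\<in>UNIV. (fst x $ i) ^ \<alpha> i) * snd x ^ m)))"

end

theory Submission
  imports Defs
begin

text \<open>
  Let \<open>U(\<xi>, t)\<close>, \<open>t = \<epsilon> / n\<close>, be the balls around the nodes. Their number at a point is bounded, because
  \<open>\<rho>\<^sub>\<Omega>\<close> is a norm distance after the embedding \<open>x \<mapsto> (x, sqrt (dist (x, \<Gamma>)))\<close>. Averaging over the
  balls containing a point yields weights \<open>\<mu>\<^sub>\<xi>\<close> comparable to \<open>\<bar>U(\<xi>, t)\<bar>\<close>. If the mean oscillation of
  polynomials of degree \<open>n\<close> over balls of radius \<open>t\<close> is at most a third of their \<open>L\<^sup>1\<close> norm, then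
  \<open>\<integral>f - \<Sum>\<mu>\<^sub>\<xi> f(\<xi>)\<close> is bounded by \<open>\<Sum>\<mu>\<^sub>\<xi>\<bar>f(\<xi>)\<bar> / 2\<close> and a finite Hahn-Banach extension corrects every
  \<open>\<mu>\<^sub>\<xi>\<close> by at most a factor between 1/2 and 3/2.

  For the oscillation, Bernstein's inequality, written with the Fejer kernel, dominates the change of a
  polynomial of degree \<open>N\<close> over distances \<open>\<epsilon> / N\<close> by \<open>\<epsilon>\<close> times the integral of its absolute value against a
  measure of bounded mass on a cube of fixed size. Near the boundary \<open>x\<^sub>d\<^sub>+\<^sub>1 = g(u)\<close> this is applied to
  \<open>F(\<tau>, z) = f(u + \<tau>, q\<^sub>u(\<tau>) + a - \<bar>z\<bar>\<^sup>2)\<close> with \<open>z\<close> in the plane, where \<open>q\<^sub>u\<close> is a paraboloid touching the graph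
  from below at \<open>u\<close> and \<open>a\<close> is of order \<open>t\<^sup>2\<close>. In the variables \<open>(\<tau>, z)\<close> a \<open>\<rho>\<^sub>\<Omega>\<close>-ball of radius \<open>t\<close> has size
  \<open>O(t)\<close> in all directions, and \<open>z \<mapsto> \<bar>z\<bar>\<^sup>2\<close> maps plane area to a multiple of length, so that only translation
  invariance is needed to integrate over \<open>u\<close> and \<open>z\<close>. The paraboloids leave the domain by at most \<open>a\<close>, which a
  one-dimensional inequality of Remez type absorbs.
\<close>

text \<open>Flattening the boundary by the graph would turn polynomials into something else. Bounds
  on second derivatives still give, for each base point, a paraboloid that follows the graph up to a
  quadratic error, and in its coordinates a polynomial of degree n has degree at most 2n in every
  variable; so all inequalities are used with degree 2n. The variable z must be planar: on a line, s
  = z^2 turns length in z into the density s^(-1/2), so a translation invariant estimate in z would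
  not be one for Lebesgue measure. The lift a meets two opposite demands. It has to exceed the gap
  between graph and paraboloid at distance t, so that every nearby point of the domain is reached
  with |z|^2 >= 0; and it has to stay below a small multiple of n^(-2), the scale on which
  polynomials of degree 2n can be continued past an endpoint at bounded cost. With t = eps / n both
  are conditions on eps alone, whence a threshold independent of n. Bernstein's inequality takes the
  form of a measure that does not depend on the polynomial: pointwise maxima would not fit an L^1
  estimate, whereas a fixed measure allows Fubini.\<close>

section \<open>Extension of bounded functionals on a finite set\<close>

text \<open>Hahn-Banach, one point at a time. \<open>V\<close> is a linear relation between value
  vectors and functional values; the bound, applied to differences of pairs in both signs, makes the
  functional depend only on the values on \<open>A\<close>. The induction fixes a coefficient for
  one point \<open>z\<close>, subtracts its contribution, and finds the remainder bounded by the
  weighted sum over the other points.\<close>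

lemma bounded_functional_coefficients:
  fixes m :: "'a \<Rightarrow> real"
  assumes "finite A" and "\<And>x. x \<in> A \<Longrightarrow> 0 \<le> m x"
    and "\<And>v l v' l'. (v, l) \<in> V \<Longrightarrow> (v', l') \<in> V \<Longrightarrow> ((\<lambda>x. v x + v' x), l + l') \<in> V"
    and "\<And>c v l. (v, l) \<in> V \<Longrightarrow> ((\<lambda>x. c * v x), c * l) \<in> V"
    and "\<And>v l. (v, l) \<in> V \<Longrightarrow> l \<le> (\<Sum>x\<in>A. m x * \<bar>v x\<bar>)"
  shows "\<exists>a. (\<forall>x\<in>A. \<bar>a x\<bar> \<le> m x) \<and> (\<forall>(v, l)\<in>V. l = (\<Sum>x\<in>A. a x * v x))"
  using assms
proof (induction A arbitrary: V rule: finite_induct)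
  case empty
  have "l = 0" if "(v, l) \<in> V" for v l
  proof -
    have "l \<le> 0" using empty(4)[OF that] by simp
    moreover have "-1 * l \<le> 0" using empty(4)[OF empty(3)[OF that, of "-1"]] by simp
    ultimately show ?thesis by simp
  qed
  then show ?case by auto
next
  case (insert z A V)
  note add = insert.prems(2) and scale = insert.prems(3) and bound = insert.prems(4)
  define p where "p v = (\<Sum>x\<in>A. m x * \<bar>v x\<bar>)" for v :: "'a \<Rightarrow> real"
  have bd: "l \<le> m z * \<bar>v z\<bar> + p v" if "(v, l) \<in> V" for v l
    using bound[OF that] insert.hyps by (simp add: p_def)
  have m0: "0 \<le> m z" "\<And>x. x \<in> A \<Longrightarrow> 0 \<le> m x" using insert.prems(1) by auto
  have p_scale: "p (\<lambda>x. c * v x) = \<bar>c\<bar> * p v" for c v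
    unfolding p_def sum_distrib_left by (intro sum.cong) (auto simp: abs_mult)
  have p_diff: "p (\<lambda>x. v x - v' x) \<le> p v + p v'" for v v'
    unfolding p_def sum.distrib[symmetric] ring_distribs(1)[symmetric]
    by (intro sum_mono mult_left_mono) (auto simp: m0)
  \<comment> \<open>Admissible coefficients at \<open>z\<close> lie between the values
    \<open>l - p v\<close> and \<open>l + p v\<close> of members normalised by
    \<open>v z = 1\<close>; the supremum of the lower ones is taken. Inserting \<open>- m z\<close>
    keeps \<open>S\<close> nonempty when no member can be normalised, and gives the lower bound on
    \<open>\<alpha>\<close> at once.\<close>
  define S where "S = insert (- m z) {l - p v | v l. (v, l) \<in> V \<and> v z = 1}"
  have key: "l - p v \<le> l' + p v'" if "(v, l) \<in> V" "v z = 1" "(v', l') \<in> V" "v' z = 1" for v l v' l'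
  proof -
    have "((\<lambda>x. v x + (-1) * v' x), l + (-1) * l') \<in> V" by (intro add scale that)
    from bd[OF this] have "l - l' \<le> p (\<lambda>x. v x - v' x)" using that by simp
    with p_diff[of v v'] show ?thesis by simp
  qed
  have low: "- m z \<le> l + p v" if "(v, l) \<in> V" "v z = 1" for v l
    using bd[OF scale[OF that(1), of "-1"]] that(2) unfolding p_scale by simp
  have bdd: "bdd_above S"
  proof (rule bdd_aboveI)
    fix y assume "y \<in> S"
    then show "y \<le> m z" using bd m0(1) unfolding S_def by fastforce
  qed
  define \<alpha> where "\<alpha> = Sup S"
  have "- m z \<le> \<alpha>" unfolding \<alpha>_def by (rule cSup_upper[OF _ bdd]) (simp add: S_def)
  moreover have "\<alpha> \<le> m z" unfolding \<alpha>_def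
  proof (rule cSup_least)
    fix y assume "y \<in> S"
    then show "y \<le> m z" using bd m0(1) unfolding S_def by fastforce
  qed (simp add: S_def)
  ultimately have \<alpha>: "\<bar>\<alpha>\<bar> \<le> m z" by simp
  have up: "l - p v \<le> \<alpha>" if "(v, l) \<in> V" "v z = 1" for v l
    unfolding \<alpha>_def by (rule cSup_upper[OF _ bdd]) (use that in \<open>auto simp: S_def\<close>)
  have dn: "\<alpha> \<le> l + p v" if "(v, l) \<in> V" "v z = 1" for v l
    unfolding \<alpha>_def
  proof (rule cSup_least)
    fix y assume "y \<in> S"
    then show "y \<le> l + p v" using key low that unfolding S_def by auto
  qed (simp add: S_def)
  define V' where "V' = (\<lambda>(v, l). (v, l - \<alpha> * v z)) ` V"
  have V'I: "(v, l - \<alpha> * v z) \<in> V'" if "(v, l) \<in> V" for v l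
    unfolding V'_def using that by force
  \<comment> \<open>Homogeneity reduces \<open>v z \<noteq> 0\<close> to \<open>v z = 1\<close>; a
    negative \<open>v z\<close> reverses the inequality, so \<open>dn\<close> then takes the place
    of \<open>up\<close>.\<close>
  have fin: "l - \<alpha> * v z \<le> p v" if "(v, l) \<in> V" for v l
  proof -
    consider "v z = 0" | "v z > 0" | "v z < 0" by linarith
    then show ?thesis
    proof cases
      case 1 then show ?thesis using bd[OF that] by simp
    next
      case 2
      from up[OF scale[OF that, of "1 / v z"]] 2 have "l / v z - p v / v z \<le> \<alpha>"
        unfolding p_scale by simp
      then show ?thesis using 2 by (simp add: field_simps)
    next
      case 3
      from dn[OF scale[OF that, of "1 / v z"]] 3 have "\<alpha> \<le> l / v z + (- (p v / v z))"
        unfolding p_scale by simp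
      then show ?thesis using 3 by (simp add: field_simps)
    qed
  qed
  have "\<exists>a. (\<forall>x\<in>A. \<bar>a x\<bar> \<le> m x) \<and> (\<forall>(v, l)\<in>V'. l = (\<Sum>x\<in>A. a x * v x))"
  proof (rule insert.IH)
    fix v l v' l' assume "(v, l) \<in> V'" "(v', l') \<in> V'"
    then obtain k k' where "(v, k) \<in> V" "l = k - \<alpha> * v z" "(v', k') \<in> V" "l' = k' - \<alpha> * v' z"
      unfolding V'_def by auto
    then have "((\<lambda>x. v x + v' x), k + k' - \<alpha> * (v z + v' z)) \<in> V'"
      using V'I[OF add, of v k v' k'] by simp
    moreover have "l + l' = k + k' - \<alpha> * (v z + v' z)"
      using \<open>l = _\<close> \<open>l' = _\<close> by (simp add: algebra_simps)
    ultimately show "((\<lambda>x. v x + v' x), l + l') \<in> V'" by simp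
  next
    fix c v l assume "(v, l) \<in> V'"
    then obtain k where "(v, k) \<in> V" "l = k - \<alpha> * v z" unfolding V'_def by auto
    then have "((\<lambda>x. c * v x), c * k - \<alpha> * (c * v z)) \<in> V'"
      using V'I[OF scale, of v k c] by simp
    moreover have "c * l = c * k - \<alpha> * (c * v z)"
      unfolding \<open>l = _\<close> by (simp add: algebra_simps)
    ultimately show "((\<lambda>x. c * v x), c * l) \<in> V'" by simp
  next
    fix v l assume "(v, l) \<in> V'"
    then show "l \<le> (\<Sum>x\<in>A. m x * \<bar>v x\<bar>)" unfolding V'_def using fin p_def by auto
  qed (use m0 in auto)
  then obtain a where a: "\<forall>x\<in>A. \<bar>a x\<bar> \<le> m x" "\<And>v l. (v, l) \<in> V' \<Longrightarrow> l = (\<Sum>x\<in>A. a x * v x)"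
    by blast
  have "l = (\<Sum>x\<in>insert z A. (a(z := \<alpha>)) x * v x)" if "(v, l) \<in> V" for v l
  proof -
    have "(\<Sum>x\<in>A. (a(z := \<alpha>)) x * v x) = (\<Sum>x\<in>A. a x * v x)"
      using insert.hyps by (intro sum.cong) auto
    then show ?thesis using a(2)[OF V'I[OF that]] insert.hyps by simp
  qed
  then show ?case using a(1) \<alpha> insert.hyps
    by (intro exI[of _ "a(z := \<alpha>)"]) auto
qed

section \<open>Bernstein inequality through averaging measures\<close>

lemma sum_cis_roots_of_unity:
  fixes d :: int and M :: nat
  assumes "M > 0" and "\<bar>d\<bar> < int M"
  shows "(\<Sum>l<M. cis (of_int d * (2 * pi * real l / real M))) = (if d = 0 then of_nat M else 0)"
proof (cases "d = 0")
  case False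
  define \<omega> where "\<omega> = cis (2 * pi * of_int d / real M)"
  have pow: "cis (of_int d * (2 * pi * real l / real M)) = \<omega> ^ l" for l
  proof -
    have "of_int d * (2 * pi * real l / real M) = real l * (2 * pi * of_int d / real M)" by simp
    then show ?thesis by (simp only: \<omega>_def Complex.DeMoivre)
  qed
  have "\<omega> \<noteq> 1"
  proof
    assume "\<omega> = 1"
    then have "cos (2 * pi * of_int d / real M) = 1" by (simp add: \<omega>_def complex_eq_iff)
    then obtain x :: int where "2 * pi * of_int d / real M = of_int x * 2 * pi"
      using cos_one_2pi_int by blast
    then have "real_of_int d = of_int x * real M" using assms(1) by (simp add: field_simps)
    then have "d = x * int M"
      by (metis of_int_eq_iff of_int_mult of_int_of_nat_eq)
    with assms(2) False show False
      by (simp add: abs_mult)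
  qed
  moreover have "\<omega> ^ M = 1"
    unfolding \<omega>_def Complex.DeMoivre using assms(1) cis_multiple_2pi[of "of_int d"] by (simp add: mult_ac)
  ultimately show ?thesis using False unfolding pow by (simp add: geometric_sum)
qed (simp)

text \<open>Only the pairs with \<open>i = j + e\<close> count. The result is the coefficient of
  frequency \<open>e\<close> in the squared modulus of a sum of \<open>N\<close> consecutive
  exponentials, that is, \<open>N\<close> times the Fejer coefficient.\<close>

lemma sum_shifted_diagonal:
  fixes e :: int and N :: nat
  shows "(\<Sum>j<N. \<Sum>i<N. if int j - int i + e = 0 then 1 else 0 :: complex)
    = of_int (max 0 (int N - \<bar>e\<bar>))"
proof -
  have inner: "(\<Sum>i<N. if int j - int i + e = 0 then 1 else 0 :: complex)
      = (if j \<in> {nat (max 0 (- e))..<nat (min (int N) (int N - e))} then 1 else 0)"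
    if "j < N" for j
  proof (cases "0 \<le> int j + e \<and> int j + e < int N")
    case True
    have "(\<Sum>i<N. if int j - int i + e = 0 then 1 else 0 :: complex)
        = (\<Sum>i<N. if i = nat (int j + e) then 1 else 0)"
      using True by (intro sum.cong) auto
    then show ?thesis using True that by auto
  next
    case False
    then have "(\<Sum>i<N. if int j - int i + e = 0 then 1 else 0 :: complex) = 0"
      by (intro sum.neutral) auto
    then show ?thesis using False that by auto
  qed
  have "(\<Sum>j<N. \<Sum>i<N. if int j - int i + e = 0 then 1 else 0 :: complex)
      = (\<Sum>j<N. if j \<in> {nat (max 0 (- e))..<nat (min (int N) (int N - e))} then 1 else 0)"
    by (intro sum.cong) (use inner in auto)
  also have "\<dots> = of_nat (card ({..<N} \<inter> {nat (max 0 (- e))..<nat (min (int N) (int N - e))}))"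
    by (subst sum.inter_restrict[symmetric]) auto
  also have "{..<N} \<inter> {nat (max 0 (- e))..<nat (min (int N) (int N - e))}
      = {nat (max 0 (- e))..<nat (min (int N) (int N - e))}"
    by auto
  also have "int (card \<dots>) = max 0 (int N - \<bar>e\<bar>)" by auto
  then have "of_nat (card {nat (max 0 (- e))..<nat (min (int N) (int N - e))})
      = (of_int (max 0 (int N - \<bar>e\<bar>)) :: complex)"
    by (metis of_int_of_nat_eq)
  finally show ?thesis .
qed

text \<open>The weights are samples of \<open>2 N sin (N \<theta>)\<close> times the Fejer kernel, whose frequencies
  \<open>\<plusminus>N + j\<close> carry the factor \<open>1 - \<bar>j\<bar> / N\<close>, that is, the multiplier \<open>\<i> k\<close> of the derivative.\<close>

lemma bernstein_nodes:
  fixes N :: nat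
  assumes "N > 0"
  obtains M :: nat and c \<phi> :: "nat \<Rightarrow> real"
  where "(\<Sum>l<M. \<bar>c l\<bar>) \<le> 2 * real N"
    and "\<And>k::int. \<bar>k\<bar> \<le> int N \<Longrightarrow> (\<Sum>l<M. of_real (c l) * cis (of_int k * \<phi> l)) = \<i> * of_int k"
proof -
  \<comment> \<open>The frequencies that occur are \<open>j - i + e\<close> with indices below
    \<open>N\<close> and \<open>\<bar>e\<bar> \<le> 2 * N\<close>. They are smaller than
    \<open>3 * N\<close> in modulus, so that sampling at \<open>3 * N\<close> equidistant nodes
    causes no aliasing.\<close>
  define M where "M = 3 * N"
  define \<phi> where "\<phi> l = 2 * pi * real l / real M" for l
  define F where "F l = (cmod (\<Sum>j<N. cis (real j * \<phi> l)))\<^sup>2 / real N" for l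
  define c where "c l = 2 * real N / real M * F l * sin (real N * \<phi> l)" for l
  have M: "M > 0" using assms by (simp add: M_def)
  have F0: "F l \<ge> 0" for l by (simp add: F_def)
  have Fc: "complex_of_real (F l) = (\<Sum>j<N. \<Sum>i<N. cis (of_int (int j - int i) * \<phi> l)) / of_nat N" for l
  proof -
    have "complex_of_real ((cmod (\<Sum>j<N. cis (real j * \<phi> l)))\<^sup>2)
        = (\<Sum>j<N. cis (real j * \<phi> l)) * (\<Sum>i<N. cis (- (real i * \<phi> l)))"
      unfolding complex_norm_square by (simp add: cis_cnj)
    also have "\<dots> = (\<Sum>j<N. \<Sum>i<N. cis (of_int (int j - int i) * \<phi> l))"
      unfolding sum_product by (intro sum.cong) (auto simp: cis_mult algebra_simps)
    finally show ?thesis by (simp add: F_def)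
  qed
  have Fsum: "(\<Sum>l<M. of_real (F l) * cis (of_int e * \<phi> l))
      = of_nat M / of_nat N * of_int (max 0 (int N - \<bar>e\<bar>))" if "\<bar>e\<bar> \<le> 2 * int N" for e
  proof -
    have "(\<Sum>l<M. of_real (F l) * cis (of_int e * \<phi> l))
        = (\<Sum>l<M. \<Sum>j<N. \<Sum>i<N. cis (of_int (int j - int i + e) * \<phi> l)) / of_nat N"
      unfolding Fc sum_divide_distrib times_divide_eq_left sum_distrib_right
      by (intro sum.cong) (auto simp: cis_mult algebra_simps)
    also have "(\<Sum>l<M. \<Sum>j<N. \<Sum>i<N. cis (of_int (int j - int i + e) * \<phi> l))
        = (\<Sum>j<N. \<Sum>l<M. \<Sum>i<N. cis (of_int (int j - int i + e) * \<phi> l))"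
      by (rule sum.swap)
    also have "\<dots> = (\<Sum>j<N. \<Sum>i<N. \<Sum>l<M. cis (of_int (int j - int i + e) * \<phi> l))"
      by (rule sum.cong[OF refl]) (rule sum.swap)
    also have "\<dots> = (\<Sum>j<N. \<Sum>i<N. of_nat M * (if int j - int i + e = 0 then 1 else 0))"
    proof (intro sum.cong refl)
      fix j i assume "j \<in> {..<N}" "i \<in> {..<N}"
      then have "\<bar>int j - int i + e\<bar> < int M" using that unfolding M_def by auto
      from sum_cis_roots_of_unity[OF M this]
      show "(\<Sum>l<M. cis (of_int (int j - int i + e) * \<phi> l))
          = of_nat M * (if int j - int i + e = 0 then 1 else 0)"
        unfolding \<phi>_def by auto
    qed
    also have "\<dots> = of_nat M * of_int (max 0 (int N - \<bar>e\<bar>))"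
      unfolding sum_shifted_diagonal[symmetric] sum_distrib_left ..
    finally show ?thesis by simp
  qed
  have "complex_of_real (\<Sum>l<M. F l) = of_nat M"
    using Fsum[of 0] assms by simp
  then have Ftot: "(\<Sum>l<M. F l) = real M"
    by (metis of_real_eq_iff of_real_of_nat_eq)
  show thesis
  proof
    have "(\<Sum>l<M. \<bar>c l\<bar>) \<le> (\<Sum>l<M. 2 * real N / real M * F l)"
    proof (intro sum_mono)
      fix l
      have "\<bar>c l\<bar> = 2 * real N / real M * F l * \<bar>sin (real N * \<phi> l)\<bar>"
        unfolding c_def abs_mult using F0[of l] by simp
      also have "\<dots> \<le> 2 * real N / real M * F l * 1"
        by (intro mult_left_mono) (auto simp: F0)
      finally show "\<bar>c l\<bar> \<le> 2 * real N / real M * F l" by simp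
    qed
    also have "\<dots> = 2 * real N" unfolding sum_distrib_left[symmetric] Ftot using M by simp
    finally show "(\<Sum>l<M. \<bar>c l\<bar>) \<le> 2 * real N" .
  next
    fix k :: int assume k: "\<bar>k\<bar> \<le> int N"
    have "of_real (c l) * cis (of_int k * \<phi> l) = - \<i> * (of_nat N / of_nat M) *
        (of_real (F l) * cis (of_int (int N + k) * \<phi> l) - of_real (F l) * cis (of_int (k - int N) * \<phi> l))" for l
    proof -
      have s: "2 * complex_of_real (sin (real N * \<phi> l)) = - \<i> * (cis (real N * \<phi> l) - cis (- (real N * \<phi> l)))"
        by (simp add: complex_eq_iff)
      have "of_real (c l) * cis (of_int k * \<phi> l) = (of_nat N / of_nat M) * of_real (F l) *
          (2 * complex_of_real (sin (real N * \<phi> l))) * cis (of_int k * \<phi> l)"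
        by (simp add: c_def)
      also have "\<dots> = - \<i> * (of_nat N / of_nat M) * of_real (F l) *
          (cis (real N * \<phi> l) * cis (of_int k * \<phi> l) - cis (- (real N * \<phi> l)) * cis (of_int k * \<phi> l))"
        unfolding s by (simp add: algebra_simps)
      finally show ?thesis by (simp add: cis_mult algebra_simps)
    qed
    \<comment> \<open>The sine moves the Fejer coefficients to two triangles centred at the
      frequencies \<open>- N\<close> and \<open>N\<close>. For \<open>\<bar>k\<bar> \<le> N\<close>
      these contribute multiples of \<open>max 0 (- k)\<close> and \<open>max 0 k\<close>, whose
      difference is linear in \<open>k\<close>.\<close>
    then have "(\<Sum>l<M. of_real (c l) * cis (of_int k * \<phi> l)) = - \<i> * (of_nat N / of_nat M) *
        ((\<Sum>l<M. of_real (F l) * cis (of_int (int N + k) * \<phi> l)) -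
         (\<Sum>l<M. of_real (F l) * cis (of_int (k - int N) * \<phi> l)))"
      by (simp only: sum_distrib_left sum_subtractf right_diff_distrib)
    also have "\<dots> = - \<i> * (of_nat N / of_nat M) * (of_nat M / of_nat N) *
        (of_int (max 0 (- k)) - of_int (max 0 k))"
    proof -
      have e: "max 0 (int N - \<bar>int N + k\<bar>) = max 0 (- k)"
        "int N - \<bar>k - int N\<bar> = k" using k by auto
      have "(\<Sum>l<M. of_real (F l) * cis (of_int (int N + k) * \<phi> l))
          = of_nat M / of_nat N * of_int (max 0 (- k))"
        using Fsum[of "int N + k"] k e(1) by auto
      moreover have "(\<Sum>l<M. of_real (F l) * cis (of_int (k - int N) * \<phi> l))
          = of_nat M / of_nat N * of_int (max 0 k)"
        using Fsum[of "k - int N"] k e(2) by auto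
      ultimately show ?thesis by (simp only: right_diff_distrib mult.assoc)
    qed
    also have "\<dots> = \<i> * of_int k"
    proof -
      have "complex_of_int (max 0 (- k)) - of_int (max 0 k) = - of_int k"
        by (auto simp: max_def)
      then show ?thesis using M assms by simp
    qed
    finally show "(\<Sum>l<M. of_real (c l) * cis (of_int k * \<phi> l)) = \<i> * of_int k" .
  qed
qed

text \<open>\<open>sin \<theta> ^ j\<close> is a combination of exponentials with frequencies
  \<open>2 * m - j\<close>, all in the range where the node rule differentiates exactly; the rule
  commutes with translation in \<open>\<theta>\<close>.\<close>

lemma sin_power_deriv_nodes:
  fixes c \<phi> :: "nat \<Rightarrow> real"
  assumes "\<And>k::int. \<bar>k\<bar> \<le> int N \<Longrightarrow> (\<Sum>l<M. of_real (c l) * cis (of_int k * \<phi> l)) = \<i> * of_int k"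
    and "j \<le> N"
  shows "real j * sin \<theta> ^ (j - 1) * cos \<theta> = (\<Sum>l<M. c l * sin (\<theta> + \<phi> l) ^ j)"
proof -
  define a :: "nat \<Rightarrow> complex" where "a m = of_nat (j choose m) * (- 1) ^ (j - m) / (2 * \<i>) ^ j" for m
  define k where "k m = 2 * int m - int j" for m
  have expand: "complex_of_real (sin \<theta> ^ j) = (\<Sum>m\<le>j. a m * cis (of_int (k m) * \<theta>))" for \<theta>
  proof -
    have "complex_of_real (sin \<theta>) = (cis \<theta> + - cis (- \<theta>)) / (2 * \<i>)"
      by (simp add: complex_eq_iff)
    then have "complex_of_real (sin \<theta> ^ j) = (cis \<theta> + - cis (- \<theta>)) ^ j / (2 * \<i>) ^ j"
      by (simp only: of_real_power power_divide)
    also have "\<dots> = (\<Sum>m\<le>j. of_nat (j choose m) * cis \<theta> ^ m * (- cis (- \<theta>)) ^ (j - m)) / (2 * \<i>) ^ j"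
      unfolding binomial_ring ..
    also have "\<dots> = (\<Sum>m\<le>j. a m * cis (of_int (k m) * \<theta>))"
      unfolding sum_divide_distrib
    proof (intro sum.cong refl)
      fix m assume "m \<in> {..j}"
      then have "real m * \<theta> + - (real (j - m) * \<theta>) = of_int (k m) * \<theta>"
        unfolding k_def by (simp add: of_nat_diff algebra_simps)
      then have "cis \<theta> ^ m * cis (- \<theta>) ^ (j - m) = cis (of_int (k m) * \<theta>)"
        unfolding Complex.DeMoivre cis_mult by simp
      then show "of_nat (j choose m) * cis \<theta> ^ m * (- cis (- \<theta>)) ^ (j - m) / (2 * \<i>) ^ j
          = a m * cis (of_int (k m) * \<theta>)"
        unfolding a_def power_minus[of "cis (- \<theta>)"] by (simp add: mult_ac)
    qed
    finally show ?thesis .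
  qed
  have kN: "\<bar>k m\<bar> \<le> int N" if "m \<le> j" for m using that assms(2) unfolding k_def by auto
  have "((\<lambda>\<theta>. complex_of_real (sin \<theta> ^ j)) has_vector_derivative
      of_real (real j * sin \<theta> ^ (j - 1) * cos \<theta>)) (at \<theta>)"
    by (rule bounded_linear.has_vector_derivative[OF bounded_linear_of_real])
      (auto intro!: derivative_eq_intros simp flip: has_real_derivative_iff_has_vector_derivative)
  moreover have "((\<lambda>\<theta>. \<Sum>m\<le>j. a m * cis (of_int (k m) * \<theta>)) has_vector_derivative
      (\<Sum>m\<le>j. a m * (of_int (k m) * (\<i> * cis (of_int (k m) * \<theta>))))) (at \<theta>)"
    by (intro has_vector_derivative_sum has_vector_derivative_mult_right)
      (auto intro!: derivative_eq_intros simp: has_vector_derivative_complex_iff)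
  ultimately have "complex_of_real (real j * sin \<theta> ^ (j - 1) * cos \<theta>)
      = (\<Sum>m\<le>j. a m * (of_int (k m) * (\<i> * cis (of_int (k m) * \<theta>))))"
    unfolding expand by (rule vector_derivative_unique_at)
  also have "\<dots> = (\<Sum>m\<le>j. a m * cis (of_int (k m) * \<theta>) * (\<Sum>l<M. of_real (c l) * cis (of_int (k m) * \<phi> l)))"
    by (intro sum.cong refl, subst assms(1)) (auto intro: kN)
  also have "\<dots> = (\<Sum>l<M. of_real (c l) * (\<Sum>m\<le>j. a m * cis (of_int (k m) * (\<theta> + \<phi> l))))"
    unfolding sum_distrib_left
    by (subst sum.swap) (intro sum.cong refl, simp add: cis_mult distrib_left mult_ac flip: cis_mult)
  also have "\<dots> = complex_of_real (\<Sum>l<M. c l * sin (\<theta> + \<phi> l) ^ j)"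
    unfolding expand[symmetric] by simp
  finally show ?thesis unfolding of_real_eq_iff .
qed

lemma poly_sin_deriv_nodes:
  fixes c \<phi> :: "nat \<Rightarrow> real"
  assumes "\<And>k::int. \<bar>k\<bar> \<le> int N \<Longrightarrow> (\<Sum>l<M. of_real (c l) * cis (of_int k * \<phi> l)) = \<i> * of_int k"
    and "degree p \<le> N"
  shows "((\<lambda>\<theta>. poly p (r * sin \<theta>)) has_real_derivative (\<Sum>l<M. c l * poly p (r * sin (\<theta> + \<phi> l)))) (at \<theta>)"
proof -
  have "((\<lambda>\<theta>. \<Sum>j\<le>degree p. coeff p j * r ^ j * sin \<theta> ^ j) has_real_derivative
     (\<Sum>j\<le>degree p. coeff p j * r ^ j * (real j * sin \<theta> ^ (j - 1) * cos \<theta>))) (at \<theta>)"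
    by (auto intro!: derivative_eq_intros sum.cong)
  moreover have "(\<Sum>j\<le>degree p. coeff p j * r ^ j * (real j * sin \<theta> ^ (j - 1) * cos \<theta>))
      = (\<Sum>j\<le>degree p. coeff p j * r ^ j * (\<Sum>l<M. c l * sin (\<theta> + \<phi> l) ^ j))"
    using assms(2) by (intro sum.cong refl, subst sin_power_deriv_nodes[OF assms(1)]) auto
  moreover have "\<dots> = (\<Sum>l<M. c l * poly p (r * sin (\<theta> + \<phi> l)))"
    unfolding poly_altdef sum_distrib_left
    by (subst sum.swap) (intro sum.cong refl, simp add: power_mult_distrib mult_ac)
  ultimately show ?thesis by (simp add: poly_altdef power_mult_distrib mult_ac)
qed

lemma half_le_sin:
  assumes "0 \<le> x" "x \<le> pi / 3"
  shows "x / 2 \<le> sin x"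
proof -
  have "sin 0 - 0 / 2 \<le> sin x - x / 2"
  proof (rule DERIV_nonneg_imp_nondecreasing[OF assms(1)])
    fix y assume "0 \<le> y" "y \<le> x"
    then have "1 / 2 \<le> cos y" using cos_monotone_0_pi_le[of y "pi / 3"] assms(2) by (simp add: cos_60)
    then show "\<exists>z. ((\<lambda>x. sin x - x / 2) has_real_derivative z) (at y) \<and> 0 \<le> z"
      by (intro exI[of _ "cos y - 1 / 2"]) (auto intro!: derivative_eq_intros)
  qed
  then show ?thesis by simp
qed

text \<open>Under \<open>t = r * sin \<theta>\<close> a polynomial becomes trigonometric, its
  derivative is a fixed combination of translates, and integrating over
  \<open>\<bar>\<theta>\<bar> \<le> \<epsilon> / N\<close> yields a measure depending on
  \<open>N\<close>, \<open>r\<close> and \<open>\<epsilon>\<close> but not on \<open>p\<close>. This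
  independence permits products over coordinates and integration over base points later on.\<close>

lemma poly_averaging_measure:
  fixes N :: nat and r \<epsilon> :: real
  assumes "N > 0" "r > 0" "0 < \<epsilon>" "\<epsilon> \<le> 1"
  obtains \<nu> :: "real measure"
  where "sets \<nu> = sets borel" "emeasure \<nu> UNIV \<le> 5" "AE t in \<nu>. \<bar>t\<bar> \<le> r"
    "\<And>p h. degree p \<le> N \<Longrightarrow> \<bar>h\<bar> \<le> \<epsilon> * r / (2 * N) \<Longrightarrow>
      ennreal \<bar>poly p h - poly p 0\<bar> \<le> ennreal \<epsilon> * (\<integral>\<^sup>+t. ennreal \<bar>poly p t\<bar> \<partial>\<nu>) \<and>
      ennreal \<bar>poly p h\<bar> \<le> (\<integral>\<^sup>+t. ennreal \<bar>poly p t\<bar> \<partial>\<nu>)"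
proof -
  obtain M :: nat and c \<phi> where c: "(\<Sum>l<M. \<bar>c l\<bar>) \<le> 2 * real N"
    and nodes: "\<And>k::int. \<bar>k\<bar> \<le> int N \<Longrightarrow> (\<Sum>l<M. of_real (c l) * cis (of_int k * \<phi> l)) = \<i> * of_int k"
    using bernstein_nodes[OF assms(1)] by metis
  define \<eta> where "\<eta> = \<epsilon> / N"
  have \<eta>: "\<eta> > 0" using assms by (simp add: \<eta>_def)
  have \<eta>1: "\<eta> \<le> 1" using assms by (simp add: \<eta>_def field_simps)
  text \<open>The node \<open>M\<close> carries a unit point mass at \<open>0\<close>.\<close>
  define w where "w l = (if l < M then \<bar>c l\<bar> / \<epsilon> else 1 / (2 * \<eta>))" for l
  define \<psi> where "\<psi> = (\<lambda>(l, s). if l < M then r * sin (s + \<phi> l) else 0)"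
  define L where "L = density lborel (\<lambda>s. indicator {-\<eta>..\<eta>} s :: ennreal)"
  define A where "A = density (count_space {..M}) (\<lambda>l. ennreal (w l))"
  define \<nu> where "\<nu> = distr (A \<Otimes>\<^sub>M L) borel \<psi>"
  have w0: "w l \<ge> 0" for l using assms \<eta> by (simp add: w_def)
  have [measurable_cong]: "sets L = sets borel" "sets A = sets (count_space {..M})"
    by (simp_all add: L_def A_def)
  interpret L: finite_measure L
    by standard (use \<eta> in \<open>simp add: L_def emeasure_density\<close>)
  have meas: "\<psi> \<in> borel_measurable (A \<Otimes>\<^sub>M L)"
  proof -
    have "\<psi> \<in> borel_measurable (count_space {..M} \<Otimes>\<^sub>M borel)"
      unfolding \<psi>_def by (rule measurable_pair_measure_countable1) auto
    then show ?thesis by (simp cong: measurable_cong_sets sets_pair_measure_cong)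
  qed
  have int: "(\<integral>\<^sup>+t. g t \<partial>\<nu>) = (\<Sum>l<M. ennreal (\<bar>c l\<bar> / \<epsilon>) * (\<integral>\<^sup>+s. g (r * sin (s + \<phi> l)) * indicator {-\<eta>..\<eta>} s \<partial>lborel)) + g 0"
    if [measurable]: "g \<in> borel_measurable borel" for g :: "real \<Rightarrow> ennreal"
  proof -
    have "(\<integral>\<^sup>+t. g t \<partial>\<nu>) = (\<integral>\<^sup>+x. g (\<psi> x) \<partial>(A \<Otimes>\<^sub>M L))"
      unfolding \<nu>_def by (rule nn_integral_distr[OF meas]) simp
    also have "\<dots> = (\<integral>\<^sup>+l. \<integral>\<^sup>+s. g (\<psi> (l, s)) \<partial>L \<partial>A)"
      by (rule L.nn_integral_fst[symmetric]) (use meas in measurable)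
    also have "\<dots> = (\<Sum>l\<le>M. ennreal (w l) * (\<integral>\<^sup>+s. g (\<psi> (l, s)) \<partial>L))"
      unfolding A_def by (subst nn_integral_density) (auto simp: nn_integral_count_space_finite)
    also have "\<dots> = (\<Sum>l<M. ennreal (w l) * (\<integral>\<^sup>+s. g (\<psi> (l, s)) \<partial>L)) + ennreal (w M) * (\<integral>\<^sup>+s. g (\<psi> (M, s)) \<partial>L)"
      by (simp add: lessThan_Suc_atMost[symmetric])
    also have "ennreal (w M) * (\<integral>\<^sup>+s. g (\<psi> (M, s)) \<partial>L) = g 0"
    proof -
      have "(\<integral>\<^sup>+s. g (\<psi> (M, s)) \<partial>L) = ennreal (2 * \<eta>) * g 0"
        using \<eta> by (simp add: \<psi>_def L_def emeasure_density mult.commute)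
      then show ?thesis using \<eta> by (simp add: w_def mult.assoc[symmetric] ennreal_mult[symmetric])
    qed
    also have "(\<Sum>l<M. ennreal (w l) * (\<integral>\<^sup>+s. g (\<psi> (l, s)) \<partial>L))
        = (\<Sum>l<M. ennreal (\<bar>c l\<bar> / \<epsilon>) * (\<integral>\<^sup>+s. g (r * sin (s + \<phi> l)) * indicator {-\<eta>..\<eta>} s \<partial>lborel))"
      by (intro sum.cong refl) (simp add: w_def \<psi>_def L_def nn_integral_density mult.commute)
    finally show ?thesis .
  qed
  show thesis
  proof
    show "sets \<nu> = sets borel" by (simp add: \<nu>_def)
    have "emeasure \<nu> UNIV = (\<integral>\<^sup>+t. 1 \<partial>\<nu>)" by (simp add: \<nu>_def)
    also have "\<dots> = (\<Sum>l<M. ennreal (\<bar>c l\<bar> / \<epsilon>) * ennreal (2 * \<eta>)) + 1"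
      using \<eta> by (subst int) auto
    also have "\<dots> = ennreal (\<Sum>l<M. \<bar>c l\<bar> * (2 * \<eta> / \<epsilon>)) + 1"
      using \<eta> assms by (simp add: ennreal_mult[symmetric])
    also have "\<dots> = ennreal ((\<Sum>l<M. \<bar>c l\<bar>) * (2 * \<eta> / \<epsilon>) + 1)"
      unfolding sum_distrib_right[symmetric] using \<eta> assms
      by (subst ennreal_plus) (auto intro!: mult_nonneg_nonneg sum_nonneg)
    \<comment> \<open>The nodes have total weight \<open>2 * N\<close>, the interval of angles has
      length \<open>2 * \<epsilon> / N\<close>, and the factor \<open>\<epsilon>\<close> of the
      estimate has been divided out: this gives 4, and the point mass adds 1.\<close>
    also have "\<dots> \<le> ennreal (2 * real N * (2 * \<eta> / \<epsilon>) + 1)"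
      using c \<eta> assms by (intro ennreal_leI add_mono mult_right_mono) auto
    also have "\<dots> = 5" using assms by (simp add: \<eta>_def)
    finally show "emeasure \<nu> UNIV \<le> 5" .
    have "\<bar>\<psi> x\<bar> \<le> r" for x
    proof (cases x)
      case (Pair l s)
      have "r * \<bar>sin (s + \<phi> l)\<bar> \<le> r * 1" using assms by (intro mult_left_mono) auto
      then show ?thesis using Pair assms by (simp add: \<psi>_def abs_mult)
    qed
    then show "AE t in \<nu>. \<bar>t\<bar> \<le> r"
      unfolding \<nu>_def by (subst AE_distr_iff[OF meas]) auto
  next
    fix p :: "real poly" and h :: real
    assume p: "degree p \<le> N" and h: "\<bar>h\<bar> \<le> \<epsilon> * r / (2 * N)"
    define T where "T \<theta> = poly p (r * sin \<theta>)" for \<theta>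
    define T' where "T' \<theta> = (\<Sum>l<M. c l * T (\<theta> + \<phi> l))" for \<theta>
    have T: "(T has_real_derivative T' \<theta>) (at \<theta>)" for \<theta>
      using poly_sin_deriv_nodes[OF nodes p] unfolding T_def T'_def by blast
    have contT: "continuous_on UNIV T" unfolding T_def by (intro continuous_intros)
    have contT': "continuous_on UNIV T'" unfolding T'_def
      by (intro continuous_intros continuous_on_compose2[OF contT]) auto
    have [measurable]: "T \<in> borel_measurable borel" "T' \<in> borel_measurable borel"
      using contT contT' by (auto intro: borel_measurable_continuous_onI)
    define \<theta> where "\<theta> = arcsin (h / r)"
    have hr: "\<bar>h / r\<bar> \<le> \<eta> / 2" using h assms by (simp add: \<eta>_def field_simps)
    then have hr1: "\<bar>h / r\<bar> \<le> 1" using \<eta>1 by linarith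
    have sin\<theta>: "r * sin \<theta> = h" unfolding \<theta>_def using hr1 assms by (subst sin_arcsin) (auto simp: abs_le_iff minus_le_iff simp del: abs_divide)
    \<comment> \<open>The factor 2 in the bound on \<open>h\<close> pays for inverting the sine by
      \<open>half_le_sin\<close>.\<close>
    have \<theta>: "\<bar>\<theta>\<bar> \<le> \<eta>"
    proof -
      have "arcsin (- (1/2)) \<le> \<theta>" "\<theta> \<le> arcsin (1/2)"
        unfolding \<theta>_def using hr \<eta>1 by (intro arcsin_le_arcsin; linarith)+
      then have b: "\<bar>\<theta>\<bar> \<le> pi / 3" by (simp add: arcsin_minus)
      have s: "\<bar>sin \<theta>\<bar> \<le> \<eta> / 2" using hr assms unfolding sin\<theta>[symmetric] by simp
      have "\<bar>\<theta>\<bar> / 2 \<le> \<bar>sin \<theta>\<bar>"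
        using half_le_sin[of "\<bar>\<theta>\<bar>"] b by (auto simp: abs_if split: if_splits)
      then show ?thesis using s by simp
    qed
    have int_T: "(\<integral>\<^sup>+t. ennreal \<bar>poly p t\<bar> \<partial>\<nu>) = (\<Sum>l<M. ennreal (\<bar>c l\<bar> / \<epsilon>) * (\<integral>\<^sup>+s. ennreal \<bar>T (s + \<phi> l)\<bar> * indicator {-\<eta>..\<eta>} s \<partial>lborel)) + ennreal \<bar>poly p 0\<bar>"
      by (subst int) (auto simp: T_def intro!: borel_measurable_continuous_onI continuous_intros)
    have diff: "ennreal \<bar>T \<theta> - T 0\<bar> \<le> (\<integral>\<^sup>+s. ennreal \<bar>T' s\<bar> * indicator {-\<eta>..\<eta>} s \<partial>lborel)"
    proof -
      define x y where "x = min 0 \<theta>" and "y = max 0 \<theta>"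
      have xy: "x \<le> y" "{x..y} \<subseteq> {-\<eta>..\<eta>}" using \<theta> \<eta> by (auto simp: x_def y_def)
      have "\<bar>T \<theta> - T 0\<bar> = \<bar>T y - T x\<bar>" by (auto simp: x_def y_def min_def max_def)
      also have "T y - T x = (LBINT s. T' s * indicator {x..y} s)"
        by (subst integral_FTC_Icc_real[symmetric, where F=T])
          (use xy T contT' in \<open>auto intro: continuous_on_eq_continuous_at[THEN iffD1, rule_format, OF open_UNIV]\<close>)
      also have "\<bar>\<dots>\<bar> \<le> (LBINT s. \<bar>T' s * indicator {x..y} s\<bar>)"
        by (rule integral_abs_bound)
      finally have "ennreal \<bar>T \<theta> - T 0\<bar> \<le> ennreal (LBINT s. \<bar>T' s * indicator {x..y} s\<bar>)"
        by (rule ennreal_leI)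
      also have "\<dots> \<le> (\<integral>\<^sup>+s. ennreal \<bar>T' s * indicator {x..y} s\<bar> \<partial>lborel)"
        by (cases "integrable lborel (\<lambda>s. \<bar>T' s * indicator {x..y} s\<bar>)")
          (auto simp: nn_integral_eq_integral not_integrable_integral_eq)
      also have "\<dots> \<le> (\<integral>\<^sup>+s. ennreal \<bar>T' s\<bar> * indicator {-\<eta>..\<eta>} s \<partial>lborel)"
        using xy by (intro nn_integral_mono) (auto simp: indicator_def)
      finally show ?thesis .
    qed
    also have "\<dots> \<le> (\<integral>\<^sup>+s. (\<Sum>l<M. ennreal \<bar>c l\<bar> * (ennreal \<bar>T (s + \<phi> l)\<bar> * indicator {-\<eta>..\<eta>} s)) \<partial>lborel)"
    proof (intro nn_integral_mono)
      fix s
      have "\<bar>T' s\<bar> \<le> (\<Sum>l<M. \<bar>c l\<bar> * \<bar>T (s + \<phi> l)\<bar>)"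
        unfolding T'_def abs_mult[symmetric] by (rule sum_abs)
      then have "ennreal \<bar>T' s\<bar> \<le> (\<Sum>l<M. ennreal \<bar>c l\<bar> * ennreal \<bar>T (s + \<phi> l)\<bar>)"
        by (simp add: ennreal_mult[symmetric] sum_nonneg ennreal_leI)
      then show "ennreal \<bar>T' s\<bar> * indicator {-\<eta>..\<eta>} s
          \<le> (\<Sum>l<M. ennreal \<bar>c l\<bar> * (ennreal \<bar>T (s + \<phi> l)\<bar> * indicator {-\<eta>..\<eta>} s))"
        by (auto simp: indicator_def)
    qed
    also have "\<dots> = (\<Sum>l<M. ennreal \<bar>c l\<bar> * (\<integral>\<^sup>+s. ennreal \<bar>T (s + \<phi> l)\<bar> * indicator {-\<eta>..\<eta>} s \<partial>lborel))"
      by (simp add: nn_integral_sum nn_integral_cmult)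
    also have "\<dots> = ennreal \<epsilon> * (\<Sum>l<M. ennreal (\<bar>c l\<bar> / \<epsilon>) * (\<integral>\<^sup>+s. ennreal \<bar>T (s + \<phi> l)\<bar> * indicator {-\<eta>..\<eta>} s \<partial>lborel))"
      using assms by (simp add: sum_distrib_left mult.assoc[symmetric] ennreal_mult[symmetric])
    finally have *: "ennreal \<bar>poly p h - poly p 0\<bar> \<le> ennreal \<epsilon> * (\<Sum>l<M. ennreal (\<bar>c l\<bar> / \<epsilon>) * (\<integral>\<^sup>+s. ennreal \<bar>T (s + \<phi> l)\<bar> * indicator {-\<eta>..\<eta>} s \<partial>lborel))"
      (is "_ \<le> _ * ?R") by (simp add: T_def sin\<theta>)
    \<comment> \<open>The triangle inequality through \<open>poly p 0\<close> is what the point mass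
      at \<open>0\<close> is for; \<open>\<epsilon> \<le> 1\<close> absorbs the factor in front of
      the node part.\<close>
    have "ennreal \<bar>poly p h\<bar> \<le> ennreal (\<bar>poly p h - poly p 0\<bar> + \<bar>poly p 0\<bar>)"
      by (rule ennreal_leI) simp
    also have "\<dots> \<le> 1 * ?R + ennreal \<bar>poly p 0\<bar>"
      unfolding ennreal_plus[OF abs_ge_zero abs_ge_zero]
      using assms by (intro add_right_mono order.trans[OF *] mult_right_mono) (auto simp flip: ennreal_1 intro: ennreal_leI)
    finally have "ennreal \<bar>poly p h\<bar> \<le> ?R + ennreal \<bar>poly p 0\<bar>" by simp
    moreover have "ennreal \<epsilon> * ?R \<le> ennreal \<epsilon> * (?R + ennreal \<bar>poly p 0\<bar>)"
      by (intro mult_left_mono) auto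
    ultimately show "ennreal \<bar>poly p h - poly p 0\<bar> \<le> ennreal \<epsilon> * (\<integral>\<^sup>+t. ennreal \<bar>poly p t\<bar> \<partial>\<nu>) \<and>
      ennreal \<bar>poly p h\<bar> \<le> (\<integral>\<^sup>+t. ennreal \<bar>poly p t\<bar> \<partial>\<nu>)"
      unfolding int_T using * by (auto intro: order.trans)
  qed
qed

section \<open>Averaging measures in several variables\<close>

definition coordinatewise_poly :: "nat \<Rightarrow> ('a::euclidean_space \<Rightarrow> real) \<Rightarrow> bool" where
  "coordinatewise_poly N F \<longleftrightarrow>
     (\<forall>x. \<forall>b\<in>Basis. \<exists>p. degree p \<le> N \<and> (\<forall>t. F (x + t *\<^sub>R b) = poly p t))"

lemma coordinatewise_poly_translate:
  assumes "coordinatewise_poly N F"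
  shows "coordinatewise_poly N (\<lambda>x. F (x + a))"
  unfolding coordinatewise_poly_def
proof (intro allI ballI)
  fix x b :: 'a assume "b \<in> Basis"
  then have "\<exists>p. degree p \<le> N \<and> (\<forall>t. F (x + a + t *\<^sub>R b) = poly p t)"
    using assms unfolding coordinatewise_poly_def by blast
  moreover have "x + a + t *\<^sub>R b = x + t *\<^sub>R b + a" for t by (simp only: ac_simps)
  ultimately show "\<exists>p. degree p \<le> N \<and> (\<forall>t. F (x + t *\<^sub>R b + a) = poly p t)" by simp
qed

text \<open>The measure is a product of one-dimensional ones, built one basis direction at a time;
  \<open>B\<close> collects the directions treated so far, hence the vanishing conditions outside
  \<open>B\<close>. Only degrees along coordinate lines enter. The second inequality is carried
  along because the induction step has to dominate point values as well as differences.\<close>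

lemma coordinate_averaging_measure:
  fixes N :: nat and r \<epsilon> :: real and B :: "'a::euclidean_space set"
  assumes N: "N > 0" and r: "r > 0" and \<epsilon>: "0 < \<epsilon>" "\<epsilon> \<le> 1" and "B \<subseteq> Basis"
  shows "\<exists>\<mu> :: 'a measure. sets \<mu> = sets borel \<and> emeasure \<mu> UNIV \<le> 5 ^ card B \<and>
     (AE y in \<mu>. (\<forall>b\<in>B. \<bar>y \<bullet> b\<bar> \<le> r) \<and> (\<forall>b\<in>Basis - B. y \<bullet> b = 0)) \<and>
     (\<forall>F h. F \<in> borel_measurable borel \<and> coordinatewise_poly N F \<and>
        (\<forall>b\<in>B. \<bar>h \<bullet> b\<bar> \<le> \<epsilon> * r / (2 * N)) \<and> (\<forall>b\<in>Basis - B. h \<bullet> b = 0) \<longrightarrow>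
        ennreal \<bar>F h - F 0\<bar> \<le> ennreal (card B * \<epsilon>) * (\<integral>\<^sup>+y. ennreal \<bar>F y\<bar> \<partial>\<mu>) \<and>
        ennreal \<bar>F h\<bar> \<le> (\<integral>\<^sup>+y. ennreal \<bar>F y\<bar> \<partial>\<mu>))"
proof -
  have "finite B" using assms(5) by (rule finite_subset) simp
  then show ?thesis using assms(5)
  proof (induction B rule: finite_induct)
    case empty
    have zero: "h = 0" if "\<forall>b\<in>Basis. h \<bullet> b = 0" for h :: 'a
      by (rule euclidean_eqI) (use that in simp)
    show ?case
    proof (intro exI[of _ "distr (count_space (UNIV :: unit set)) borel (\<lambda>_. 0::'a)"] conjI allI impI)
      let ?\<delta> = "distr (count_space (UNIV :: unit set)) borel (\<lambda>_. 0::'a)"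
      show "sets ?\<delta> = sets borel" by simp
      show "emeasure ?\<delta> UNIV \<le> 5 ^ card {}" by (subst emeasure_distr) auto
      show "AE y in ?\<delta>. (\<forall>b\<in>{}. \<bar>y \<bullet> b\<bar> \<le> r) \<and> (\<forall>b\<in>Basis - {}. y \<bullet> b = 0)"
        by (subst AE_distr_iff) auto
      fix F :: "'a \<Rightarrow> real" and h :: 'a
      assume asm: "F \<in> borel_measurable borel \<and> coordinatewise_poly N F \<and>
        (\<forall>b\<in>{}. \<bar>h \<bullet> b\<bar> \<le> \<epsilon> * r / (2 * N)) \<and> (\<forall>b\<in>Basis - {}. h \<bullet> b = 0)"
      have "h = 0" by (rule zero) (use asm in auto)
      have "(\<integral>\<^sup>+y. ennreal \<bar>F y\<bar> \<partial>?\<delta>) = ennreal \<bar>F 0\<bar>"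
        using asm by (subst nn_integral_distr) (auto simp: nn_integral_count_space_finite)
      with \<open>h = 0\<close>
      show "ennreal \<bar>F h - F 0\<bar> \<le> ennreal (card {} * \<epsilon>) * (\<integral>\<^sup>+y. ennreal \<bar>F y\<bar> \<partial>?\<delta>)"
        and "ennreal \<bar>F h\<bar> \<le> (\<integral>\<^sup>+y. ennreal \<bar>F y\<bar> \<partial>?\<delta>)" by simp_all
    qed
  next
    case (insert b B)
    then have b: "b \<in> Basis" "b \<notin> B" and B: "B \<subseteq> Basis" by auto
    from insert.IH[OF B] obtain \<mu> :: "'a measure" where \<mu>: "sets \<mu> = sets borel \<and> emeasure \<mu> UNIV \<le> 5 ^ card B \<and>
       (AE y in \<mu>. (\<forall>b\<in>B. \<bar>y \<bullet> b\<bar> \<le> r) \<and> (\<forall>b\<in>Basis - B. y \<bullet> b = 0)) \<and>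
       (\<forall>F h. F \<in> borel_measurable borel \<and> coordinatewise_poly N F \<and>
          (\<forall>b\<in>B. \<bar>h \<bullet> b\<bar> \<le> \<epsilon> * r / (2 * N)) \<and> (\<forall>b\<in>Basis - B. h \<bullet> b = 0) \<longrightarrow>
          ennreal \<bar>F h - F 0\<bar> \<le> ennreal (card B * \<epsilon>) * (\<integral>\<^sup>+y. ennreal \<bar>F y\<bar> \<partial>\<mu>) \<and>
          ennreal \<bar>F h\<bar> \<le> (\<integral>\<^sup>+y. ennreal \<bar>F y\<bar> \<partial>\<mu>))"
      by (elim exE)
    note sets\<mu> = \<mu>[THEN conjunct1] and mass\<mu> = \<mu>[THEN conjunct2, THEN conjunct1]
      and AE\<mu> = \<mu>[THEN conjunct2, THEN conjunct2, THEN conjunct1]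
    note IH = \<mu>[THEN conjunct2, THEN conjunct2, THEN conjunct2, rule_format, OF conjI[OF _ conjI[OF _ conjI]]]
    obtain \<nu> :: "real measure" where sets\<nu>: "sets \<nu> = sets borel" and mass\<nu>: "emeasure \<nu> UNIV \<le> 5"
      and AE\<nu>: "AE t in \<nu>. \<bar>t\<bar> \<le> r"
      and \<nu>: "\<And>p h. degree p \<le> N \<Longrightarrow> \<bar>h\<bar> \<le> \<epsilon> * r / (2 * N) \<Longrightarrow>
        ennreal \<bar>poly p h - poly p 0\<bar> \<le> ennreal \<epsilon> * (\<integral>\<^sup>+t. ennreal \<bar>poly p t\<bar> \<partial>\<nu>) \<and>
        ennreal \<bar>poly p h\<bar> \<le> (\<integral>\<^sup>+t. ennreal \<bar>poly p t\<bar> \<partial>\<nu>)"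
      by (rule poly_averaging_measure[OF N r \<epsilon>]) (rule that, assumption+)
    note [measurable_cong] = sets\<mu> sets\<nu>
    have spaces: "space \<mu> = UNIV" "space \<nu> = UNIV"
      using sets_eq_imp_space_eq[OF sets\<mu>] sets_eq_imp_space_eq[OF sets\<nu>] by simp_all
    have "emeasure \<mu> UNIV < \<infinity>" "emeasure \<nu> UNIV < \<infinity>"
      using mass\<mu> mass\<nu> by (auto intro: le_less_trans simp: power_less_top_ennreal)
    then interpret \<mu>: finite_measure \<mu> + \<nu>: finite_measure \<nu>
      by (auto intro!: finite_measureI simp: spaces)
    interpret P: pair_sigma_finite \<mu> \<nu> ..
    define \<psi> where "\<psi> = (\<lambda>(y, s). y + s *\<^sub>R b)"
    have \<psi>[measurable]: "\<psi> \<in> borel_measurable (\<mu> \<Otimes>\<^sub>M \<nu>)" unfolding \<psi>_def by measurable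
    define \<mu>' where "\<mu>' = distr (\<mu> \<Otimes>\<^sub>M \<nu>) borel \<psi>"
    have int1: "(\<integral>\<^sup>+x. g x \<partial>\<mu>') = (\<integral>\<^sup>+y. \<integral>\<^sup>+s. g (y + s *\<^sub>R b) \<partial>\<nu> \<partial>\<mu>)"
      if [measurable]: "g \<in> borel_measurable borel" for g :: "'a \<Rightarrow> ennreal"
      unfolding \<mu>'_def by (subst nn_integral_distr) (auto simp: \<psi>_def \<nu>.nn_integral_fst[symmetric])
    have int2: "(\<integral>\<^sup>+x. g x \<partial>\<mu>') = (\<integral>\<^sup>+s. \<integral>\<^sup>+y. g (y + s *\<^sub>R b) \<partial>\<mu> \<partial>\<nu>)"
      if [measurable]: "g \<in> borel_measurable borel" for g :: "'a \<Rightarrow> ennreal"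
      unfolding int1[OF that] by (rule P.Fubini'[symmetric]) measurable
    show ?case
    proof (intro exI[of _ \<mu>'] conjI allI impI)
      show "sets \<mu>' = sets borel" by (simp add: \<mu>'_def)
      have "emeasure \<mu>' UNIV = (\<integral>\<^sup>+x. 1 \<partial>\<mu>')" by (simp add: \<mu>'_def)
      also have "\<dots> = emeasure \<nu> UNIV * emeasure \<mu> UNIV" by (subst int1) (auto simp: spaces)
      also have "\<dots> \<le> 5 * 5 ^ card B" by (intro mult_mono mass\<nu> mass\<mu>) auto
      finally show "emeasure \<mu>' UNIV \<le> 5 ^ card (insert b B)" using insert.hyps by simp
      have "AE x in \<mu> \<Otimes>\<^sub>M \<nu>. (\<forall>c\<in>insert b B. \<bar>\<psi> x \<bullet> c\<bar> \<le> r) \<and> (\<forall>c\<in>Basis - insert b B. \<psi> x \<bullet> c = 0)"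
      proof (rule P.AE_pair_measure)
        have "finite (insert b B)" "finite (Basis - insert b B)" using insert.hyps by auto
        then show "{x \<in> space (\<mu> \<Otimes>\<^sub>M \<nu>). (\<forall>c\<in>insert b B. \<bar>\<psi> x \<bullet> c\<bar> \<le> r) \<and> (\<forall>c\<in>Basis - insert b B. \<psi> x \<bullet> c = 0)} \<in> sets (\<mu> \<Otimes>\<^sub>M \<nu>)"
          by measurable
        show "AE y in \<mu>. AE s in \<nu>. (\<forall>c\<in>insert b B. \<bar>\<psi> (y, s) \<bullet> c\<bar> \<le> r) \<and> (\<forall>c\<in>Basis - insert b B. \<psi> (y, s) \<bullet> c = 0)"
          using AE\<mu>
        proof eventually_elim
          case (elim y)
          have ib: "b \<bullet> c = (if c = b then 1 else 0)" if "c \<in> insert b B \<or> c \<in> Basis" for c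
          proof -
            have "c \<in> Basis" using that b(1) B by auto
            then show ?thesis by (subst inner_Basis[OF b(1)]) auto
          qed
          have \<psi>c: "\<psi> (y, s) \<bullet> c = y \<bullet> c + (if c = b then s else 0)" if "c \<in> insert b B \<or> c \<in> Basis" for s c
            unfolding \<psi>_def using ib[OF that] by (simp add: inner_add_left)
          have yb: "y \<bullet> b = 0" using elim b by simp
          show ?case using AE\<nu>
          proof eventually_elim
            case s: (elim s)
            show ?case
            proof (intro conjI ballI)
              fix c assume c: "c \<in> insert b B"
              then show "\<bar>\<psi> (y, s) \<bullet> c\<bar> \<le> r"
                unfolding \<psi>c[OF disjI1[OF c]] using s yb elim by auto
            next
              fix c assume c: "c \<in> Basis - insert b B"
              then have "y \<bullet> c = 0" "c \<noteq> b" "c \<in> Basis" using elim by auto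
              then show "\<psi> (y, s) \<bullet> c = 0" using \<psi>c[of c s] by simp
            qed
          qed
        qed
      qed
      then show "AE y in \<mu>'. (\<forall>c\<in>insert b B. \<bar>y \<bullet> c\<bar> \<le> r) \<and> (\<forall>c\<in>Basis - insert b B. y \<bullet> c = 0)"
        unfolding \<mu>'_def
      proof (subst AE_distr_iff[OF \<psi>])
        have "finite (insert b B)" "finite (Basis - insert b B)" using insert.hyps by auto
        then show "{y \<in> space borel. (\<forall>c\<in>insert b B. \<bar>y \<bullet> c\<bar> \<le> r) \<and> (\<forall>c\<in>Basis - insert b B. y \<bullet> c = 0)} \<in> sets borel"
          by measurable
      qed
    next
      fix F :: "'a \<Rightarrow> real" and h :: 'a
      assume asm: "F \<in> borel_measurable borel \<and> coordinatewise_poly N F \<and>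
        (\<forall>c\<in>insert b B. \<bar>h \<bullet> c\<bar> \<le> \<epsilon> * r / (2 * N)) \<and> (\<forall>c\<in>Basis - insert b B. h \<bullet> c = 0)"
      then have [measurable]: "F \<in> borel_measurable borel" and F: "coordinatewise_poly N F"
        and hB: "\<And>c. c \<in> insert b B \<Longrightarrow> \<bar>h \<bullet> c\<bar> \<le> \<epsilon> * r / (2 * N)"
        and h0: "\<And>c. c \<in> Basis - insert b B \<Longrightarrow> h \<bullet> c = 0" by auto
      define t where "t = h \<bullet> b"
      define h' where "h' = h - t *\<^sub>R b"
      have h: "h = h' + t *\<^sub>R b" by (simp add: h'_def)
      have t: "\<bar>t\<bar> \<le> \<epsilon> * r / (2 * N)" using hB by (simp add: t_def)
      have h'B: "\<forall>c\<in>B. \<bar>h' \<bullet> c\<bar> \<le> \<epsilon> * r / (2 * N)"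
      proof
        fix c assume "c \<in> B"
        then have "b \<bullet> c = 0" using b B by (subst inner_Basis) auto
        then show "\<bar>h' \<bullet> c\<bar> \<le> \<epsilon> * r / (2 * N)" using hB \<open>c \<in> B\<close> by (simp add: h'_def inner_diff_left)
      qed
      have h'0: "\<forall>c\<in>Basis - B. h' \<bullet> c = 0"
      proof
        fix c assume c: "c \<in> Basis - B"
        then have "b \<bullet> c = (if b = c then 1 else 0)" using b by (subst inner_Basis) auto
        then show "h' \<bullet> c = 0" using h0[of c] c b(1) by (auto simp: h'_def inner_diff_left t_def)
      qed
      have trans: "ennreal \<bar>F (h' + s *\<^sub>R b)\<bar> \<le> (\<integral>\<^sup>+y. ennreal \<bar>F (y + s *\<^sub>R b)\<bar> \<partial>\<mu>)" for s
        using IH[OF _ coordinatewise_poly_translate[OF F] h'B h'0, of "s *\<^sub>R b"] by simp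
      have poly1: "ennreal \<bar>F (y + t *\<^sub>R b) - F y\<bar> \<le> ennreal \<epsilon> * (\<integral>\<^sup>+s. ennreal \<bar>F (y + s *\<^sub>R b)\<bar> \<partial>\<nu>) \<and>
          ennreal \<bar>F (y + t *\<^sub>R b)\<bar> \<le> (\<integral>\<^sup>+s. ennreal \<bar>F (y + s *\<^sub>R b)\<bar> \<partial>\<nu>) \<and>
          ennreal \<bar>F y\<bar> \<le> (\<integral>\<^sup>+s. ennreal \<bar>F (y + s *\<^sub>R b)\<bar> \<partial>\<nu>)" for y
      proof -
        from F b(1) obtain p where p: "degree p \<le> N" "\<And>s. F (y + s *\<^sub>R b) = poly p s"
          unfolding coordinatewise_poly_def by blast
        have "F y = poly p 0" using p(2)[of 0] by simp
        moreover have "\<bar>0\<bar> \<le> \<epsilon> * r / (2 * real N)" using r \<epsilon> by simp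
        ultimately show ?thesis using \<nu>[OF p(1) t] \<nu>[OF p(1), of 0] unfolding p(2) by auto
      qed
      let ?I = "\<integral>\<^sup>+x. ennreal \<bar>F x\<bar> \<partial>\<mu>'"
      have avg: "(\<integral>\<^sup>+s. ennreal \<bar>F (h' + s *\<^sub>R b)\<bar> \<partial>\<nu>) \<le> ?I"
        unfolding int2[of "\<lambda>x. ennreal \<bar>F x\<bar>", simplified] by (intro nn_integral_mono trans)
      have "ennreal \<bar>F h\<bar> \<le> (\<integral>\<^sup>+s. ennreal \<bar>F (h' + s *\<^sub>R b)\<bar> \<partial>\<nu>)" using poly1[of h', THEN conjunct2, THEN conjunct1] unfolding h[symmetric] .
      then show "ennreal \<bar>F h\<bar> \<le> ?I" using avg by (rule order.trans)
      \<comment> \<open>\<open>F h - F 0\<close> is split at \<open>h'\<close>. The leg from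
        \<open>h'\<close> to \<open>h\<close> runs along \<open>b\<close>, and \<open>trans\<close>
        spreads every value on that line over \<open>\<mu>\<close>. The leg from \<open>0\<close> to
        \<open>h'\<close> is the induction hypothesis, in which the third part of
        \<open>poly1\<close> replaces point values by \<open>\<nu>\<close>-averages.\<close>
      have "ennreal \<bar>F h - F h'\<bar> \<le> ennreal \<epsilon> * (\<integral>\<^sup>+s. ennreal \<bar>F (h' + s *\<^sub>R b)\<bar> \<partial>\<nu>)"
        using poly1[of h', THEN conjunct1] unfolding h[symmetric] .
      also have "\<dots> \<le> ennreal \<epsilon> * ?I" by (rule mult_left_mono[OF avg]) simp
      finally have 1: "ennreal \<bar>F h - F h'\<bar> \<le> ennreal \<epsilon> * ?I" .
      have "ennreal \<bar>F h' - F 0\<bar> \<le> ennreal (card B * \<epsilon>) * (\<integral>\<^sup>+y. ennreal \<bar>F y\<bar> \<partial>\<mu>)"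
        using IH[OF _ F h'B h'0] by simp
      also have "\<dots> \<le> ennreal (card B * \<epsilon>) * ?I"
        unfolding int1[of "\<lambda>x. ennreal \<bar>F x\<bar>", simplified]
        by (intro mult_left_mono nn_integral_mono) (use poly1 in auto)
      finally have 2: "ennreal \<bar>F h' - F 0\<bar> \<le> ennreal (card B * \<epsilon>) * ?I" .
      have "ennreal \<bar>F h - F 0\<bar> \<le> ennreal (\<bar>F h - F h'\<bar> + \<bar>F h' - F 0\<bar>)"
        by (rule ennreal_leI) simp
      also have "\<dots> \<le> ennreal \<epsilon> * ?I + ennreal (card B * \<epsilon>) * ?I"
        unfolding ennreal_plus[OF abs_ge_zero abs_ge_zero] using 1 2 by (rule add_mono)
      also have "\<dots> = ennreal (card (insert b B) * \<epsilon>) * ?I"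
        using insert.hyps \<epsilon> by (simp add: distrib_right[symmetric] ennreal_plus[symmetric] algebra_simps del: ennreal_plus)
      finally show "ennreal \<bar>F h - F 0\<bar> \<le> ennreal (card (insert b B) * \<epsilon>) * ?I" .
    qed
  qed
qed

lemma averaging_measure:
  fixes N :: nat and r \<epsilon> :: real
  assumes "N > 0" "r > 0" "0 < \<epsilon>" "\<epsilon> \<le> 1"
  obtains \<mu> :: "'a::euclidean_space measure"
  where "sets \<mu> = sets borel" "emeasure \<mu> UNIV \<le> 5 ^ DIM('a)" "AE y in \<mu>. \<forall>b\<in>Basis. \<bar>y \<bullet> b\<bar> \<le> r"
    "\<And>F h. F \<in> borel_measurable borel \<Longrightarrow> coordinatewise_poly N F \<Longrightarrow>
      \<forall>b\<in>Basis. \<bar>h \<bullet> b\<bar> \<le> \<epsilon> * r / (2 * N) \<Longrightarrow>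
      ennreal \<bar>F h - F 0\<bar> \<le> ennreal (DIM('a) * \<epsilon>) * (\<integral>\<^sup>+y. ennreal \<bar>F y\<bar> \<partial>\<mu>)"
  using coordinate_averaging_measure[OF assms, of "Basis :: 'a set"] by auto

section \<open>Extending one-dimensional integrals beyond an endpoint\<close>

text \<open>Chebyshev polynomials of the second kind, equal to
  \<open>sin ((k + 1) * \<theta>) / sin \<theta>\<close> at \<open>cos \<theta>\<close>. With
  \<open>x = cos \<theta>\<close> the unweighted \<open>dx\<close> supplies exactly the factor
  \<open>sin \<theta>\<close> that cancels the denominator, so expansion coefficients are controlled
  by the plain L^1 norm.\<close>

fun chebyshev_U :: "nat \<Rightarrow> real poly" where
  "chebyshev_U 0 = 1"
| "chebyshev_U (Suc 0) = [:0, 2:]"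
| "chebyshev_U (Suc (Suc k)) = [:0, 2:] * chebyshev_U (Suc k) - chebyshev_U k"

lemma degree_chebyshev_U: "degree (chebyshev_U k) \<le> k"
proof (induction k rule: chebyshev_U.induct)
  case (3 k)
  have "degree ([:0, 2:] * chebyshev_U (Suc k)) \<le> Suc (Suc k)"
    using 3(1) by (intro order.trans[OF degree_mult_le]) auto
  then show ?case using 3(2) by (auto intro!: degree_diff_le)
qed auto

lemma coeff_chebyshev_U: "coeff (chebyshev_U k) k = 2 ^ k"
proof (induction k rule: chebyshev_U.induct)
  case (3 k)
  have "coeff (chebyshev_U k) (Suc (Suc k)) = 0"
    using degree_chebyshev_U[of k] by (intro coeff_eq_0) auto
  with 3 show ?case by simp
qed auto

lemma sin_mult_chebyshev_U: "sin \<theta> * poly (chebyshev_U k) (cos \<theta>) = sin (real (Suc k) * \<theta>)"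
proof (induction k rule: chebyshev_U.induct)
  case 2
  then show ?case using sin_double[of \<theta>] by (simp add: mult_ac)
next
  case (3 k)
  have "sin \<theta> * poly (chebyshev_U (Suc (Suc k))) (cos \<theta>)
      = 2 * cos \<theta> * sin (real (Suc (Suc k)) * \<theta>) - sin (real (Suc k) * \<theta>)"
    using 3 by (simp add: algebra_simps)
  also have "\<dots> = sin (real (Suc (Suc k)) * \<theta> + \<theta>)"
  proof -
    have "sin (real (Suc k) * \<theta>) = sin (real (Suc (Suc k)) * \<theta> - \<theta>)" by (simp add: algebra_simps)
    then show ?thesis unfolding sin_add sin_diff by simp
  qed
  also have "real (Suc (Suc k)) * \<theta> + \<theta> = real (Suc (Suc (Suc k))) * \<theta>" by (simp add: algebra_simps)
  finally show ?case .
qed simp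

lemma chebyshev_U_expansion:
  fixes p :: "real poly"
  assumes "degree p \<le> N"
  obtains c :: "nat \<Rightarrow> real" where "p = (\<Sum>k\<le>N. smult (c k) (chebyshev_U k))"
  using assms
proof (induction N arbitrary: p thesis)
  case 0
  then obtain a where "p = [:a:]" by (metis degree_eq_zeroE le_zero_eq)
  then show ?case using "0.prems"(1)[of "\<lambda>_. a"] by simp
next
  case (Suc N)
  define a where "a = coeff p (Suc N) / 2 ^ Suc N"
  define q where "q = p - smult a (chebyshev_U (Suc N))"
  have "coeff q i = 0" if "i > N" for i
  proof (cases "i = Suc N")
    case True then show ?thesis using coeff_chebyshev_U[of "Suc N"] by (simp add: q_def a_def)
  next
    case False
    with that have "i > Suc N" by simp
    then show ?thesis using Suc.prems(2) degree_chebyshev_U[of "Suc N"]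
      by (simp add: q_def coeff_eq_0)
  qed
  then have "degree q \<le> N" by (intro degree_le) auto
  from Suc.IH[OF _ this] obtain c where c: "q = (\<Sum>k\<le>N. smult (c k) (chebyshev_U k))" by blast
  have "p = (\<Sum>k\<le>Suc N. smult ((c(Suc N := a)) k) (chebyshev_U k))"
    using c by (simp add: q_def algebra_simps)
  then show ?case by (rule Suc.prems(1))
qed

text \<open>At \<open>1 + y\<close> the increment of \<open>u\<close> grows by
  \<open>2 * y * u (Suc k)\<close> per step, hence in total by an amount of order
  \<open>y * k\<^sup>2\<close>. The hypothesis keeps the increments below 2, so that the growth
  stays linear in \<open>k\<close>, as at the endpoint \<open>1\<close>.\<close>

lemma chebyshev_U_bound:
  assumes "0 \<le> y" "4 * y * (real N + 1)\<^sup>2 \<le> 1" "k \<le> N"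
  shows "\<bar>poly (chebyshev_U k) (1 + y)\<bar> \<le> 2 * (real k + 1)"
proof -
  define u where "u k = poly (chebyshev_U k) (1 + y)" for k
  have rec: "u (Suc (Suc k)) = 2 * (1 + y) * u (Suc k) - u k" for k
    by (simp add: u_def algebra_simps)
  have "0 \<le> u k \<and> u k \<le> 2 * (real k + 1) \<and> 0 \<le> u (Suc k) - u k \<and> u (Suc k) - u k \<le> 1 + 4 * y * (real k + 1)\<^sup>2"
    if "k \<le> N" for k
    using that
  proof (induction k)
    case 0
    then show ?case using assms(1) by (simp add: u_def algebra_simps)
  next
    case (Suc k)
    then have IH: "0 \<le> u k" "u k \<le> 2 * (real k + 1)" "0 \<le> u (Suc k) - u k"
      "u (Suc k) - u k \<le> 1 + 4 * y * (real k + 1)\<^sup>2" by auto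
    have "4 * y * (real k + 1)\<^sup>2 \<le> 4 * y * (real N + 1)\<^sup>2"
      using Suc.prems assms(1) by (intro mult_left_mono power_mono) auto
    then have 1: "u (Suc k) \<le> 2 * (real (Suc k) + 1)" using IH assms(2) by simp
    have d: "u (Suc (Suc k)) - u (Suc k) = u (Suc k) - u k + 2 * y * u (Suc k)"
      unfolding rec by (simp add: algebra_simps)
    have "2 * y * u (Suc k) \<le> 2 * y * (2 * (real (Suc k) + 1))"
      using 1 assms(1) by (intro mult_left_mono) auto
    moreover have "0 \<le> 2 * y * u (Suc k)" using IH assms(1) by simp
    moreover have "4 * y * (real k + 1)\<^sup>2 + 2 * y * (2 * (real (Suc k) + 1)) \<le> 4 * y * (real (Suc k) + 1)\<^sup>2"
    proof -
      have "(real k + 1)\<^sup>2 + (real (Suc k) + 1) \<le> (real (Suc k) + 1)\<^sup>2" by (simp add: power2_eq_square algebra_simps)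
      from mult_left_mono[OF this, of "4 * y"] show ?thesis using assms(1) by (simp add: algebra_simps)
    qed
    ultimately show ?case using 1 IH d by auto
  qed
  from this[OF assms(3)] show ?thesis by (simp add: u_def)
qed

lemma sin_orthogonality:
  "((\<lambda>\<theta>. sin (real (Suc j) * \<theta>) * sin (real (Suc k) * \<theta>)) has_integral (if j = k then pi / 2 else 0)) {0..pi}"
proof -
  have prod: "sin (real (Suc j) * \<theta>) * sin (real (Suc k) * \<theta>)
      = (cos (of_int (int j - int k) * \<theta>) - cos (of_int (int j + int k + 2) * \<theta>)) / 2" for \<theta>
    unfolding sin_times_sin by (simp add: algebra_simps)
  have cosint: "((\<lambda>\<theta>. cos (of_int m * \<theta>)) has_integral (if m = 0 then pi else 0)) {0..pi}" for m :: int
  proof (cases "m = 0")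
    case True
    then show ?thesis using has_integral_const_real[of "1::real" 0 pi] by simp
  next
    case False
    have "((\<lambda>\<theta>. cos (of_int m * \<theta>)) has_integral sin (of_int m * pi) / of_int m - sin (of_int m * 0) / of_int m) {0..pi}"
      using False by (intro fundamental_theorem_of_calculus)
        (auto intro!: derivative_eq_intros simp flip: has_real_derivative_iff_has_vector_derivative)
    moreover have "sin (of_int m * pi) = 0" using sin_integer_2pi sin_npi_int by (simp add: mult.commute)
    ultimately show ?thesis using False by simp
  qed
  have "((\<lambda>\<theta>. (cos (of_int (int j - int k) * \<theta>) - cos (of_int (int j + int k + 2) * \<theta>)) / 2) has_integral
      ((if int j - int k = 0 then pi else 0) - (if int j + int k + 2 = 0 then pi else 0)) / 2) {0..pi}"
    by (intro has_integral_divide has_integral_diff cosint)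
  then show ?thesis unfolding prod by (auto split: if_splits)
qed

text \<open>Integration against sines gives \<open>\<bar>c k\<bar> \<le> I\<close> for the
  coefficients in the basis \<open>chebyshev_U\<close>, since \<open>pi / 2 \<ge> 1\<close>; there
  are \<open>N + 1\<close> of them, each multiplied by at most \<open>2 * (N + 1)\<close>.\<close>

lemma poly_bound_beyond_endpoint:
  fixes p :: "real poly"
  assumes "degree p \<le> N" "0 \<le> y" "4 * y * (real N + 1)\<^sup>2 \<le> 1"
  shows "\<bar>poly p (1 + y)\<bar> \<le> 2 * (real N + 1)\<^sup>2 * integral {-1..1} (\<lambda>x. \<bar>poly p x\<bar>)"
proof -
  define I where "I = integral {-1..1} (\<lambda>x. \<bar>poly p x\<bar>)"
  have I: "((\<lambda>\<theta>. sin \<theta> * \<bar>poly p (cos \<theta>)\<bar>) has_integral I) {0..pi}"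
  proof -
    \<comment> \<open>The substitution is made with the increasing map \<open>- cos\<close>; a
      reflection then returns to \<open>cos\<close>.\<close>
    have "((\<lambda>\<theta>. sin \<theta> *\<^sub>R \<bar>poly p (- (- cos \<theta>))\<bar>) has_integral integral {- cos 0..- cos pi} (\<lambda>x. \<bar>poly p (- x)\<bar>)) {0..pi}"
      by (rule has_integral_substitution[where c="-1" and d=1])
        (auto intro!: continuous_intros derivative_eq_intros)
    moreover have "integral {- cos 0..- cos pi} (\<lambda>x. \<bar>poly p (- x)\<bar>) = I"
      using Henstock_Kurzweil_Integration.integral_reflect_real[of 1 "-1" "\<lambda>x. \<bar>poly p x\<bar>"] by (simp add: I_def)
    ultimately show ?thesis by simp
  qed
  obtain c where c: "p = (\<Sum>k\<le>N. smult (c k) (chebyshev_U k))"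
    using chebyshev_U_expansion[OF assms(1)] .
  have sinp: "sin \<theta> * poly p (cos \<theta>) = (\<Sum>k\<le>N. c k * sin (real (Suc k) * \<theta>))" for \<theta>
    unfolding sin_mult_chebyshev_U[symmetric]
    by (subst c) (simp add: poly_sum sum_distrib_left mult_ac)
  have ck: "\<bar>c k\<bar> \<le> I" if "k \<le> N" for k
  proof -
    have "((\<lambda>\<theta>. \<Sum>j\<le>N. c j * (sin (real (Suc j) * \<theta>) * sin (real (Suc k) * \<theta>))) has_integral
       (\<Sum>j\<le>N. c j * (if j = k then pi / 2 else 0))) {0..pi}"
      by (intro has_integral_sum has_integral_mult_right sin_orthogonality) auto
    also have "(\<Sum>j\<le>N. c j * (if j = k then pi / 2 else 0)) = c k * (pi / 2)"
      using that by (subst sum.remove[of _ k]) auto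
    also have "(\<lambda>\<theta>. \<Sum>j\<le>N. c j * (sin (real (Suc j) * \<theta>) * sin (real (Suc k) * \<theta>)))
        = (\<lambda>\<theta>. sin \<theta> * poly p (cos \<theta>) * sin (real (Suc k) * \<theta>))"
      unfolding sinp sum_distrib_right by (simp add: mult_ac)
    finally have J: "((\<lambda>\<theta>. sin \<theta> * poly p (cos \<theta>) * sin (real (Suc k) * \<theta>)) has_integral c k * (pi / 2)) {0..pi}" .
    have "norm (integral {0..pi} (\<lambda>\<theta>. sin \<theta> * poly p (cos \<theta>) * sin (real (Suc k) * \<theta>)))
        \<le> integral {0..pi} (\<lambda>\<theta>. sin \<theta> * \<bar>poly p (cos \<theta>)\<bar>)"
    proof (rule integral_norm_bound_integral)
      fix \<theta> :: real assume "\<theta> \<in> {0..pi}"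
      then have "sin \<theta> \<ge> 0" by (simp add: sin_ge_zero)
      then show "norm (sin \<theta> * poly p (cos \<theta>) * sin (real (Suc k) * \<theta>)) \<le> sin \<theta> * \<bar>poly p (cos \<theta>)\<bar>"
        using mult_left_mono[OF abs_sin_le_one[of "real (Suc k) * \<theta>"], of "sin \<theta> * \<bar>poly p (cos \<theta>)\<bar>"]
        by (simp add: abs_mult)
    qed (use I J in \<open>auto simp: has_integral_integrable\<close>)
    then have "\<bar>c k * (pi / 2)\<bar> \<le> I"
      unfolding integral_unique[OF I] integral_unique[OF J] by simp
    then have "\<bar>c k\<bar> * (pi / 2) \<le> I" by (simp add: abs_mult)
    moreover have "\<bar>c k\<bar> * 1 \<le> \<bar>c k\<bar> * (pi / 2)"
      using pi_ge_two by (intro mult_left_mono) auto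
    ultimately show ?thesis by simp
  qed
  have "\<bar>poly p (1 + y)\<bar> \<le> (\<Sum>k\<le>N. \<bar>c k\<bar> * \<bar>poly (chebyshev_U k) (1 + y)\<bar>)"
    by (subst c) (simp add: poly_sum abs_mult[symmetric])
  also have "\<dots> \<le> (\<Sum>k\<le>N. I * (2 * (real N + 1)))"
    using ck chebyshev_U_bound[OF assms(2,3)] by (intro sum_mono mult_mono) (fastforce intro: order.trans)+
  also have "\<dots> = 2 * (real N + 1)\<^sup>2 * I" by (simp add: power2_eq_square algebra_simps)
  finally show ?thesis by (simp add: I_def)
qed


text \<open>On the added strip the polynomial is at most of order \<open>N\<^sup>2 / S\<close> times
  its integral over \<open>{0..S}\<close>. A strip whose length is a small multiple of
  \<open>S / N\<^sup>2\<close> therefore costs only a fraction of that integral.\<close>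

lemma nn_integral_poly_extend_interval:
  fixes p :: "real poly" and S a :: real
  assumes "degree p \<le> N" "0 < S" "0 \<le> a" "8 * a * (real N + 1)\<^sup>2 \<le> S"
  shows "(\<integral>\<^sup>+s\<in>{-a..S}. ennreal \<bar>poly p s\<bar> \<partial>lborel)
    \<le> 2 * (\<integral>\<^sup>+s\<in>{0..S}. ennreal \<bar>poly p s\<bar> \<partial>lborel)"
proof -
  have [measurable]: "poly p \<in> borel_measurable borel"
    by (intro borel_measurable_continuous_onI continuous_intros)
  define I where "I = integral {0..S} (\<lambda>s. \<bar>poly p s\<bar>)"
  have cont: "continuous_on A (\<lambda>s. \<bar>poly p s\<bar>)" for A by (intro continuous_intros)
  have I0: "I \<ge> 0" unfolding I_def by (intro integral_nonneg integrable_continuous_real cont) auto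
  have I_eq: "(\<integral>\<^sup>+s\<in>{0..S}. ennreal \<bar>poly p s\<bar> \<partial>lborel) = ennreal I"
    unfolding I_def by (intro nn_integral_has_integral_lebesgue' integrable_integral integrable_continuous_real cont) auto
  have ptw: "\<bar>poly p s\<bar> \<le> 4 * (real N + 1)\<^sup>2 / S * I" if "- a \<le> s" "s \<le> 0" for s
  proof -
    \<comment> \<open>The affine map sends \<open>1\<close> to \<open>0\<close> and
      \<open>{-1..1}\<close> onto \<open>{0..S}\<close>, so a negative \<open>s\<close> corresponds
      to a point just beyond \<open>1\<close>.\<close>
    define q where "q = pcompose p [:S / 2, - S / 2:]"
    have q: "poly q x = poly p (S / 2 - S / 2 * x)" for x by (simp add: q_def poly_pcompose algebra_simps)
    have "degree q \<le> N" using assms(1,2) by (simp add: q_def degree_pcompose)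
    moreover have "4 * (- 2 * s / S) * (real N + 1)\<^sup>2 \<le> 1"
    proof -
      have "8 * (- s) * (real N + 1)\<^sup>2 \<le> 8 * a * (real N + 1)\<^sup>2"
        using that by (intro mult_right_mono) auto
      also have "\<dots> \<le> S" using assms by simp
      finally have "(8 * (- s) * (real N + 1)\<^sup>2) / S \<le> S / S" using assms by (intro divide_right_mono) auto
      then show ?thesis using assms by simp
    qed
    ultimately have "\<bar>poly q (1 + - 2 * s / S)\<bar> \<le> 2 * (real N + 1)\<^sup>2 * integral {-1..1} (\<lambda>x. \<bar>poly q x\<bar>)"
      using that assms(2) by (intro poly_bound_beyond_endpoint) (auto simp: field_simps)
    also have "poly q (1 + - 2 * s / S) = poly p s" using assms(2) by (simp add: q field_simps)
    also have "integral {-1..1} (\<lambda>x. \<bar>poly q x\<bar>) = 2 / S * I"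
    proof -
      have "((\<lambda>s. \<bar>poly p s\<bar>) has_integral I) (cbox 0 S)"
        unfolding I_def by (simp add: integrable_integral integrable_continuous_real cont)
      from has_integral_affinity[OF this, of "- S / 2" "S / 2"] assms(2)
      have "((\<lambda>x. \<bar>poly p (S / 2 - S / 2 * x)\<bar>) has_integral 2 / S * I) ((\<lambda>x. - (2 / S * x) + 1) ` {0..S})"
        by (simp add: algebra_simps)
      also have "(\<lambda>x. - (2 / S * x) + 1) ` {0..S} = {-1..1}"
      proof -
        have "(\<lambda>x. - (2 / S * x) + 1) ` {0..S} = (\<lambda>x. (- 2 / S) * x + 1) ` {0..S}" by simp
        also have "\<dots> = {-1..1}"
          unfolding image_affinity_atLeastAtMost using assms(2) by simp
        finally show ?thesis .
      qed
      finally show ?thesis unfolding q by (rule integral_unique)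
    qed
    finally show ?thesis by simp
  qed
  have "(\<integral>\<^sup>+s\<in>{-a..S}. ennreal \<bar>poly p s\<bar> \<partial>lborel)
      \<le> (\<integral>\<^sup>+s. ennreal (4 * (real N + 1)\<^sup>2 / S * I) * indicator {-a..0} s + ennreal \<bar>poly p s\<bar> * indicator {0..S} s \<partial>lborel)"
    using ptw by (intro nn_integral_mono) (auto simp: indicator_def intro!: ennreal_leI add_increasing2)
  also have "\<dots> = ennreal (4 * (real N + 1)\<^sup>2 / S * I) * ennreal a + ennreal I"
    using assms(3) by (subst nn_integral_add) (auto simp: nn_integral_cmult_indicator I_eq)
  also have "\<dots> = ennreal (4 * (real N + 1)\<^sup>2 / S * I * a + I)"
    using assms I0 by (simp add: ennreal_mult[symmetric] ennreal_plus[symmetric] del: ennreal_plus)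
  also have "\<dots> \<le> ennreal (2 * I)"
  proof (rule ennreal_leI)
    have "4 * (real N + 1)\<^sup>2 / S * I * a = (8 * a * (real N + 1)\<^sup>2) * (I / (2 * S))" by simp
    also have "\<dots> \<le> S * (I / (2 * S))" using assms I0 by (intro mult_right_mono) auto
    also have "\<dots> = I / 2" using assms(2) by simp
    finally show "4 * (real N + 1)\<^sup>2 / S * I * a + I \<le> 2 * I" using I0 by simp
  qed
  also have "\<dots> = 2 * ennreal I" using I0 by (simp add: ennreal_mult)
  finally show ?thesis unfolding I_eq .
qed

section \<open>Averaging below a graph\<close>

text \<open>The disc \<open>(cmod z)\<^sup>2 \<le> a\<close> has area \<open>pi * a\<close>. Hence
  the image of plane measure and \<open>pi\<close> times length on the half-line agree on all rays
  \<open>{..a}\<close>, which form an intersection-stable generator of the Borel sets.\<close>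

lemma nn_integral_norm_square_complex:
  fixes \<phi> :: "real \<Rightarrow> ennreal"
  assumes [measurable]: "\<phi> \<in> borel_measurable borel"
  shows "(\<integral>\<^sup>+z. \<phi> ((cmod z)\<^sup>2) \<partial>lborel) = ennreal pi * (\<integral>\<^sup>+s. \<phi> s * indicator {0..} s \<partial>lborel)"
proof -
  define M where "M = distr lborel borel (\<lambda>z::complex. (cmod z)\<^sup>2)"
  define M' where "M' = density lborel (\<lambda>s::real. ennreal pi * indicator {0..} s)"
  have atMost: "emeasure M {..a} = ennreal (pi * max 0 a)" for a
  proof -
    have "emeasure M {..a} = emeasure lborel {z::complex. (cmod z)\<^sup>2 \<le> a}"
      unfolding M_def by (subst emeasure_distr) (auto intro!: arg_cong2[where f=emeasure])
    also have "\<dots> = ennreal (pi * max 0 a)"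
    proof (cases "a \<ge> 0")
      case True
      then have "{z::complex. (cmod z)\<^sup>2 \<le> a} = cball 0 (sqrt a)"
        by (auto simp: real_le_rsqrt sqrt_ge_absD real_sqrt_le_iff dest: real_le_rsqrt power_mono[of _ "sqrt a" 2])
      then show ?thesis using True by (simp add: emeasure_cball unit_ball_vol_2)
    next
      case False
      then have "{z::complex. (cmod z)\<^sup>2 \<le> a} = {}"
        by (auto simp: not_le intro: less_le_trans)
      then show ?thesis using False by simp
    qed
    finally show ?thesis .
  qed
  have atMost': "emeasure M' {..a} = ennreal (pi * max 0 a)" for a
  proof -
    have "emeasure M' {..a} = (\<integral>\<^sup>+s. ennreal pi * indicator {0..a} s \<partial>lborel)"
      unfolding M'_def by (subst emeasure_density) (auto intro!: nn_integral_cong simp: indicator_def)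
    also have "\<dots> = ennreal pi * emeasure lborel {0..a}" by (simp add: nn_integral_cmult_indicator)
    finally show ?thesis by (cases "a \<ge> 0") (auto simp: ennreal_mult)
  qed
  have "M = M'"
  proof (rule measure_eqI_generator_eq[where E="range atMost" and \<Omega>=UNIV and A="\<lambda>i. {..real i}"])
    show "Int_stable (range atMost :: real set set)"
      by (auto simp: Int_stable_def intro!: exI[of _ "min _ _"])
    show "emeasure M X = emeasure M' X" if "X \<in> range atMost" for X
      using that by (auto simp: atMost atMost')
    show "(\<Union>i. {..real i}) = UNIV" by (auto intro: real_arch_simple)
    show "sets M = sigma_sets UNIV (range atMost)" "sets M' = sigma_sets UNIV (range atMost)"
      by (simp_all add: M_def M'_def borel_eq_atMost)
  qed (auto simp: atMost)
  have "(\<integral>\<^sup>+z. \<phi> ((cmod z)\<^sup>2) \<partial>lborel) = (\<integral>\<^sup>+s. \<phi> s \<partial>M)"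
    unfolding M_def by (subst nn_integral_distr) auto
  also have "\<dots> = (\<integral>\<^sup>+s. ennreal pi * (\<phi> s * indicator {0..} s) \<partial>lborel)"
    unfolding \<open>M = M'\<close> M'_def
    by (subst nn_integral_density) (auto simp: mult_ac intro!: nn_integral_cong)
  finally show ?thesis by (simp add: nn_integral_cmult)
qed

section \<open>Depth below a graph and distance to the boundary\<close>

lemma infdist_frontier_le_dist:
  fixes K :: "'a::euclidean_space set"
  assumes "x \<in> K" "z \<notin> K"
  shows "infdist x (frontier K) \<le> dist x z"
proof -
  have "closed_segment x z \<inter> frontier K \<noteq> {}"
    using assms by (intro connected_Int_frontier) auto
  then obtain y where y: "y \<in> closed_segment x z" "y \<in> frontier K" by blast
  have "infdist x (frontier K) \<le> dist x y" using y(2) by (rule infdist_le)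
  also have "\<dots> \<le> dist x z" using y(1) by (metis dist_commute dist_in_closed_segment(1))
  finally show ?thesis .
qed

lemma dist_prod_real_square:
  fixes x y :: "'a::real_normed_vector \<times> real"
  shows "(dist x y)\<^sup>2 = (norm (fst x - fst y))\<^sup>2 + (snd x - snd y)\<^sup>2"
  by (simp add: dist_prod_def dist_norm)

lemma dist_prod_real_le:
  fixes x y :: "'a::real_normed_vector \<times> real"
  shows "dist x y \<le> norm (fst x - fst y) + \<bar>snd x - snd y\<bar>"
  unfolding dist_prod_def using sqrt_sum_squares_le_sum_abs[of "dist (fst x) (fst y)" "dist (snd x) (snd y)"]
  by (simp add: dist_norm)

text \<open>A chart in its own coordinates. The gradient of \<open>g\<close> may grow linearly, so a
  Lipschitz constant is asked for only on the ball of radius \<open>R + 2\<close>: all base points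
  compared lie within distance 2 of base points of \<open>K\<close>. Second-order information enters
  the comparison of depths through \<open>g_second_diff\<close> alone.\<close>

locale graph_domain =
  fixes K U :: "('a::euclidean_space \<times> real) set" and g :: "'a \<Rightarrow> real" and L B R :: real
  assumes closed_K: "closed K" and open_U: "open U"
    and graph: "K \<inter> U = {x \<in> U. snd x \<le> g (fst x)}"
    and K_bound: "K \<subseteq> cball 0 R" and frontier_ne: "frontier K \<noteq> {}"
    and L0: "L \<ge> 0" and B0: "B \<ge> 0"
    and g_cont: "continuous_on UNIV g"
    and g_lip: "\<And>u v. norm u \<le> R + 2 \<Longrightarrow> norm v \<le> R + 2 \<Longrightarrow> \<bar>g u - g v\<bar> \<le> L * norm (u - v)"
    and g_second_diff: "\<And>u w h. \<bar>(g (w + h) - g w) - (g (u + h) - g u)\<bar> \<le> B * norm (w - u) * norm h"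
begin

definition depth :: "'a \<times> real \<Rightarrow> real" where "depth x = g (fst x) - snd x"

abbreviation bdist :: "'a \<times> real \<Rightarrow> real" where "bdist x \<equiv> infdist x (frontier K)"

lemma bdist_nonneg: "bdist x \<ge> 0" by (rule infdist_nonneg)

lemma in_K_iff: "x \<in> U \<Longrightarrow> x \<in> K \<longleftrightarrow> depth x \<ge> 0"
  using arg_cong[OF graph, of "\<lambda>A. x \<in> A"] by (simp add: depth_def)

lemma norm_fst_le_R: "x \<in> K \<Longrightarrow> norm (fst x) \<le> R"
  using K_bound norm_fst_le[of "fst x" "snd x"] by fastforce

lemma cont_depth: "continuous_on UNIV depth"
  unfolding depth_def by (intro continuous_intros continuous_on_compose2[OF g_cont]) auto

lemma frontier_iff:
  assumes "x \<in> U"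
  shows "x \<in> frontier K \<longleftrightarrow> depth x = 0"
proof
  assume fr: "x \<in> frontier K"
  then have "x \<in> K" using closed_K frontier_subset_closed by blast
  then have "depth x \<ge> 0" using assms in_K_iff by blast
  moreover have "\<not> depth x > 0"
  proof
    assume "depth x > 0"
    have "open (U \<inter> depth -` {0<..})"
      by (intro open_Int open_U open_vimage[OF open_greaterThan cont_depth])
    moreover have "U \<inter> depth -` {0<..} \<subseteq> K" using in_K_iff by auto
    ultimately have "x \<in> interior K" using \<open>depth x > 0\<close> assms by (intro interiorI[of "U \<inter> depth -` {0<..}"]) auto
    then show False using fr by (simp add: frontier_def)
  qed
  ultimately show "depth x = 0" by simp
next
  assume d: "depth x = 0"
  then have "x \<in> K" using assms in_K_iff by simp
  moreover have "x \<notin> interior K"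
  proof
    assume "x \<in> interior K"
    then have "x \<in> interior K \<inter> U" "open (interior K \<inter> U)" using assms open_U by auto
    then obtain e where e: "e > 0" "ball x e \<subseteq> interior K \<inter> U" using open_contains_ball by meson
    define z where "z = (fst x, snd x + e / 2)"
    have "dist x z = e / 2" using e(1) by (cases x) (simp add: z_def dist_Pair_Pair dist_real_def)
    then have "z \<in> ball x e" using e(1) by simp
    then have "z \<in> K" "z \<in> U" using e(2) interior_subset[of K] by blast+
    then have "depth z \<ge> 0" using in_K_iff by blast
    then show False using d e(1) by (simp add: depth_def z_def)
  qed
  ultimately show "x \<in> frontier K" using closure_subset by (auto simp: frontier_def)
qed

text \<open>Suppose the boundary point nearest to \<open>x\<close> were far to the side compared
  with its height above \<open>x\<close>. Moving it towards \<open>x\<close> while rising with slope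
  \<open>L + 1\<close>, steeper than the graph, would lead outside \<open>K\<close> and yet closer
  to \<open>x\<close>, which is impossible. So this height alone is comparable to the
  distance.\<close>

lemma nearest_boundary_point:
  assumes x: "x \<in> K" and U: "cball x \<delta> \<subseteq> U" and \<delta>: "\<delta> \<le> 1" "bdist x < \<delta>"
  obtains w where "dist x (w, g w) = bdist x" "(w, g w) \<in> frontier K"
    "norm (fst x - w) \<le> 2 * (L + 1) * (g w - snd x)"
proof -
  have cl: "closed (frontier K)" by (rule frontier_closed)
  obtain p where p: "p \<in> frontier K" "bdist x = dist x p"
    using infdist_attains_inf[OF cl frontier_ne, of x] by blast
  have pU: "p \<in> U" using U p \<delta> by auto
  define w where "w = fst p"
  have pw: "p = (w, g w)" using frontier_iff[OF pU] p(1) by (cases p) (auto simp: w_def depth_def)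
  define u where "u = fst x"
  define m where "m = g w - snd x"
  have xU: "x \<in> U" using U \<delta> bdist_nonneg[of x] by auto
  have ux: "norm u \<le> R" using norm_fst_le_R[OF x] by (simp add: u_def)
  have d2: "(bdist x)\<^sup>2 = (norm (u - w))\<^sup>2 + m\<^sup>2"
    unfolding p(2) pw by (simp add: dist_prod_real_square u_def m_def power2_commute)
  have "norm (u - w) \<le> 2 * (L + 1) * m"
  proof (rule ccontr)
    assume neg: "\<not> norm (u - w) \<le> 2 * (L + 1) * m"
    have uw: "u \<noteq> w"
    proof
      assume "u = w"
      then have "m \<ge> 0" using in_K_iff[OF xU] x by (simp add: m_def u_def depth_def)
      with neg \<open>u = w\<close> L0 show False by simp
    qed
    have pos: "norm (u - w) - (L + 1) * m > 0"
    proof (cases "m \<ge> 0")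
      case True
      then have "(L + 1) * m \<ge> 0" using L0 by simp
      moreover have "2 * (L + 1) * m = (L + 1) * m + (L + 1) * m" by (simp add: algebra_simps)
      ultimately show ?thesis using neg by linarith
    next
      case False
      then have "(L + 1) * m \<le> 0" using L0 by (simp add: mult_le_0_iff)
      moreover have "norm (u - w) > 0" using uw by simp
      ultimately show ?thesis by linarith
    qed
    \<comment> \<open>The minimiser of the squared distance from \<open>x\<close> to
      \<open>p'\<close>, a quadratic in the step length.\<close>
    define \<tau> where "\<tau> = (norm (u - w) - (L + 1) * m) / (1 + (L + 1)\<^sup>2)"
    have den: "1 + (L + 1)\<^sup>2 > 0" by (simp add: add_pos_nonneg)
    have \<tau>: "\<tau> > 0" unfolding \<tau>_def using pos den by simp
    define e where "e = (u - w) /\<^sub>R norm (u - w)"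
    have ne: "norm e = 1" using uw by (simp add: e_def)
    have uwe: "u - w = norm (u - w) *\<^sub>R e" using uw by (simp add: e_def)
    define p' where "p' = (w + \<tau> *\<^sub>R e, g w + (L + 1) * \<tau>)"
    have n1: "(norm (u - (w + \<tau> *\<^sub>R e)))\<^sup>2 = (norm (u - w) - \<tau>)\<^sup>2"
    proof -
      have "u - (w + \<tau> *\<^sub>R e) = (u - w) - \<tau> *\<^sub>R e" by simp
      also have "\<dots> = (norm (u - w) - \<tau>) *\<^sub>R e" by (subst uwe) (simp add: scaleR_diff_left)
      finally show ?thesis using ne by simp
    qed
    have "(dist x p')\<^sup>2 = (norm (u - w) - \<tau>)\<^sup>2 + (m + (L + 1) * \<tau>)\<^sup>2"
    proof -
      have "(snd x - (g w + (L + 1) * \<tau>))\<^sup>2 = (m + (L + 1) * \<tau>)\<^sup>2"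
        by (subst power2_commute) (simp add: m_def algebra_simps)
      then show ?thesis unfolding n1[symmetric] dist_prod_real_square by (simp add: p'_def u_def)
    qed
    also have "\<dots> = (bdist x)\<^sup>2 - 2 * \<tau> * (norm (u - w) - (L + 1) * m) + \<tau> * (\<tau> * (1 + (L + 1)\<^sup>2))"
      unfolding d2 by (simp add: power2_eq_square algebra_simps)
    also have "\<tau> * (1 + (L + 1)\<^sup>2) = norm (u - w) - (L + 1) * m" unfolding \<tau>_def using den by simp
    also have "(bdist x)\<^sup>2 - 2 * \<tau> * (norm (u - w) - (L + 1) * m) + \<tau> * (norm (u - w) - (L + 1) * m) < (bdist x)\<^sup>2"
      using mult_pos_pos[OF \<tau> pos] by simp
    finally have dp': "dist x p' < bdist x" using bdist_nonneg by (rule power_less_imp_less_base)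
    have "p' \<in> K" using infdist_frontier_le_dist[OF x, of p'] dp' by force
    moreover have "p' \<in> U" using dp' \<delta> U by auto
    ultimately have "depth p' \<ge> 0" using in_K_iff by blast
    moreover have "depth p' < 0"
    proof -
      have "norm (u - (w + \<tau> *\<^sub>R e)) \<le> dist x p'" using dist_fst_le[of x p'] by (simp add: u_def p'_def dist_norm)
      then have "norm (w + \<tau> *\<^sub>R e) \<le> R + 2" using ux dp' \<delta> norm_triangle_sub[of "w + \<tau> *\<^sub>R e" u]
        by (simp add: norm_minus_commute)
      moreover have "norm w \<le> R + 2"
      proof -
        have "norm (u - w) \<le> dist x p" using dist_fst_le[of x p] by (simp add: u_def pw dist_norm)
        then show ?thesis using ux \<delta> norm_triangle_sub[of w u] p(2) by (simp add: norm_minus_commute)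
      qed
      ultimately have "\<bar>g (w + \<tau> *\<^sub>R e) - g w\<bar> \<le> L * \<tau>" using g_lip[of "w + \<tau> *\<^sub>R e" w] \<tau> ne by simp
      then show ?thesis using \<tau> by (simp add: depth_def p'_def algebra_simps)
    qed
    ultimately show False by simp
  qed
  then show thesis using that[of w] p pw by (simp add: u_def m_def)
qed

lemma depth_le_bdist:
  assumes x: "x \<in> K" and U: "cball x \<delta> \<subseteq> U" and \<delta>: "\<delta> \<le> 1" "bdist x < \<delta>"
  shows "depth x \<le> (L + 1) * bdist x"
proof -
  obtain w where w: "dist x (w, g w) = bdist x" using nearest_boundary_point[OF assms] .
  have "norm (fst x - w) \<le> bdist x" using dist_fst_le[of x "(w, g w)"] w by (simp add: dist_norm)
  moreover have "\<bar>snd x - g w\<bar> \<le> bdist x" using dist_snd_le[of x "(w, g w)"] w by (simp add: dist_norm)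
  moreover have "norm (fst x) \<le> R" using norm_fst_le_R[OF x] .
  ultimately have "\<bar>g (fst x) - g w\<bar> \<le> L * norm (fst x - w)" 
    using \<delta> norm_triangle_sub[of w "fst x"] by (intro g_lip) (auto simp: norm_minus_commute)
  also have "\<dots> \<le> L * bdist x" using \<open>norm (fst x - w) \<le> bdist x\<close> L0 by (rule mult_left_mono)
  finally show ?thesis using \<open>\<bar>snd x - g w\<bar> \<le> bdist x\<close> by (simp add: depth_def algebra_simps)
qed

text \<open>The point of the graph vertically above \<open>x\<close> is a boundary point as long as
  it lies in \<open>U\<close>; the smallness of \<open>bdist x\<close> ensures this through
  \<open>depth_le_bdist\<close>.\<close>

lemma bdist_le_depth:
  assumes x: "x \<in> K" and U: "cball x \<delta> \<subseteq> U" and \<delta>: "\<delta> \<le> 1" "(L + 1) * bdist x < \<delta>"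
  shows "bdist x \<le> depth x"
proof -
  have "1 * bdist x \<le> (L + 1) * bdist x" using L0 bdist_nonneg by (intro mult_right_mono) auto
  then have d: "bdist x < \<delta>" using \<delta> by simp
  have dx: "depth x < \<delta>" using depth_le_bdist[OF x U \<delta>(1) d] \<delta> by simp
  have "x \<in> U" using U d bdist_nonneg[of x] by auto
  then have d0: "depth x \<ge> 0" using in_K_iff x by blast
  define q where "q = (fst x, g (fst x))"
  have dq: "dist x q = depth x" using d0 by (cases x) (simp add: q_def depth_def dist_Pair_Pair dist_real_def)
  then have "q \<in> U" using dx U by auto
  then have "q \<in> frontier K" by (simp add: frontier_iff depth_def q_def)
  then have "bdist x \<le> dist x q" by (rule infdist_le)
  then show ?thesis using dq by simp
qed

text \<open>The boundary point nearest to \<open>x\<close> is moved along the graph by the horizontal displacement of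
  \<open>x'\<close>: this changes the vertical offset by \<open>depth x' - depth x\<close> up to a second order difference.\<close>

lemma depth_diff_ge:
  assumes x: "x \<in> K" and x': "x' \<in> K" and U: "cball x \<delta> \<subseteq> U" and \<delta>: "\<delta> \<le> 1" "bdist x < \<delta> / 2"
    and t: "dist x x' \<le> t" "(L + 2) * t \<le> \<delta> / 2" "\<bar>sqrt (bdist x) - sqrt (bdist x')\<bar> \<le> t"
  shows "depth x' - depth x \<ge> - (4 * (2 * L + 3) + B + 4 * (L + 1) * (2 * L + 3)\<^sup>2) * (t * sqrt (bdist x))"
proof -
  define d d' where "d = bdist x" and "d' = bdist x'"
  have d0: "d \<ge> 0" "d' \<ge> 0" unfolding d_def d'_def by (rule bdist_nonneg)+
  have t0: "t \<ge> 0" by (rule order.trans[OF zero_le_dist t(1)])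
  define C1 where "C1 = 2 * L + 3"
  have C1: "C1 > 0" using L0 by (simp add: C1_def)
  have dd: "bdist x < \<delta>" using \<delta> d0 by (simp add: d_def)
  obtain w where w: "dist x (w, g w) = d" "(w, g w) \<in> frontier K"
    and uw: "norm (fst x - w) \<le> 2 * (L + 1) * (g w - snd x)"
    using nearest_boundary_point[OF x U \<delta>(1) dd] unfolding d_def .
  define u v where "u = fst x" and "v = fst x'"
  define h where "h = v - u"
  define m where "m = g w - snd x"
  define m' where "m' = g (w + h) - snd x'"
  have m0: "m \<ge> 0" 
  proof -
    have "0 \<le> 2 * (L + 1) * (g w - snd x)" by (rule order.trans[OF norm_ge_zero uw])
    then show ?thesis using L0 by (simp add: m_def zero_le_mult_iff)
  qed
  have d2: "d\<^sup>2 = (norm (u - w))\<^sup>2 + m\<^sup>2"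
    unfolding w(1)[symmetric] by (simp add: dist_prod_real_square u_def m_def power2_commute)
  have uwd: "norm (u - w) \<le> d" by (rule power2_le_imp_le) (use d2 d0 in auto)
  have md: "m \<le> d" by (rule power2_le_imp_le) (use d2 d0 in auto)
  have dC1: "d \<le> C1 * m"
  proof -
    have "d\<^sup>2 \<le> (norm (u - w) + m)\<^sup>2" unfolding d2 using m0 by (simp add: power2_eq_square algebra_simps)
    then have "d \<le> norm (u - w) + m" by (rule power2_le_imp_le) (use m0 in auto)
    then show ?thesis using uw by (simp add: C1_def u_def m_def algebra_simps)
  qed
  have s_le: "depth x \<le> (L + 1) * d" using depth_le_bdist[OF x U \<delta>(1) dd] by (simp add: d_def)
  have nh: "norm h \<le> t" using t(1) dist_fst_le[of x x'] by (simp add: h_def u_def v_def dist_norm norm_minus_commute)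
  have t1: "t \<le> (L + 2) * t" "2 * t \<le> (L + 2) * t" using t0 L0 by (auto simp: algebra_simps)
  have "0 < \<delta>" using dd d0 by (simp add: d_def)
  then have "dist x x' \<le> \<delta>" using t(1,2) t1(1) by linarith
  then have x'U: "x' \<in> U" using U by (metis mem_cball subsetD)
  have s': "depth x' \<ge> 0" using in_K_iff[OF x'U] x' by blast
  define e where "e = (g (w + h) - g w) - (g (u + h) - g u)"
  have e: "\<bar>e\<bar> \<le> B * (t * sqrt d)"
  proof -
    have "\<bar>e\<bar> \<le> B * norm (w - u) * norm h" unfolding e_def by (rule g_second_diff)
    also have "\<dots> \<le> B * d * t" using uwd nh B0 d0 by (intro mult_mono) (auto simp: norm_minus_commute)
    \<comment> \<open>\<open>d \<le> 1\<close> turns the second-order error \<open>B * d * t\<close>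
      into one of the desired order \<open>t * sqrt d\<close>.\<close>
    also have "d \<le> sqrt d"
    proof -
      have "d \<le> 1" using dd \<delta> by (simp add: d_def)
      then have "d * d \<le> d * 1" using d0 by (intro mult_left_mono) auto
      then show ?thesis by (intro real_le_rsqrt) (simp add: power2_eq_square)
    qed
    then have "B * d * t \<le> B * sqrt d * t" using B0 t0 by (intro mult_right_mono mult_left_mono)
    finally show ?thesis by (simp add: mult_ac)
  qed
  have uh: "u + h = v" by (simp add: h_def)
  have mm: "m' - m = depth x' - depth x + e"
    by (simp add: m'_def m_def e_def depth_def uh u_def[symmetric] v_def[symmetric])
  \<comment> \<open>For \<open>m' < 0\<close> the point \<open>x'\<close> lies above the displaced
    boundary point. Then \<open>(w + h, snd x')\<close> is outside \<open>K\<close>, and the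
    horizontal offset alone bounds \<open>d'\<close>. Truncation at \<open>0\<close> covers both
    cases.\<close>
  define \<mu> where "\<mu> = max m' 0"
  have near: "d'\<^sup>2 \<le> (norm (u - w))\<^sup>2 + \<mu>\<^sup>2"
  proof (cases "m' \<ge> 0")
    case True
    define b where "b = (w + h, g (w + h))"
    have "dist x b \<le> dist x (w, g w) + dist (w, g w) b" by (rule dist_triangle)
    also have "dist (w, g w) b \<le> norm h + \<bar>g w - g (w + h)\<bar>"
      unfolding b_def using dist_prod_real_le[of "(w, g w)" "(w + h, g (w + h))"] by simp
    also have "\<bar>g w - g (w + h)\<bar> \<le> L * norm h"
    proof -
      have ux: "norm u \<le> R" using norm_fst_le_R[OF x] by (simp add: u_def)
      have "norm w \<le> R + 1" using norm_triangle_sub[of w u] uwd ux dd \<delta> by (simp add: norm_minus_commute d_def)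
      moreover have "norm (w + h) \<le> norm w + norm h" by (rule norm_triangle_ineq)
      moreover have "t \<le> 1" using t t1 \<delta> by simp
      ultimately show ?thesis using nh g_lip[of w "w + h"] by simp
    qed
    also have "dist x (w, g w) + (norm h + L * norm h) \<le> \<delta> / 2 + (L + 2) * t"
    proof -
      have "norm h + L * norm h \<le> (L + 1) * t" using nh L0 mult_left_mono[OF nh L0] by (simp add: algebra_simps)
      then show ?thesis using w(1) \<delta>(2) t0 by (simp add: d_def algebra_simps)
    qed
    finally have "dist x b \<le> \<delta>" using t(2) by simp
    then have "b \<in> U" using U by auto
    then have "b \<in> frontier K" by (simp add: frontier_iff b_def depth_def)
    then have "d' \<le> dist x' b" unfolding d'_def by (rule infdist_le)
    then have "d'\<^sup>2 \<le> (dist x' b)\<^sup>2" using d0 by (intro power_mono) auto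
    also have "(dist x' b)\<^sup>2 = (norm (u - w))\<^sup>2 + m'\<^sup>2"
    proof -
      have "norm (fst x' - (w + h)) = norm (u - w)" by (simp add: h_def v_def)
      then show ?thesis by (simp add: b_def dist_prod_real_square m'_def power2_commute)
    qed
    finally show ?thesis using True by (simp add: \<mu>_def)
  next
    case False
    define z where "z = (w + h, snd x')"
    have "dist x z \<le> \<delta>"
    proof -
      have "dist x z \<le> norm (u - (w + h)) + \<bar>snd x - snd x'\<bar>"
        using dist_prod_real_le[of x z] by (simp add: z_def u_def)
      also have "norm (u - (w + h)) \<le> norm (u - w) + norm h"
        using norm_triangle_ineq4[of "u - w" h] by (simp add: algebra_simps)
      also have "\<bar>snd x - snd x'\<bar> \<le> t" using t(1) dist_snd_le[of x x'] by (simp add: dist_real_def)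
      finally show ?thesis using uwd nh t(2) t1 \<delta>(2) by (simp add: d_def)
    qed
    then have zU: "z \<in> U" using U by auto
    have "depth z < 0" using False by (simp add: z_def depth_def m'_def)
    then have "z \<notin> K" using in_K_iff[OF zU] by simp
    from infdist_frontier_le_dist[OF x' this] have "d' \<le> dist x' z" by (simp add: d'_def)
    also have "dist x' z = norm (u - w)"
    proof -
      have "norm (fst x' - (w + h)) = norm (u - w)" by (simp add: h_def v_def)
      then show ?thesis by (simp add: z_def dist_prod_def dist_norm)
    qed
    finally have "d'\<^sup>2 \<le> (norm (u - w))\<^sup>2" using d0 by (intro power_mono) auto
    also have "\<dots> \<le> (norm (u - w))\<^sup>2 + \<mu>\<^sup>2" by simp
    finally show ?thesis .
  qed
  \<comment> \<open>Since \<open>m\<close> carries a fixed share of \<open>d\<close>, a drop of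
    \<open>m\<close> forces a drop of the distance: \<open>(m - \<mu>) * m\<close> is at most
    \<open>d\<^sup>2 - d'\<^sup>2\<close>, the hypothesis on the square roots bounds
    \<open>d - d'\<close> by \<open>2 * t * sqrt d\<close>, and \<open>dC1\<close> lets one factor
    \<open>d\<close> cancel.\<close>
  have gain: "m - \<mu> \<le> 4 * C1 * (t * sqrt d)"
  proof (cases "\<mu> < m")
    case False
    moreover have "0 \<le> 4 * C1 * (t * sqrt d)" using C1 t0 d0 by simp
    ultimately show ?thesis by linarith
  next
    case True
    have \<mu>0: "\<mu> \<ge> 0" by (simp add: \<mu>_def)
    have dpos: "d > 0" using True \<mu>0 md by simp
    have lt: "\<mu>\<^sup>2 < m\<^sup>2" using True \<mu>0 by (rule power_strict_mono) simp
    have "d'\<^sup>2 < d\<^sup>2" using near d2 lt by simp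
    then have d'd: "d' < d" using d0(1) by (rule power_less_imp_less_base)
    have "sqrt d - sqrt d' \<le> t" using t(3) by (simp add: d_def d'_def)
    moreover have "sqrt d' \<le> sqrt d" using d'd by simp
    ultimately have "d - d' \<le> t * (2 * sqrt d)"
    proof -
      assume a: "sqrt d - sqrt d' \<le> t" "sqrt d' \<le> sqrt d"
      have "d - d' = (sqrt d - sqrt d') * (sqrt d + sqrt d')" using d0 by (simp add: algebra_simps)
      also have "\<dots> \<le> t * (2 * sqrt d)" using a t0 d0 by (intro mult_mono) auto
      finally show ?thesis .
    qed
    then have "(d - d') * (d + d') \<le> (t * (2 * sqrt d)) * (2 * d)"
      using d'd d0 t0 by (intro mult_mono) auto
    moreover have "(m - \<mu>) * m \<le> (d - d') * (d + d')"
    proof -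
      have "(m - \<mu>) * m \<le> m\<^sup>2 - \<mu>\<^sup>2" using True \<mu>0 mult_right_mono[of \<mu> m \<mu>] by (simp add: power2_eq_square algebra_simps)
      also have "\<dots> \<le> d\<^sup>2 - d'\<^sup>2" using near d2 by simp
      finally show ?thesis by (simp add: power2_eq_square algebra_simps)
    qed
    moreover have "(m - \<mu>) * d \<le> (m - \<mu>) * (C1 * m)" using True dC1 by (intro mult_left_mono) auto
    ultimately have "(m - \<mu>) * m \<le> (t * (2 * sqrt d)) * (2 * d)" "(m - \<mu>) * d \<le> C1 * ((m - \<mu>) * m)"
      by (simp_all add: mult_ac)
    then have "(m - \<mu>) * d \<le> C1 * ((t * (2 * sqrt d)) * (2 * d))"
      using mult_left_mono[of "(m - \<mu>) * m" "(t * (2 * sqrt d)) * (2 * d)" C1] C1 by linarith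
    then have "(m - \<mu>) * d \<le> (4 * C1 * (t * sqrt d)) * d" by (simp add: mult_ac)
    then show ?thesis using dpos by simp
  qed
  let ?q = "t * sqrt d"
  have q0: "?q \<ge> 0" using t0 d0 by simp
  \<comment> \<open>In the truncated case \<open>gain\<close> bounds \<open>m\<close>, hence
    \<open>d\<close> and \<open>depth x\<close>, by a multiple of \<open>t * sqrt d\<close>; then
    \<open>depth x' \<ge> 0\<close> suffices.\<close>
  have "depth x' - depth x \<ge> - (4 * C1 + B) * ?q \<or> depth x' - depth x \<ge> - (4 * (L + 1) * C1\<^sup>2) * ?q"
  proof (cases "m' \<ge> 0")
    case True
    then have "m' - m \<ge> - (4 * C1 * ?q)" using gain by (simp add: \<mu>_def)
    then have "depth x' - depth x \<ge> - (4 * C1 * ?q) - B * ?q" using mm e by linarith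
    then have "depth x' - depth x \<ge> - (4 * C1 + B) * ?q" by (simp add: algebra_simps)
    then show ?thesis ..
  next
    case False
    then have "m \<le> 4 * C1 * ?q" using gain by (simp add: \<mu>_def)
    then have "C1 * m \<le> C1 * (4 * C1 * ?q)" using C1 by (intro mult_left_mono) auto
    then have "d \<le> 4 * C1\<^sup>2 * ?q" using dC1 by (simp add: power2_eq_square mult_ac)
    then have "(L + 1) * d \<le> (L + 1) * (4 * C1\<^sup>2 * ?q)" using L0 by (intro mult_left_mono) auto
    then have "depth x' - depth x \<ge> - (4 * (L + 1) * C1\<^sup>2) * ?q" using s_le s' by (simp add: algebra_simps)
    then show ?thesis ..
  qed
  moreover have "(4 * C1 + B) * ?q \<ge> 0" "(4 * (L + 1) * C1\<^sup>2) * ?q \<ge> 0"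
    using q0 C1 B0 L0 by (auto intro!: mult_nonneg_nonneg)
  ultimately show ?thesis unfolding C1_def[symmetric] d_def[symmetric] by (auto simp: algebra_simps)
qed

text \<open>\<open>depth_diff_ge\<close> at \<open>x\<close> and, with half the chart radius, at
  \<open>x'\<close> gives a depth difference of order \<open>t * (sqrt d + t)\<close>. As
  \<open>d \<le> depth x\<close>, division by the sum of the square roots leaves order
  \<open>t\<close>. Thus the square root of the depth can replace that of the boundary
  distance.\<close>

lemma sqrt_depth_lipschitz:
  assumes \<delta>: "0 < \<delta>" "\<delta> \<le> 1"
  obtains C where "C > 0"
    "\<And>x x' t. x \<in> K \<Longrightarrow> x' \<in> K \<Longrightarrow> cball x \<delta> \<subseteq> U \<Longrightarrow> bdist x < \<delta> / (16 * (L + 1)) \<Longrightarrow>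
      dist x x' \<le> t \<Longrightarrow> (L + 2) * t \<le> \<delta> / 16 \<Longrightarrow> \<bar>sqrt (bdist x) - sqrt (bdist x')\<bar> \<le> t \<Longrightarrow>
      depth x' \<ge> 0 \<and> \<bar>sqrt (depth x) - sqrt (depth x')\<bar> \<le> C * t"
proof -
  define C where "C = 4 * (2 * L + 3) + B + 4 * (L + 1) * (2 * L + 3)\<^sup>2"
  have C: "C > 0" unfolding C_def using L0 B0 by (intro add_pos_nonneg) auto
  show thesis
  proof
    show "2 * C + 1 > 0" using C by simp
    fix x x' t
    assume x: "x \<in> K" and x': "x' \<in> K" and U: "cball x \<delta> \<subseteq> U" and b: "bdist x < \<delta> / (16 * (L + 1))"
      and t: "dist x x' \<le> t" "(L + 2) * t \<le> \<delta> / 16" "\<bar>sqrt (bdist x) - sqrt (bdist x')\<bar> \<le> t"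
    define d d' where "d = bdist x" and "d' = bdist x'"
    have d0: "d \<ge> 0" "d' \<ge> 0" unfolding d_def d'_def by (rule bdist_nonneg)+
    have t0: "t \<ge> 0" by (rule order.trans[OF zero_le_dist t(1)])
    have t1: "2 * t \<le> (L + 2) * t" using t0 L0 by (auto simp: algebra_simps)
    have tb: "t \<le> \<delta> / 32" using t1 t(2) by simp
    have Ld: "(L + 1) * d < \<delta> / 16" using b L0 by (simp add: d_def field_simps)
    moreover have "1 * d \<le> (L + 1) * d" using L0 d0 by (intro mult_right_mono) auto
    ultimately have ds: "d < \<delta> / 16" by simp
    have d's: "d' < \<delta> / 4"
    proof -
      have "sqrt d' \<le> sqrt d + t" using t(3) by (simp add: d_def d'_def)
      then have "d' \<le> (sqrt d + t)\<^sup>2" using d0 t0 by (metis real_sqrt_ge_zero power_mono real_sqrt_pow2)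
      also have "\<dots> \<le> 2 * d + 2 * t\<^sup>2" using d0 sum_squares_ge_zero[of "sqrt d - t" 0]
        by (simp add: power2_eq_square algebra_simps)
      also have "t\<^sup>2 \<le> t * 1" unfolding power2_eq_square using t0 tb \<delta> by (intro mult_left_mono) auto
      finally show ?thesis using ds tb \<delta> by simp
    qed
    have U': "cball x' (\<delta> / 2) \<subseteq> U"
    proof
      fix y assume "y \<in> cball x' (\<delta> / 2)"
      then have "dist x y \<le> t + \<delta> / 2" using t(1) dist_triangle[of x y x'] by simp
      then have "y \<in> cball x \<delta>" using tb \<delta> by simp
      then show "y \<in> U" using U by blast
    qed
    have "x \<in> cball x \<delta>" "x' \<in> cball x' (\<delta> / 2)" using \<delta> by simp_all
    then have xU: "x \<in> U" "x' \<in> U" using U U' by blast+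
    have s0: "depth x \<ge> 0" "depth x' \<ge> 0" using in_K_iff xU x x' by blast+
    have 1: "depth x' - depth x \<ge> - C * (t * sqrt d)"
      unfolding C_def d_def
      by (rule depth_diff_ge[OF x x' U \<delta>(2) _ t(1) _ t(3)]) (use ds t(2) \<delta> in \<open>auto simp: d_def\<close>)
    have 2: "depth x - depth x' \<ge> - C * (t * sqrt d')"
      unfolding C_def d'_def
      by (rule depth_diff_ge[OF x' x U' _ _ _ _ ]) (use d's t \<delta> in \<open>auto simp: d'_def dist_commute abs_minus_commute\<close>)
    have "sqrt d' \<le> sqrt d + t" using t(3) by (simp add: d_def d'_def)
    then have "C * (t * sqrt d') \<le> C * (t * (sqrt d + t))" using C t0 by (intro mult_left_mono) auto
    moreover have "C * (t * sqrt d) \<le> C * (t * (sqrt d + t))" using C t0 by (intro mult_left_mono) auto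
    ultimately have sd: "\<bar>depth x - depth x'\<bar> \<le> C * (t * (sqrt d + t))" using 1 2 by simp
    have "d \<le> depth x" unfolding d_def
      by (rule bdist_le_depth[OF x U \<delta>(2)]) (use Ld \<delta> in \<open>simp add: d_def\<close>)
    then have "sqrt d \<le> sqrt (depth x)" by simp
    then have sd': "\<bar>depth x - depth x'\<bar> \<le> C * (t * (sqrt (depth x) + t))"
      using sd C t0 by (smt (verit) mult_left_mono)
    define a a' where "a = sqrt (depth x)" and "a' = sqrt (depth x')"
    have a0: "a \<ge> 0" "a' \<ge> 0" using s0 by (auto simp: a_def a'_def)
    have aa: "depth x = a * a" "depth x' = a' * a'" using s0 by (auto simp: a_def a'_def)
    have prod: "\<bar>a - a'\<bar> * (a + a') \<le> C * (t * (a + t))"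
    proof -
      have "\<bar>a - a'\<bar> * (a + a') = \<bar>(a - a') * (a + a')\<bar>" using a0 by (simp add: abs_mult)
      also have "(a - a') * (a + a') = depth x - depth x'" unfolding aa by (simp add: algebra_simps)
      finally show ?thesis using sd' by (simp add: a_def)
    qed
    \<comment> \<open>Were the difference larger, then \<open>a + t \<le> 2 * (a + a')\<close>, and
      the factor \<open>a + a'\<close> would cancel from \<open>prod\<close>, leaving at most
      \<open>2 * C * t\<close>.\<close>
    have "\<bar>a - a'\<bar> \<le> (2 * C + 1) * t"
    proof (rule ccontr)
      assume "\<not> ?thesis"
      then have big: "\<bar>a - a'\<bar> > (2 * C + 1) * t" by simp
      have "(2 * C + 1) * t \<ge> t" using C t0 by (simp add: algebra_simps)
      then have "a + t \<le> 2 * (a + a')"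
        using big a0 by (auto simp: abs_if split: if_splits)
      then have "C * (t * (a + t)) \<le> C * (t * (2 * (a + a')))" using C t0 by (intro mult_left_mono) auto
      also have "\<dots> \<le> (2 * C + 1) * t * (a + a')" using t0 a0 by (simp add: algebra_simps)
      also have "\<dots> < \<bar>a - a'\<bar> * (a + a')"
      proof (rule mult_strict_right_mono[OF big])
        have "\<bar>a - a'\<bar> > 0" using big C t0 by (smt (verit) mult_nonneg_nonneg)
        then show "a + a' > 0" using a0 by (auto simp: abs_if split: if_splits)
      qed
      finally show False using prod by simp
    qed
    then show "depth x' \<ge> 0 \<and> \<bar>sqrt (depth x) - sqrt (depth x')\<bar> \<le> (2 * C + 1) * t"
      using s0 by (simp add: a_def a'_def)
  qed
qed

end

section \<open>Lebesgue measure in the coordinates below the graph\<close>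

lemma nn_integral_lborel_translate:
  fixes \<phi> :: "'a::euclidean_space \<Rightarrow> ennreal"
  assumes [measurable]: "\<phi> \<in> borel_measurable borel"
  shows "(\<integral>\<^sup>+x. \<phi> (x + c) \<partial>lborel) = (\<integral>\<^sup>+x. \<phi> x \<partial>lborel)"
proof -
  have "(\<integral>\<^sup>+x. \<phi> x \<partial>lborel) = (\<integral>\<^sup>+x. \<phi> x \<partial>distr lborel borel ((+) c))"
    by (simp add: lborel_distr_plus)
  also have "\<dots> = (\<integral>\<^sup>+x. \<phi> (c + x) \<partial>lborel)" by (subst nn_integral_distr) auto
  finally show ?thesis by (simp add: add.commute)
qed

lemma nn_integral_lborel_reflect:
  fixes \<phi> :: "real \<Rightarrow> ennreal"
  assumes "\<phi> \<in> borel_measurable borel"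
  shows "(\<integral>\<^sup>+s. \<phi> (c - s) \<partial>lborel) = (\<integral>\<^sup>+s. \<phi> s \<partial>lborel)"
  using nn_integral_real_affine[OF assms, of "-1" c] by simp

lemma nn_integral_lborel_pair:
  fixes \<phi> :: "'a::euclidean_space \<times> 'b::euclidean_space \<Rightarrow> ennreal"
  assumes "\<phi> \<in> borel_measurable borel"
  shows "(\<integral>\<^sup>+x. \<phi> x \<partial>lborel) = (\<integral>\<^sup>+u. \<integral>\<^sup>+v. \<phi> (u, v) \<partial>lborel \<partial>lborel)"
  using lborel.nn_integral_fst[of \<phi> lborel] assms by (simp add: lborel_prod)

text \<open>Writing a vertical coordinate as \<open>g u - (\<bar>z\<bar>\<^sup>2 - a)\<close> with \<open>z\<close> in the plane
  turns Lebesgue measure below the graph into Lebesgue measure in \<open>(u, z)\<close>, where every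
  translation is measure preserving.\<close>

lemma graph_averaging_bound:
  fixes g :: "'a::euclidean_space \<Rightarrow> real" and \<mu> :: "('a \<times> complex) measure"
    and \<Phi> H :: "'a \<times> real \<Rightarrow> ennreal" and q :: "'a \<Rightarrow> 'a \<Rightarrow> real"
  assumes [measurable]: "g \<in> borel_measurable borel" "\<Phi> \<in> borel_measurable borel"
      "H \<in> borel_measurable borel" "Z \<in> sets borel"
    and q[measurable]: "(\<lambda>x. q (fst x) (snd x)) \<in> borel_measurable borel"
    and \<mu>: "sets \<mu> = sets borel" "emeasure \<mu> UNIV < \<infinity>"
    and Z: "\<And>x. x \<in> Z \<Longrightarrow> snd x \<le> g (fst x)" and a: "a \<ge> 0"
    and bound: "\<And>u z. (u, g u - ((cmod z)\<^sup>2 - a)) \<in> Z \<Longrightarrow> H (u, g u - ((cmod z)\<^sup>2 - a)) \<le>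
      A * (\<integral>\<^sup>+y. \<Phi> (u + fst y, q u (fst y) + (cmod (z + snd y))\<^sup>2 - a) \<partial>\<mu>)"
  shows "(\<integral>\<^sup>+x\<in>Z. H x \<partial>lborel) \<le> A * emeasure \<mu> UNIV * (\<integral>\<^sup>+x. \<Phi> x \<partial>lborel)"
proof -
  note [measurable_cong] = \<mu>(1)
  have [measurable]: "fst \<in> borel_measurable (borel :: ('b::euclidean_space \<times> 'c::euclidean_space) measure)"
    "snd \<in> borel_measurable (borel :: ('b::euclidean_space \<times> 'c::euclidean_space) measure)"
    by (auto intro!: borel_measurable_continuous_onI continuous_intros)
  have space\<mu>: "space \<mu> = UNIV" using sets_eq_imp_space_eq[OF \<mu>(1)] by simp
  interpret \<mu>: finite_measure \<mu> using \<mu>(2) by (intro finite_measureI) (simp add: space\<mu>)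
  interpret P: pair_sigma_finite \<mu> "lborel :: ('a \<times> complex) measure" ..
  have q2[measurable]: "(\<lambda>x. q (f x) (h x)) \<in> borel_measurable M"
    if [measurable]: "f \<in> borel_measurable M" "h \<in> borel_measurable M" for f h and M :: "'e measure"
    using measurable_compose[of "\<lambda>x. (f x, h x)" M borel, OF _ q] by simp
  define \<phi> where "\<phi> u s = H (u, g u - s) * indicator Z (u, g u - s)" for u s
  have \<phi>0: "\<phi> u s = 0" if "s < 0" for u s
    using Z[of "(u, g u - s)"] that by (auto simp: \<phi>_def indicator_def)
  \<comment> \<open>\<open>s\<close> is the depth below the graph. The plane reaches all depths from
    \<open>- a\<close> on and \<open>Z\<close> contains no negative ones, so the shift by
    \<open>a\<close> loses nothing. The factor \<open>pi\<close> occurs on both sides and cancels at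
    the end.\<close>
  have lift: "ennreal pi * (\<integral>\<^sup>+v. H (u, v) * indicator Z (u, v) \<partial>lborel) = (\<integral>\<^sup>+z. \<phi> u ((cmod z)\<^sup>2 - a) \<partial>lborel)" for u
  proof -
    have [measurable]: "\<phi> u \<in> borel_measurable borel" unfolding \<phi>_def by measurable
    have "(\<integral>\<^sup>+v. H (u, v) * indicator Z (u, v) \<partial>lborel) = (\<integral>\<^sup>+s. \<phi> u s \<partial>lborel)"
      unfolding \<phi>_def by (rule nn_integral_lborel_reflect[symmetric]) measurable
    also have "\<dots> = (\<integral>\<^sup>+s. \<phi> u (s + - a) \<partial>lborel)"
      by (rule nn_integral_lborel_translate[symmetric]) measurable
    also have "\<dots> = (\<integral>\<^sup>+s. \<phi> u (s - a) * indicator {0..} s \<partial>lborel)"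
      using \<phi>0 a by (intro nn_integral_cong) (auto simp: indicator_def)
    finally show ?thesis by (subst nn_integral_norm_square_complex) auto
  qed
  define G where "G y x = \<Phi> (fst x + fst y, q (fst x) (fst y) + (cmod (snd x + snd y))\<^sup>2 - a)" for y x
  have G[measurable]: "(\<lambda>(y, x). G y x) \<in> borel_measurable (borel \<Otimes>\<^sub>M borel)"
    unfolding G_def by measurable
  \<comment> \<open>The order of integration matters. The vertical shift depends on \<open>u\<close>
    and \<open>y\<close> only, so with \<open>u\<close> fixed first \<open>z\<close> and then the
    depth can be translated, and \<open>u\<close> itself comes last.\<close>
  have G_le: "(\<integral>\<^sup>+x. G y x \<partial>lborel) \<le> ennreal pi * (\<integral>\<^sup>+x. \<Phi> x \<partial>lborel)" for y
  proof -
    have "(\<integral>\<^sup>+x. G y x \<partial>lborel) = (\<integral>\<^sup>+u. \<integral>\<^sup>+z. \<Phi> (u + fst y, q u (fst y) + (cmod (z + snd y))\<^sup>2 - a) \<partial>lborel \<partial>lborel)"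
      by (subst nn_integral_lborel_pair) (auto simp: G_def)
    also have "\<dots> \<le> (\<integral>\<^sup>+u. ennreal pi * (\<integral>\<^sup>+s. \<Phi> (u + fst y, s) \<partial>lborel) \<partial>lborel)"
    proof (intro nn_integral_mono)
      fix u
      have "(\<integral>\<^sup>+z. \<Phi> (u + fst y, q u (fst y) + (cmod (z + snd y))\<^sup>2 - a) \<partial>lborel)
          = (\<integral>\<^sup>+z. \<Phi> (u + fst y, q u (fst y) + (cmod z)\<^sup>2 - a) \<partial>lborel)"
        by (rule nn_integral_lborel_translate) measurable
      also have "\<dots> = ennreal pi * (\<integral>\<^sup>+s. \<Phi> (u + fst y, q u (fst y) + s - a) * indicator {0..} s \<partial>lborel)"
        by (rule nn_integral_norm_square_complex) measurable
      also have "\<dots> \<le> ennreal pi * (\<integral>\<^sup>+s. \<Phi> (u + fst y, q u (fst y) + s - a) \<partial>lborel)"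
        by (intro mult_left_mono nn_integral_mono) (auto simp: indicator_def)
      also have "(\<integral>\<^sup>+s. \<Phi> (u + fst y, q u (fst y) + s - a) \<partial>lborel)
          = (\<integral>\<^sup>+s. \<Phi> (u + fst y, s + (q u (fst y) - a)) \<partial>lborel)"
        by (simp add: algebra_simps)
      also have "\<dots> = (\<integral>\<^sup>+s. \<Phi> (u + fst y, s) \<partial>lborel)"
        by (rule nn_integral_lborel_translate) measurable
      finally show "(\<integral>\<^sup>+z. \<Phi> (u + fst y, q u (fst y) + (cmod (z + snd y))\<^sup>2 - a) \<partial>lborel)
          \<le> ennreal pi * (\<integral>\<^sup>+s. \<Phi> (u + fst y, s) \<partial>lborel)" .
    qed
    also have "\<dots> = ennreal pi * (\<integral>\<^sup>+u. \<integral>\<^sup>+s. \<Phi> (u + fst y, s) \<partial>lborel \<partial>lborel)"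
      by (rule nn_integral_cmult) measurable
    also have "(\<integral>\<^sup>+u. \<integral>\<^sup>+s. \<Phi> (u + fst y, s) \<partial>lborel \<partial>lborel) = (\<integral>\<^sup>+u. \<integral>\<^sup>+s. \<Phi> (u, s) \<partial>lborel \<partial>lborel)"
      by (rule nn_integral_lborel_translate) measurable
    also have "\<dots> = (\<integral>\<^sup>+x. \<Phi> x \<partial>lborel)"
      by (rule nn_integral_lborel_pair[symmetric]) measurable
    finally show ?thesis .
  qed
  have "ennreal pi * (\<integral>\<^sup>+x\<in>Z. H x \<partial>lborel)
      = (\<integral>\<^sup>+u. ennreal pi * (\<integral>\<^sup>+v. H (u, v) * indicator Z (u, v) \<partial>lborel) \<partial>lborel)"
    by (subst nn_integral_lborel_pair, measurable, rule nn_integral_cmult[symmetric], measurable)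
  also have "\<dots> = (\<integral>\<^sup>+u. \<integral>\<^sup>+z. \<phi> u ((cmod z)\<^sup>2 - a) \<partial>lborel \<partial>lborel)" unfolding lift ..
  also have "\<dots> \<le> (\<integral>\<^sup>+u. \<integral>\<^sup>+z. A * (\<integral>\<^sup>+y. G y (u, z) \<partial>\<mu>) \<partial>lborel \<partial>lborel)"
  proof (intro nn_integral_mono)
    fix u :: 'a and z :: complex
    show "\<phi> u ((cmod z)\<^sup>2 - a) \<le> A * (\<integral>\<^sup>+y. G y (u, z) \<partial>\<mu>)"
      using bound[of u z] unfolding \<phi>_def G_def by (simp add: indicator_def)
  qed
  also have "\<dots> = (\<integral>\<^sup>+x. A * (\<integral>\<^sup>+y. G y x \<partial>\<mu>) \<partial>lborel)"
    by (rule nn_integral_lborel_pair[symmetric, where \<phi>="\<lambda>x. A * (\<integral>\<^sup>+y. G y x \<partial>\<mu>)"]) measurable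
  also have "\<dots> = A * (\<integral>\<^sup>+x. \<integral>\<^sup>+y. G y x \<partial>\<mu> \<partial>lborel)"
    by (rule nn_integral_cmult) measurable
  also have "\<dots> = A * (\<integral>\<^sup>+y. \<integral>\<^sup>+x. G y x \<partial>lborel \<partial>\<mu>)"
    by (intro arg_cong[where f="(*) A"] P.Fubini') measurable
  also have "\<dots> \<le> A * (\<integral>\<^sup>+y. ennreal pi * (\<integral>\<^sup>+x. \<Phi> x \<partial>lborel) \<partial>\<mu>)"
    by (intro mult_left_mono nn_integral_mono G_le) simp
  also have "\<dots> = ennreal pi * (A * emeasure \<mu> UNIV * (\<integral>\<^sup>+x. \<Phi> x \<partial>lborel))"
    by (simp add: space\<mu> mult_ac)
  finally show ?thesis by (subst (asm) ennreal_mult_le_mult_iff) auto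
qed

section \<open>Oscillation of polynomials near the boundary\<close>

lemma has_derivative_partial:
  fixes f :: "real ^ 'd \<Rightarrow> real"
  assumes "f differentiable_on UNIV"
  shows "(f has_derivative (\<lambda>h. (\<chi> i. partial i f u) \<bullet> h)) (at u)"
proof -
  have d: "(f has_derivative frechet_derivative f (at u)) (at u)"
    using assms by (auto simp: differentiable_on_def frechet_derivative_works[symmetric])
  then interpret bounded_linear "frechet_derivative f (at u)" by (rule has_derivative_bounded_linear)
  have "frechet_derivative f (at u) h = (\<chi> i. partial i f u) \<bullet> h" for h
  proof -
    have "frechet_derivative f (at u) h = frechet_derivative f (at u) (\<Sum>i\<in>UNIV. h $ i *\<^sub>R axis i 1)"
      using basis_expansion[of h] by (simp add: scalar_mult_eq_scaleR)
    also have "\<dots> = (\<Sum>i\<in>UNIV. h $ i * partial i f u)" by (simp add: sum scaleR partial_def)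
    finally show ?thesis by (simp add: inner_vec_def mult.commute)
  qed
  then have "frechet_derivative f (at u) = (\<lambda>h. (\<chi> i. partial i f u) \<bullet> h)" by (rule ext)
  with d show ?thesis by simp
qed

text \<open>The Hessian is bounded only entrywise; passing to Euclidean norms twice costs the square
  of the dimension.\<close>

lemma C2_function_gradient:
  fixes g :: "real ^ 'd \<Rightarrow> real"
  assumes g: "C2_function g" and M: "\<And>i k x. \<bar>partial i (partial k g) x\<bar> \<le> M"
  obtains Dg B where "B \<ge> 0" "\<And>u. (g has_derivative (\<lambda>h. Dg u \<bullet> h)) (at u)"
    "\<And>u v. norm (Dg u - Dg v) \<le> B * norm (u - v)"
proof -
  define Dg :: "real ^ 'd \<Rightarrow> real ^ 'd" where "Dg u = (\<chi> i. partial i g u)" for u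
  have M0: "M \<ge> 0" using order.trans[OF abs_ge_zero M] .
  define n where "n = real CARD('d)"
  have lip: "\<bar>partial k g u - partial k g v\<bar> \<le> (n * M) * norm (u - v)" for k u v
  proof -
    have "norm (partial k g u - partial k g v) \<le> (n * M) * norm (u - v)"
    proof (rule differentiable_bound[of UNIV "partial k g" "\<lambda>x h. (\<chi> i. partial i (partial k g) x) \<bullet> h"])
      fix x :: "real ^ 'd"
      show "(partial k g has_derivative (\<lambda>h. (\<chi> i. partial i (partial k g) x) \<bullet> h)) (at x within UNIV)"
        using g by (intro has_derivative_partial) (auto simp: C2_function_def)
      show "onorm (\<lambda>h. (\<chi> i. partial i (partial k g) x) \<bullet> h) \<le> n * M"
      proof (rule onorm_le)
        fix h :: "real ^ 'd"
        have "norm (\<chi> i. partial i (partial k g) x) \<le> (\<Sum>i\<in>UNIV. \<bar>(\<chi> i. partial i (partial k g) x) $ i\<bar>)"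
          by (rule norm_le_l1_cart)
        also have "\<dots> \<le> (\<Sum>i\<in>(UNIV :: 'd set). M)" by (intro sum_mono) (simp add: M)
        finally have "norm (\<chi> i. partial i (partial k g) x) \<le> n * M" by (simp add: n_def)
        then show "norm ((\<chi> i. partial i (partial k g) x) \<bullet> h) \<le> n * M * norm h"
          using order.trans[OF Cauchy_Schwarz_ineq2 mult_right_mono] by simp
      qed
    qed auto
    then show ?thesis by simp
  qed
  show thesis
  proof
    show "0 \<le> n * (n * M)" using M0 by (simp add: n_def)
    show "(g has_derivative (\<lambda>h. Dg u \<bullet> h)) (at u)" for u
      unfolding Dg_def using g by (intro has_derivative_partial) (auto simp: C2_function_def)
    fix u v
    have "norm (Dg u - Dg v) \<le> (\<Sum>i\<in>UNIV. \<bar>(Dg u - Dg v) $ i\<bar>)" by (rule norm_le_l1_cart)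
    also have "\<dots> \<le> (\<Sum>i\<in>(UNIV :: 'd set). (n * M) * norm (u - v))"
      by (intro sum_mono) (simp add: Dg_def lip)
    finally show "norm (Dg u - Dg v) \<le> n * (n * M) * norm (u - v)" by (simp add: n_def mult_ac)
  qed
qed

text \<open>Mean value inequality for \<open>g x - Dg u \<bullet> x\<close> on the ball of radius
  \<open>norm h\<close>, where its gradient has norm at most \<open>B * norm h\<close>.\<close>

lemma lipschitz_gradient_taylor:
  fixes g :: "'a::euclidean_space \<Rightarrow> real"
  assumes D: "\<And>u. (g has_derivative (\<lambda>h. Dg u \<bullet> h)) (at u)"
    and lip: "\<And>u v. norm (Dg u - Dg v) \<le> B * norm (u - v)" and "B \<ge> 0"
  shows "\<bar>g (u + h) - g u - Dg u \<bullet> h\<bar> \<le> B * (norm h)\<^sup>2"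
proof -
  have "norm ((g (u + h) - Dg u \<bullet> (u + h)) - (g u - Dg u \<bullet> u)) \<le> (B * norm h) * norm ((u + h) - u)"
  proof (rule differentiable_bound[of "cball u (norm h)" "\<lambda>x. g x - Dg u \<bullet> x" "\<lambda>x k. Dg x \<bullet> k - Dg u \<bullet> k"])
    fix x assume x: "x \<in> cball u (norm h)"
    show "((\<lambda>x. g x - Dg u \<bullet> x) has_derivative (\<lambda>k. Dg x \<bullet> k - Dg u \<bullet> k)) (at x within cball u (norm h))"
      by (intro derivative_intros has_derivative_at_withinI[OF D])
    show "onorm (\<lambda>k. Dg x \<bullet> k - Dg u \<bullet> k) \<le> B * norm h"
    proof (rule onorm_le)
      fix k
      have "norm (Dg x \<bullet> k - Dg u \<bullet> k) \<le> norm (Dg x - Dg u) * norm k"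
        unfolding inner_diff_left[symmetric] using Cauchy_Schwarz_ineq2 by simp
      also have "norm (Dg x - Dg u) \<le> B * norm (x - u)" by (rule lip)
      also have "\<dots> \<le> B * norm h" using x \<open>B \<ge> 0\<close> by (intro mult_left_mono) (auto simp: dist_norm norm_minus_commute)
      finally show "norm (Dg x \<bullet> k - Dg u \<bullet> k) \<le> B * norm h * norm k" by (simp add: mult_right_mono)
    qed
  qed (auto simp: dist_norm)
  then show ?thesis by (simp add: inner_add_right power2_eq_square algebra_simps)
qed

text \<open>Mean value inequality for \<open>g (w + x) - g (u + x)\<close> as a function of
  \<open>x\<close>, whose gradient has norm at most \<open>B * norm (w - u)\<close>.\<close>

lemma lipschitz_gradient_second_difference:
  fixes g :: "'a::euclidean_space \<Rightarrow> real"
  assumes D: "\<And>u. (g has_derivative (\<lambda>h. Dg u \<bullet> h)) (at u)"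
    and lip: "\<And>u v. norm (Dg u - Dg v) \<le> B * norm (u - v)"
  shows "\<bar>(g (w + h) - g w) - (g (u + h) - g u)\<bar> \<le> B * norm (w - u) * norm h"
proof -
  have "norm ((g (w + h) - g (u + h)) - (g (w + 0) - g (u + 0))) \<le> (B * norm (w - u)) * norm (h - 0)"
  proof (rule differentiable_bound[of UNIV "\<lambda>x. g (w + x) - g (u + x)" "\<lambda>x k. Dg (w + x) \<bullet> k - Dg (u + x) \<bullet> k"])
    fix x
    have shift: "((\<lambda>x. g (c + x)) has_derivative (\<lambda>k. Dg (c + x) \<bullet> k)) (at x)" for c
    proof -
      have "((\<lambda>x. c + x) has_derivative (\<lambda>k. k)) (at x)" by (auto intro!: derivative_eq_intros)
      from has_derivative_compose[OF this D] show ?thesis .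
    qed
    show "((\<lambda>x. g (w + x) - g (u + x)) has_derivative (\<lambda>k. Dg (w + x) \<bullet> k - Dg (u + x) \<bullet> k)) (at x within UNIV)"
      using shift by (auto intro!: has_derivative_diff)
    show "onorm (\<lambda>k. Dg (w + x) \<bullet> k - Dg (u + x) \<bullet> k) \<le> B * norm (w - u)"
    proof (rule onorm_le)
      fix k
      have "norm (Dg (w + x) \<bullet> k - Dg (u + x) \<bullet> k) \<le> norm (Dg (w + x) - Dg (u + x)) * norm k"
        unfolding inner_diff_left[symmetric] using Cauchy_Schwarz_ineq2 by simp
      also have "norm (Dg (w + x) - Dg (u + x)) \<le> B * norm (w - u)" using lip[of "w + x" "u + x"] by simp
      finally show "norm (Dg (w + x) \<bullet> k - Dg (u + x) \<bullet> k) \<le> B * norm (w - u) * norm k" by (simp add: mult_right_mono)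
    qed
  qed auto
  moreover have "(g (w + h) - g w) - (g (u + h) - g u) = (g (w + h) - g (u + h)) - (g (w + 0) - g (u + 0))" by simp
  ultimately show ?thesis by simp
qed

text \<open>The only trace of total degree that the analysis uses: coordinate lines of the
  paraboloid parametrisation are quadratic curves. Unlike a representation by coefficients, the
  property is visibly stable under affine maps, such as the chart coordinates.\<close>

definition quadratic_curve_poly :: "nat \<Rightarrow> ('a::real_vector \<Rightarrow> real) \<Rightarrow> bool" where
  "quadratic_curve_poly N f \<longleftrightarrow>
     (\<forall>x y z. \<exists>p. degree p \<le> N \<and> (\<forall>t. f (x + t *\<^sub>R y + t\<^sup>2 *\<^sub>R z) = poly p t))"

text \<open>\<open>H\<close> is at most the oscillation of \<open>f\<close> over the points of \<open>K\<close> near \<open>x\<close>; phrased without a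
  supremum so that any measurable average of differences qualifies.\<close>

definition dominated_by_oscillation ::
    "'a::euclidean_space set \<Rightarrow> ('a \<Rightarrow> 'a \<Rightarrow> bool) \<Rightarrow> ('a \<Rightarrow> real) \<Rightarrow> 'a set \<Rightarrow> ('a \<Rightarrow> ennreal) \<Rightarrow> bool" where
  "dominated_by_oscillation K near f Z H \<longleftrightarrow> H \<in> borel_measurable borel \<and>
     (\<forall>x\<in>Z. \<forall>A. (\<forall>x'\<in>K. near x x' \<longrightarrow> ennreal \<bar>f x' - f x\<bar> \<le> A) \<longrightarrow> H x \<le> A)"

text \<open>\<open>e\<close> and \<open>C\<close> are fixed before \<open>n\<close>,
  \<open>\<epsilon>\<close> and \<open>f\<close>, which makes the final threshold uniform.
  \<open>Z\<close> ranges over all Borel parts of \<open>G\<close> so that estimates on several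
  regions can be added; \<open>near\<close> is a parameter because interior points are handled with
  the plain distance.\<close>

definition oscillation_estimate ::
    "'a::euclidean_space set \<Rightarrow> (real \<Rightarrow> 'a \<Rightarrow> 'a \<Rightarrow> bool) \<Rightarrow> 'a set \<Rightarrow> real \<Rightarrow> real \<Rightarrow> bool" where
  "oscillation_estimate K near G e C \<longleftrightarrow> e > 0 \<and> C \<ge> 0 \<and>
     (\<forall>(n::nat) \<epsilon> f Z H. n \<ge> 1 \<longrightarrow> 0 < \<epsilon> \<longrightarrow> \<epsilon> \<le> e \<longrightarrow> continuous_on UNIV f \<longrightarrow>
        quadratic_curve_poly (2 * n) f \<longrightarrow> Z \<in> sets borel \<longrightarrow> Z \<subseteq> K \<inter> G \<longrightarrow>
        dominated_by_oscillation K (near (\<epsilon> / n)) f Z H \<longrightarrow>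
        (\<integral>\<^sup>+x\<in>Z. H x \<partial>lborel) \<le> ennreal (C * \<epsilon>) * (\<integral>\<^sup>+x\<in>K. ennreal \<bar>f x\<bar> \<partial>lborel))"

lemma oscillation_estimateD:
  assumes "oscillation_estimate K near G e C" "n \<ge> 1" "0 < \<epsilon>" "\<epsilon> \<le> e" "continuous_on UNIV f"
    "quadratic_curve_poly (2 * n) f" "Z \<in> sets borel" "Z \<subseteq> K \<inter> G"
    "dominated_by_oscillation K (near (\<epsilon> / n)) f Z H"
  shows "(\<integral>\<^sup>+x\<in>Z. H x \<partial>lborel) \<le> ennreal (C * \<epsilon>) * (\<integral>\<^sup>+x\<in>K. ennreal \<bar>f x\<bar> \<partial>lborel)"
  using assms unfolding oscillation_estimate_def by blast

lemma oscillation_estimate_mono: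
  assumes "oscillation_estimate K near G e C" "\<And>t x x'. near' t x x' \<Longrightarrow> near t x x'"
  shows "oscillation_estimate K near' G e C"
proof -
  have "dominated_by_oscillation K (near t) f Z H" if "dominated_by_oscillation K (near' t) f Z H" for t f Z H
    using that assms(2) unfolding dominated_by_oscillation_def by meson
  with assms(1) show ?thesis unfolding oscillation_estimate_def by meson
qed

text \<open>Along a coordinate line the base point moves linearly and the height is quadratic in
  \<open>t\<close>, so \<open>f\<close> is evaluated on a quadratic curve.\<close>

lemma coordinatewise_poly_lift:
  fixes f :: "'a::euclidean_space \<times> real \<Rightarrow> real"
  assumes "quadratic_curve_poly N f"
  shows "coordinatewise_poly N (\<lambda>y :: 'a \<times> complex.
    f (u + fst y, c + d \<bullet> fst y - B * (norm (fst y))\<^sup>2 - (cmod (z + snd y))\<^sup>2))"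
  unfolding coordinatewise_poly_def
proof (intro allI ballI)
  fix x b :: "'a \<times> complex"
  define \<alpha> where "\<alpha> = c + d \<bullet> fst x - B * (norm (fst x))\<^sup>2 - (cmod (z + snd x))\<^sup>2"
  define \<beta> where "\<beta> = d \<bullet> fst b - 2 * B * (fst x \<bullet> fst b) - 2 * ((z + snd x) \<bullet> snd b)"
  define \<gamma> where "\<gamma> = - B * (norm (fst b))\<^sup>2 - (cmod (snd b))\<^sup>2"
  obtain p where p: "degree p \<le> N"
    "\<And>t. f ((u + fst x, \<alpha>) + t *\<^sub>R (fst b, \<beta>) + t\<^sup>2 *\<^sub>R (0, \<gamma>)) = poly p t"
    using assms unfolding quadratic_curve_poly_def by blast
  have sq: "(norm (v + t *\<^sub>R w))\<^sup>2 = (norm v)\<^sup>2 + 2 * t * (v \<bullet> w) + t\<^sup>2 * (norm w)\<^sup>2"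
    for v w :: "'e::real_inner" and t
    unfolding power2_norm_eq_inner by (simp add: inner_add_left inner_add_right inner_commute power2_eq_square algebra_simps)
  have "f (u + fst (x + t *\<^sub>R b), c + d \<bullet> fst (x + t *\<^sub>R b) - B * (norm (fst (x + t *\<^sub>R b)))\<^sup>2
      - (cmod (z + snd (x + t *\<^sub>R b)))\<^sup>2) = poly p t" for t
  proof -
    have 1: "c + d \<bullet> fst (x + t *\<^sub>R b) - B * (norm (fst (x + t *\<^sub>R b)))\<^sup>2
      - (cmod (z + snd (x + t *\<^sub>R b)))\<^sup>2 = \<alpha> + t * \<beta> + t\<^sup>2 * \<gamma>"
      using sq[of "fst x" t "fst b"] sq[of "z + snd x" t "snd b"]
      by (simp add: \<alpha>_def \<beta>_def \<gamma>_def inner_add_right add.assoc algebra_simps)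
    show ?thesis unfolding 1 using p(2)[of t] by (simp add: add.assoc)
  qed
  then show "\<exists>p. degree p \<le> N \<and> (\<forall>t. f (u + fst (x + t *\<^sub>R b), c + d \<bullet> fst (x + t *\<^sub>R b)
      - B * (norm (fst (x + t *\<^sub>R b)))\<^sup>2 - (cmod (z + snd (x + t *\<^sub>R b)))\<^sup>2) = poly p t)"
    using p(1) by blast
qed

lemma sqrt_add_diff_le:
  assumes "0 \<le> p" "0 \<le> c"
  shows "\<bar>sqrt (p + c) - sqrt p\<bar> \<le> sqrt c"
  using assms sqrt_add_le_add_sqrt[of p c] by (simp add: abs_le_iff real_sqrt_le_mono add_increasing2 algebra_simps)

section \<open>Oscillation estimate in one boundary chart\<close>

locale smooth_graph_domain = graph_domain K U g L B R
  for K U :: "('a::euclidean_space \<times> real) set" and g :: "'a \<Rightarrow> real" and L B R :: real +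
  fixes Dg :: "'a \<Rightarrow> 'a"
  assumes Dg_cont: "continuous_on UNIV Dg"
    and g_taylor: "\<And>u h. \<bar>g (u + h) - g u - Dg u \<bullet> h\<bar> \<le> B * (norm h)\<^sup>2"
begin

definition gap :: "'a \<Rightarrow> 'a \<Rightarrow> real" where
  "gap u h = g (u + h) - (g u + Dg u \<bullet> h - B * (norm h)\<^sup>2)"

lemma gap_bounds: "0 \<le> gap u h" "gap u h \<le> 2 * (B * (norm h)\<^sup>2)"
  using g_taylor[of u h] unfolding gap_def by auto

text \<open>The base points at which the one-dimensional extension inequality is useful: the segment
  that carries its right-hand side has to lie in \<open>K\<close>.\<close>

definition columns :: "real \<Rightarrow> 'a set" where
  "columns S = {u. \<forall>s\<in>{0..S}. (u, g u - s) \<in> K}"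

lemma closed_columns: "closed (columns S)"
proof -
  have "columns S = (\<Inter>s\<in>{0..S}. (\<lambda>u. (u, g u - s)) -` K)" unfolding columns_def by auto
  moreover have "closed ((\<lambda>u. (u, g u - s)) -` K)" for s
    by (intro closed_vimage closed_K continuous_intros g_cont)
  ultimately show ?thesis by (auto intro!: closed_INT)
qed

text \<open>Every point of the column lies within \<open>\<delta>\<close> of \<open>x\<close>, where
  the graph decides membership: the base shift, the rise \<open>L * \<rho>\<close> of the graph, the
  column length \<open>S\<close> and the depth of \<open>x\<close> add up to the last
  hypothesis.\<close>

lemma columns_near:
  assumes x: "x \<in> K" and U: "cball x \<delta> \<subseteq> U" and \<delta>: "\<delta> \<le> 1" "bdist x < \<delta>"
    and h: "norm h \<le> \<rho>" "\<rho> \<le> 1" and S: "(1 + L) * \<rho> + S + (L + 1) * bdist x \<le> \<delta>"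
  shows "fst x + h \<in> columns S"
  unfolding columns_def
proof (intro CollectI ballI)
  fix s assume s: "s \<in> {0..S}"
  define y where "y = (fst x + h, g (fst x + h) - s)"
  have xU: "x \<in> U" using U \<delta> bdist_nonneg[of x] by auto
  have d0: "0 \<le> depth x" using in_K_iff[OF xU] x by simp
  have "norm (fst x) \<le> R" by (rule norm_fst_le_R[OF x])
  then have gl: "\<bar>g (fst x + h) - g (fst x)\<bar> \<le> L * norm h"
    using g_lip[of "fst x + h" "fst x"] h norm_triangle_ineq[of "fst x" h] by simp
  also have "\<dots> \<le> L * \<rho>" using h L0 by (intro mult_left_mono)
  finally have gl: "\<bar>g (fst x + h) - g (fst x)\<bar> \<le> L * \<rho>" .
  have "dist x y \<le> norm (fst x - fst y) + \<bar>snd x - snd y\<bar>" by (rule dist_prod_real_le)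
  also have "norm (fst x - fst y) \<le> \<rho>" using h by (simp add: y_def)
  also have "\<bar>snd x - snd y\<bar> \<le> L * \<rho> + S + depth x"
    using gl s d0 by (simp add: y_def depth_def abs_le_iff)
  also have "depth x \<le> (L + 1) * bdist x" by (rule depth_le_bdist[OF x U \<delta>])
  finally have "dist x y \<le> \<delta>" using S by (simp add: algebra_simps)
  then have "y \<in> U" using U by auto
  then show "(fst x + h, g (fst x + h) - s) \<in> K"
    using in_K_iff[of y] s by (simp add: y_def depth_def)
qed

text \<open>On each vertical line \<open>f\<close> is a polynomial in the depth, so the extension
  inequality absorbs the part above the graph, with depths down to \<open>- a\<close>, into the part
  inside \<open>K\<close>.\<close>

lemma nn_integral_columns_le:
  fixes f :: "'a \<times> real \<Rightarrow> real"
  assumes f: "continuous_on UNIV f" "quadratic_curve_poly N f"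
    and S: "0 < S" "0 \<le> a" "8 * a * (real N + 1)\<^sup>2 \<le> S"
  shows "(\<integral>\<^sup>+x. ennreal \<bar>f (fst x, g (fst x) - snd x)\<bar> * indicator (columns S \<times> {-a..S}) x \<partial>lborel)
    \<le> 2 * (\<integral>\<^sup>+x\<in>K. ennreal \<bar>f x\<bar> \<partial>lborel)"
proof -
  have [measurable]: "f \<in> borel_measurable borel" "g \<in> borel_measurable borel"
    "columns S \<in> sets borel" "K \<in> sets borel"
    "fst \<in> borel_measurable (borel :: ('a \<times> real) measure)"
    "snd \<in> borel_measurable (borel :: ('a \<times> real) measure)"
    using f(1) g_cont closed_columns closed_K
    by (auto intro!: borel_measurable_continuous_onI continuous_intros borel_closed)
  have ind: "indicator (columns S \<times> {-a..S}) (u, s) = (indicator (columns S) u * indicator {-a..S} s :: ennreal)" for u s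
    by (auto simp: indicator_def)
  have m1: "columns S \<times> {-a..S} \<in> sets borel"
    by (intro borel_closed closed_Times closed_columns closed_atLeastAtMost)
  have "(\<integral>\<^sup>+x. ennreal \<bar>f (fst x, g (fst x) - snd x)\<bar> * indicator (columns S \<times> {-a..S}) x \<partial>lborel)
      = (\<integral>\<^sup>+u. \<integral>\<^sup>+s. ennreal \<bar>f (u, g u - s)\<bar> * indicator (columns S \<times> {-a..S}) (u, s) \<partial>lborel \<partial>lborel)"
    using m1 by (subst nn_integral_lborel_pair) auto
  also have "\<dots> \<le> (\<integral>\<^sup>+u. 2 * (\<integral>\<^sup>+s. ennreal \<bar>f (u, g u - s)\<bar> * indicator K (u, g u - s) \<partial>lborel) \<partial>lborel)"
  proof (intro nn_integral_mono)
    fix u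
    obtain p where p: "degree p \<le> N" "\<And>t. f ((u, g u) + t *\<^sub>R (0, -1) + t\<^sup>2 *\<^sub>R (0, 0)) = poly p t"
      using f(2) unfolding quadratic_curve_poly_def by blast
    have fp: "f (u, g u - s) = poly p s" for s using p(2)[of s] by simp
    show "(\<integral>\<^sup>+s. ennreal \<bar>f (u, g u - s)\<bar> * indicator (columns S \<times> {-a..S}) (u, s) \<partial>lborel)
        \<le> 2 * (\<integral>\<^sup>+s. ennreal \<bar>f (u, g u - s)\<bar> * indicator K (u, g u - s) \<partial>lborel)"
    proof (cases "u \<in> columns S")
      case True
      have "(\<integral>\<^sup>+s. ennreal \<bar>f (u, g u - s)\<bar> * indicator (columns S \<times> {-a..S}) (u, s) \<partial>lborel)
          = (\<integral>\<^sup>+s\<in>{-a..S}. ennreal \<bar>poly p s\<bar> \<partial>lborel)"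
        using True by (simp add: ind fp)
      also have "\<dots> \<le> 2 * (\<integral>\<^sup>+s\<in>{0..S}. ennreal \<bar>poly p s\<bar> \<partial>lborel)"
        by (rule nn_integral_poly_extend_interval[OF p(1) S])
      also have "\<dots> \<le> 2 * (\<integral>\<^sup>+s. ennreal \<bar>f (u, g u - s)\<bar> * indicator K (u, g u - s) \<partial>lborel)"
        using True by (intro mult_left_mono nn_integral_mono) (auto simp: fp columns_def indicator_def)
      finally show ?thesis .
    qed (simp add: ind)
  qed
  also have "\<dots> = 2 * (\<integral>\<^sup>+u. \<integral>\<^sup>+s. ennreal \<bar>f (u, g u - s)\<bar> * indicator K (u, g u - s) \<partial>lborel \<partial>lborel)"
    by (rule nn_integral_cmult) measurable
  also have "(\<lambda>u. \<integral>\<^sup>+s. ennreal \<bar>f (u, g u - s)\<bar> * indicator K (u, g u - s) \<partial>lborel)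
      = (\<lambda>u. \<integral>\<^sup>+s. ennreal \<bar>f (u, s)\<bar> * indicator K (u, s) \<partial>lborel)"
    by (intro ext nn_integral_lborel_reflect[where \<phi>="\<lambda>s. ennreal \<bar>f (u, s)\<bar> * indicator K (u, s)" for u]) measurable
  also have "(\<integral>\<^sup>+u. \<integral>\<^sup>+s. ennreal \<bar>f (u, s)\<bar> * indicator K (u, s) \<partial>lborel \<partial>lborel)
      = (\<integral>\<^sup>+x\<in>K. ennreal \<bar>f x\<bar> \<partial>lborel)"
    by (rule nn_integral_lborel_pair[symmetric]) measurable
  finally show ?thesis .
qed

text \<open>Both values of \<open>f\<close> are values of a single function \<open>F\<close>:
  \<open>f x\<close> at \<open>0\<close> and \<open>f x'\<close> at \<open>(h1, z1 - z)\<close>, a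
  displacement of order \<open>t\<close> in every direction. The averaging measure applies to
  \<open>F\<close>, and the points that it charges are then rewritten in terms of base point and
  depth below the graph.\<close>

lemma local_oscillation_bound:
  fixes f :: "'a \<times> real \<Rightarrow> real" and \<mu> :: "('a \<times> complex) measure" and r :: real
  assumes f: "continuous_on UNIV f" "quadratic_curve_poly N f"
    and x: "x \<in> K" and U: "cball x \<delta> \<subseteq> U" and \<delta>: "\<delta> \<le> 1" "bdist x < \<delta>"
    and x': "x' \<in> K" "norm (fst x' - fst x) \<le> t" "depth x' \<ge> 0"
    and C: "\<bar>sqrt (depth x) - sqrt (depth x')\<bar> \<le> C * t"
    and a: "a = 2 * B * t\<^sup>2" and z: "(cmod z)\<^sup>2 = depth x + a"
    and \<rho>: "\<rho> = DIM('a) * r" "\<rho> \<le> 1" "(1 + L) * \<rho> + S + (L + 1) * bdist x \<le> \<delta>"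
    and S: "2 * B * \<rho>\<^sup>2 + 2 * depth x + 2 * a + 8 * r\<^sup>2 \<le> S"
    and \<mu>: "sets \<mu> = sets borel" "AE y in \<mu>. \<forall>b\<in>Basis. \<bar>y \<bullet> b\<bar> \<le> r"
    and osc: "\<And>F h. F \<in> borel_measurable borel \<Longrightarrow> coordinatewise_poly N F \<Longrightarrow>
      \<forall>b\<in>Basis. \<bar>h \<bullet> b\<bar> \<le> (C + 2 * sqrt (2 * B) + 1) * t \<Longrightarrow>
      ennreal \<bar>F h - F 0\<bar> \<le> A * (\<integral>\<^sup>+y. ennreal \<bar>F y\<bar> \<partial>\<mu>)"
  shows "ennreal \<bar>f x' - f x\<bar> \<le> A * (\<integral>\<^sup>+y. ennreal \<bar>f (fst x + fst y,
      g (fst x + fst y) - (gap (fst x) (fst y) + (cmod (z + snd y))\<^sup>2 - a))\<bar> *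
      indicator (columns S \<times> {-a..S}) (fst x + fst y, gap (fst x) (fst y) + (cmod (z + snd y))\<^sup>2 - a) \<partial>\<mu>)"
proof -
  define u where "u = fst x"
  define h1 where "h1 = fst x' - u"
  have t0: "t \<ge> 0" using order.trans[OF norm_ge_zero x'(2)] .
  have xU: "x \<in> U" using U \<delta> bdist_nonneg[of x] by auto
  have s0: "0 \<le> depth x" using in_K_iff[OF xU] x by simp
  have a0: "a \<ge> 0" using B0 by (simp add: a)
  have h1: "norm h1 \<le> t" using x'(2) by (simp add: h1_def u_def)
  \<comment> \<open>This dictates \<open>a = 2 * B * t\<^sup>2\<close>: over base shifts of length
    at most \<open>t\<close> the gap never exceeds \<open>a\<close>, so
    \<open>depth x' + (a - gap u h1)\<close> has a real square root.\<close>
  have gap1: "0 \<le> gap u h1" "gap u h1 \<le> a"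
  proof -
    have "B * (norm h1)\<^sup>2 \<le> B * t\<^sup>2" using h1 B0 by (intro mult_left_mono power_mono) auto
    then show "0 \<le> gap u h1" "gap u h1 \<le> a" using gap_bounds[of u h1] by (auto simp: a)
  qed
  \<comment> \<open>\<open>z1\<close> is put on the ray through \<open>z\<close>, so that only the
    moduli differ; for \<open>z = 0\<close> any direction will do.\<close>
  define e where "e = (if z = 0 then 1 else sgn z)"
  have e: "cmod e = 1" by (simp add: e_def norm_sgn)
  have ze: "z = of_real (cmod z) * e" by (simp add: e_def sgn_eq)
  define \<rho>' where "\<rho>' = sqrt (depth x' + (a - gap u h1))"
  have \<rho>'0: "\<rho>' \<ge> 0" using x'(3) gap1 by (simp add: \<rho>'_def)
  have \<rho>'2: "\<rho>'\<^sup>2 = depth x' + (a - gap u h1)" using x'(3) gap1 by (simp add: \<rho>'_def)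
  define z1 where "z1 = of_real \<rho>' * e"
  have cz: "cmod z = sqrt (depth x + a)" using z by (metis norm_ge_zero real_sqrt_unique)
  \<comment> \<open>The moduli of \<open>z\<close> and \<open>z1\<close> differ from the square
    roots of the depths by at most \<open>sqrt a\<close> each, whence the term
    \<open>2 * sqrt (2 * B)\<close>.\<close>
  have sqa: "sqrt a = sqrt (2 * B) * t" using t0 by (simp add: a real_sqrt_mult)
  have zdiff: "cmod (z1 - z) \<le> (C + 2 * sqrt (2 * B)) * t"
  proof -
    have "z1 - z = of_real (\<rho>' - cmod z) * e" unfolding z1_def by (subst ze) (simp add: algebra_simps)
    then have "cmod (z1 - z) = \<bar>\<rho>' - cmod z\<bar>" by (simp only: norm_mult e norm_of_real mult_1_right)
    also have "\<dots> \<le> \<bar>\<rho>' - sqrt (depth x')\<bar> + \<bar>sqrt (depth x') - sqrt (depth x)\<bar> + \<bar>sqrt (depth x) - cmod z\<bar>" by simp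
    also have "\<bar>\<rho>' - sqrt (depth x')\<bar> \<le> sqrt a"
      unfolding \<rho>'_def using gap1 x'(3) by (intro order.trans[OF sqrt_add_diff_le]) auto
    also have "\<bar>sqrt (depth x) - cmod z\<bar> \<le> sqrt a"
      unfolding cz using sqrt_add_diff_le[OF s0 a0] by (simp add: abs_minus_commute)
    also have "\<bar>sqrt (depth x') - sqrt (depth x)\<bar> \<le> C * t" using C by (simp add: abs_minus_commute)
    finally show ?thesis unfolding sqa by (simp add: algebra_simps)
  qed
  define F where "F y = f (u + fst y, (g u + a) + Dg u \<bullet> fst y - B * (norm (fst y))\<^sup>2 - (cmod (z + snd y))\<^sup>2)"
    for y :: "'a \<times> complex"
  have cont: "continuous_on UNIV F" unfolding F_def
    by (intro continuous_intros continuous_on_compose2[OF f(1)]) auto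
  have Fx: "F 0 = f x" unfolding F_def using z by (cases x) (simp add: u_def depth_def)
  have Fx': "F (h1, z1 - z) = f x'"
  proof -
    have "(cmod (z + (z1 - z)))\<^sup>2 = \<rho>'\<^sup>2" by (simp add: z1_def norm_mult e)
    then show ?thesis unfolding F_def \<rho>'2
      by (cases x') (simp add: gap_def depth_def h1_def)
  qed
  have "\<forall>b\<in>Basis. \<bar>(h1, z1 - z) \<bullet> b\<bar> \<le> (C + 2 * sqrt (2 * B) + 1) * t"
  proof
    fix b :: "'a \<times> complex" assume "b \<in> Basis"
    then have "\<bar>(h1, z1 - z) \<bullet> b\<bar> \<le> norm (h1, z1 - z)" by (rule Basis_le_norm)
    also have "\<dots> \<le> norm h1 + norm (z1 - z)" by (rule norm_Pair_le)
    finally show "\<bar>(h1, z1 - z) \<bullet> b\<bar> \<le> (C + 2 * sqrt (2 * B) + 1) * t" using h1 zdiff by (simp add: algebra_simps)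
  qed
  from osc[OF borel_measurable_continuous_onI[OF cont] _ this]
  have "ennreal \<bar>f x' - f x\<bar> \<le> A * (\<integral>\<^sup>+y. ennreal \<bar>F y\<bar> \<partial>\<mu>)"
    unfolding Fx Fx' using coordinatewise_poly_lift[OF f(2)] unfolding F_def by blast
  also have "\<dots> \<le> A * (\<integral>\<^sup>+y. ennreal \<bar>f (u + fst y, g (u + fst y) - (gap u (fst y) + (cmod (z + snd y))\<^sup>2 - a))\<bar> *
      indicator (columns S \<times> {-a..S}) (u + fst y, gap u (fst y) + (cmod (z + snd y))\<^sup>2 - a) \<partial>\<mu>)"
  proof (intro mult_left_mono nn_integral_mono_AE)
    show "AE y in \<mu>. ennreal \<bar>F y\<bar> \<le> ennreal \<bar>f (u + fst y, g (u + fst y) - (gap u (fst y) + (cmod (z + snd y))\<^sup>2 - a))\<bar> *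
      indicator (columns S \<times> {-a..S}) (u + fst y, gap u (fst y) + (cmod (z + snd y))\<^sup>2 - a)"
      using \<mu>(2)
    proof eventually_elim
      case (elim y)
      have n1: "norm (fst y) \<le> \<rho>"
      proof -
        have "norm (fst y) \<le> (\<Sum>b\<in>Basis. \<bar>fst y \<bullet> b\<bar>)" by (rule norm_le_l1)
        also have "\<dots> \<le> (\<Sum>b\<in>(Basis :: 'a set). r)"
        proof (intro sum_mono)
          fix b :: 'a assume "b \<in> Basis"
          then have "(b, 0) \<in> (Basis :: ('a \<times> complex) set)" by (simp add: Basis_prod_def)
          with elim have "\<bar>y \<bullet> (b, 0)\<bar> \<le> r" by blast
          then show "\<bar>fst y \<bullet> b\<bar> \<le> r" by (cases y) simp
        qed
        finally show ?thesis by (simp add: \<rho>)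
      qed
      have n2: "cmod (snd y) \<le> 2 * r"
      proof -
        have "cmod (snd y) \<le> (\<Sum>b\<in>Basis. \<bar>snd y \<bullet> b\<bar>)" by (rule norm_le_l1)
        also have "\<dots> \<le> (\<Sum>b\<in>(Basis :: complex set). r)"
        proof (intro sum_mono)
          fix b :: complex assume "b \<in> Basis"
          then have "(0, b) \<in> (Basis :: ('a \<times> complex) set)" by (simp add: Basis_prod_def)
          with elim have "\<bar>y \<bullet> (0, b)\<bar> \<le> r" by blast
          then show "\<bar>snd y \<bullet> b\<bar> \<le> r" by (cases y) simp
        qed
        finally show ?thesis by simp
      qed
      have "u + fst y \<in> columns S"
        unfolding u_def by (rule columns_near[OF x U \<delta> n1 \<rho>(2,3)])
      \<comment> \<open>The hypothesis on \<open>S\<close> is the sum of what arises here: the gap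
        over the cube, and twice the squared moduli of \<open>z\<close> and of a planar shift of
        length \<open>2 * r\<close>.\<close>
      moreover have "gap u (fst y) + (cmod (z + snd y))\<^sup>2 - a \<in> {-a..S}"
      proof -
        have "B * (norm (fst y))\<^sup>2 \<le> B * \<rho>\<^sup>2" using n1 B0 by (intro mult_left_mono power_mono) auto
        then have "gap u (fst y) \<le> 2 * B * \<rho>\<^sup>2" using gap_bounds(2)[of u "fst y"] by simp
        moreover have "(cmod (z + snd y))\<^sup>2 \<le> 2 * (cmod z)\<^sup>2 + 2 * (2 * r)\<^sup>2"
        proof -
          have "(cmod (z + snd y))\<^sup>2 \<le> (cmod z + cmod (snd y))\<^sup>2"
            by (intro power_mono norm_triangle_ineq) auto
          also have "\<dots> \<le> 2 * (cmod z)\<^sup>2 + 2 * (cmod (snd y))\<^sup>2"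
            using zero_le_power2[of "cmod z - cmod (snd y)"] by (simp add: power2_eq_square algebra_simps)
          also have "(cmod (snd y))\<^sup>2 \<le> (2 * r)\<^sup>2" using n2 by (intro power_mono) auto
          finally show ?thesis by simp
        qed
        ultimately show ?thesis using gap_bounds(1)[of u "fst y"] S a0 z by (simp add: power_mult_distrib)
      qed
      moreover have "F y = f (u + fst y, g (u + fst y) - (gap u (fst y) + (cmod (z + snd y))\<^sup>2 - a))"
        unfolding F_def gap_def by (simp add: algebra_simps)
      ultimately show ?case by simp
    qed
  qed simp
  finally show ?thesis unfolding u_def .
qed


lemma chart_oscillation:
  assumes \<delta>: "0 < \<delta>" "\<delta> \<le> 1"
  shows "\<exists>r\<^sub>0>0. \<exists>\<epsilon>\<^sub>0 C. oscillation_estimate K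
    (\<lambda>t x x'. dist x x' \<le> t \<and> \<bar>sqrt (bdist x) - sqrt (bdist x')\<bar> \<le> t)
    {x. cball x \<delta> \<subseteq> U \<and> bdist x < r\<^sub>0} \<epsilon>\<^sub>0 C"
proof -
  obtain C where C: "C > 0"
    and depth_lip: "\<And>x x' t. x \<in> K \<Longrightarrow> x' \<in> K \<Longrightarrow> cball x \<delta> \<subseteq> U \<Longrightarrow> bdist x < \<delta> / (16 * (L + 1)) \<Longrightarrow>
      dist x x' \<le> t \<Longrightarrow> (L + 2) * t \<le> \<delta> / 16 \<Longrightarrow> \<bar>sqrt (bdist x) - sqrt (bdist x')\<bar> \<le> t \<Longrightarrow>
      depth x' \<ge> 0 \<and> \<bar>sqrt (depth x) - sqrt (depth x')\<bar> \<le> C * t"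
    using sqrt_depth_lipschitz[OF \<delta>] by metis
  define k where "k = real DIM('a)"
  have k1: "k \<ge> 1" using DIM_positive[where 'a='a] by (simp add: k_def Suc_le_eq)
  define S where "S = \<delta> / 8"
  define \<rho> where "\<rho> = \<delta> / (64 * ((1 + L) * (1 + B)))"
  define r where "r = \<rho> / k"
  define r\<^sub>0 where "r\<^sub>0 = \<delta> / (64 * (L + 1))"
  define C3 where "C3 = C + 2 * sqrt (2 * B) + 1"
  \<comment> \<open>The three bounds serve, in this order, the extension inequality, the comparison
    of square roots of depths, and \<open>\<eta> \<le> 1\<close>.\<close>
  define \<epsilon>\<^sub>0 where "\<epsilon>\<^sub>0 = min (\<delta> / (2000 * (1 + B))) (min (\<delta> / (16 * (L + 2))) (r / (4 * C3)))"
  define m where "m = DIM('a \<times> complex)"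
  define C' where "C' = real m * (4 * C3 / r) * 5 ^ m * 2"
  have LB: "(1 + L) * (1 + B) \<ge> 1" using L0 B0 mult_mono[of 1 "1 + L" 1 "1 + B"] by simp
  have \<rho>0: "\<rho> > 0" using \<delta> LB by (simp add: \<rho>_def)
  have r: "r > 0" using \<rho>0 k1 by (simp add: r_def)
  have r\<rho>: "r \<le> \<rho>" unfolding r_def using k1 \<rho>0 by (simp add: divide_le_eq)
  have \<rho>64: "(1 + L) * ((1 + B) * \<rho>) = \<delta> / 64" unfolding \<rho>_def using LB by (simp add: field_simps)
  have B\<rho>: "(1 + B) * \<rho> \<le> \<delta> / 64"
  proof -
    have "1 * ((1 + B) * \<rho>) \<le> (1 + L) * ((1 + B) * \<rho>)" using L0 B0 \<rho>0 by (intro mult_right_mono) auto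
    then show ?thesis using \<rho>64 by simp
  qed
  have L\<rho>: "(1 + L) * \<rho> \<le> \<delta> / 64"
  proof -
    have "(1 + L) * (1 * \<rho>) \<le> (1 + L) * ((1 + B) * \<rho>)" using L0 B0 \<rho>0 by (intro mult_left_mono mult_right_mono) auto
    then show ?thesis using \<rho>64 by simp
  qed
  have \<rho>s: "\<rho> \<le> \<delta> / 64"
  proof -
    have "1 * \<rho> \<le> (1 + B) * \<rho>" using B0 \<rho>0 by (intro mult_right_mono) auto
    then show ?thesis using B\<rho> by simp
  qed
  have C3: "C3 > 0" using C B0 by (simp add: C3_def add_pos_nonneg)
  have r\<^sub>0: "r\<^sub>0 > 0" "(L + 1) * r\<^sub>0 = \<delta> / 64" using \<delta> L0 by (auto simp: r\<^sub>0_def field_simps)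
  have r\<^sub>0le: "r\<^sub>0 \<le> \<delta> / 64"
  proof -
    have "1 * r\<^sub>0 \<le> (L + 1) * r\<^sub>0" using r\<^sub>0(1) L0 by (intro mult_right_mono) auto
    then show ?thesis using r\<^sub>0 by simp
  qed
  have \<epsilon>\<^sub>0: "\<epsilon>\<^sub>0 > 0" using \<delta> B0 L0 r C3 by (simp add: \<epsilon>\<^sub>0_def)
  have "oscillation_estimate K (\<lambda>t x x'. dist x x' \<le> t \<and> \<bar>sqrt (bdist x) - sqrt (bdist x')\<bar> \<le> t)
    {x. cball x \<delta> \<subseteq> U \<and> bdist x < r\<^sub>0} \<epsilon>\<^sub>0 C'"
    unfolding oscillation_estimate_def
  proof (intro conjI allI impI \<epsilon>\<^sub>0)
    show "C' \<ge> 0" using C3 r by (simp add: C'_def)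
    fix n :: nat and \<epsilon> :: real and f :: "'a \<times> real \<Rightarrow> real" and Z and H :: "'a \<times> real \<Rightarrow> ennreal"
    assume n: "n \<ge> 1" and \<epsilon>: "0 < \<epsilon>" "\<epsilon> \<le> \<epsilon>\<^sub>0"
      and f: "continuous_on UNIV f" "quadratic_curve_poly (2 * n) f"
      and Zb: "Z \<in> sets borel" "Z \<subseteq> K \<inter> {x. cball x \<delta> \<subseteq> U \<and> bdist x < r\<^sub>0}"
      and maj: "dominated_by_oscillation K
        (\<lambda>x x'. dist x x' \<le> \<epsilon> / n \<and> \<bar>sqrt (bdist x) - sqrt (bdist x')\<bar> \<le> \<epsilon> / n) f Z H"
    have Z: "Z \<in> sets borel" "Z \<subseteq> K" "\<And>x. x \<in> Z \<Longrightarrow> cball x \<delta> \<subseteq> U \<and> bdist x < r\<^sub>0" using Zb by blast+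
    have H: "H \<in> borel_measurable borel"
        "\<And>x A. x \<in> Z \<Longrightarrow> (\<And>x'. x' \<in> K \<Longrightarrow> dist x x' \<le> \<epsilon> / n \<Longrightarrow>
         \<bar>sqrt (bdist x) - sqrt (bdist x')\<bar> \<le> \<epsilon> / n \<Longrightarrow> ennreal \<bar>f x' - f x\<bar> \<le> A) \<Longrightarrow> H x \<le> A"
      using maj unfolding dominated_by_oscillation_def by blast+
    define t where "t = \<epsilon> / n"
    define a where "a = 2 * B * t\<^sup>2"
    \<comment> \<open>The step allowed by the averaging measure for degree \<open>2 * n\<close> is
      \<open>\<eta> * r / (4 * n)\<close>. This choice makes it \<open>C3 * t\<close>, while the
      cube of half-side \<open>r\<close> stays fixed as \<open>n\<close> grows.\<close>
    define \<eta> where "\<eta> = 4 * C3 * \<epsilon> / r"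
    have t: "0 < t" "t \<le> \<epsilon>" using n \<epsilon> by (auto simp: t_def field_simps)
    have \<epsilon>1: "\<epsilon> \<le> \<delta> / (2000 * (1 + B))" "\<epsilon> \<le> \<delta> / (16 * (L + 2))" "\<epsilon> \<le> r / (4 * C3)"
      using \<epsilon> by (auto simp: \<epsilon>\<^sub>0_def)
    have B\<epsilon>: "(1 + B) * \<epsilon> \<le> \<delta> / 2000" using \<epsilon>1(1) B0 by (simp add: field_simps)
    have "0 \<le> B * \<epsilon>" "(1 + B) * \<epsilon> = \<epsilon> + B * \<epsilon>" using B0 \<epsilon> by (auto simp: algebra_simps)
    then have B\<epsilon>': "B * \<epsilon> \<le> \<delta> / 2000" and \<epsilon>s: "\<epsilon> \<le> 1"
      using B\<epsilon> \<epsilon> \<delta> by linarith+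
    have B\<epsilon>2: "B * \<epsilon>\<^sup>2 \<le> \<delta> / 2000"
    proof -
      have "B * \<epsilon> * \<epsilon> \<le> B * \<epsilon> * 1" using \<epsilon>s B0 \<epsilon> by (intro mult_left_mono) auto
      then show ?thesis using B\<epsilon>' by (simp add: power2_eq_square mult.assoc)
    qed
    have a0: "a \<ge> 0" using B0 by (simp add: a_def)
    have a_small: "a \<le> \<delta> / 1000"
    proof -
      have "B * t\<^sup>2 \<le> B * \<epsilon>\<^sup>2" using t B0 by (intro mult_left_mono power_mono) auto
      then show ?thesis using B\<epsilon>2 by (simp add: a_def)
    qed
    \<comment> \<open>\<open>a\<close> decays like the inverse square of \<open>n\<close> while the
      inequality asks for a factor of order \<open>n\<^sup>2\<close>; so \<open>n\<close> cancels
      and a smallness condition on \<open>\<epsilon>\<close> remains.\<close>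
    have remez: "8 * a * (real (2 * n) + 1)\<^sup>2 \<le> S"
    proof -
      have "(real (2 * n) + 1)\<^sup>2 \<le> (3 * real n)\<^sup>2" using n by (intro power_mono) auto
      then have "8 * a * (real (2 * n) + 1)\<^sup>2 \<le> 8 * a * (3 * real n)\<^sup>2" using a0 by (intro mult_left_mono) auto
      also have "\<dots> = 144 * (B * \<epsilon>\<^sup>2)" using n by (simp add: a_def t_def power_divide power_mult_distrib)
      also have "\<dots> \<le> S" using B\<epsilon>2 \<delta> by (simp add: S_def)
      finally show ?thesis .
    qed
    have Lt: "(L + 2) * t \<le> \<delta> / 16"
    proof -
      have "(L + 2) * t \<le> (L + 2) * (\<delta> / (16 * (L + 2)))" using t \<epsilon>1(2) L0 by (intro mult_left_mono) auto
      also have "\<dots> = \<delta> / 16" using L0 by (simp add: field_simps)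
      finally show ?thesis .
    qed
    have \<eta>: "0 < \<eta>" "\<eta> \<le> 1" using \<epsilon> \<epsilon>1(3) C3 r by (auto simp: \<eta>_def field_simps)
    have \<eta>t: "\<eta> * r / real (2 * (2 * n)) = C3 * t" using r n by (simp add: \<eta>_def t_def field_simps)
    have N: "2 * n > 0" using n by simp
    obtain \<mu> :: "('a \<times> complex) measure" where avg: "sets \<mu> = sets borel"
      "emeasure \<mu> UNIV \<le> 5 ^ DIM('a \<times> complex)" "AE y in \<mu>. \<forall>b\<in>Basis. \<bar>y \<bullet> b\<bar> \<le> r"
      "\<And>F h. F \<in> borel_measurable borel \<Longrightarrow> coordinatewise_poly (2 * n) F \<Longrightarrow>
        \<forall>b\<in>Basis. \<bar>h \<bullet> b\<bar> \<le> \<eta> * r / (2 * (2 * n)) \<Longrightarrow>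
        ennreal \<bar>F h - F 0\<bar> \<le> ennreal (DIM('a \<times> complex) * \<eta>) * (\<integral>\<^sup>+y. ennreal \<bar>F y\<bar> \<partial>\<mu>)"
      by (rule averaging_measure[OF N r \<eta>]) (rule that, assumption+)
    note sets\<mu> = avg(1) and mass = avg(2)[folded m_def] and AE\<mu> = avg(3)
      and osc = avg(4)[unfolded \<eta>t, folded m_def]
    define \<Phi> where "\<Phi> x = ennreal \<bar>f (fst x, g (fst x) - snd x)\<bar> * indicator (columns S \<times> {-a..S}) x" for x
    have "(\<integral>\<^sup>+x\<in>Z. H x \<partial>lborel)
        \<le> ennreal (m * \<eta>) * emeasure \<mu> UNIV * (\<integral>\<^sup>+x. \<Phi> x \<partial>lborel)"
    proof (rule graph_averaging_bound[where q=gap and g=g and a=a])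
      show "g \<in> borel_measurable borel" using g_cont by (rule borel_measurable_continuous_onI)
      have "continuous_on UNIV (\<lambda>x :: 'a \<times> 'a. gap (fst x) (snd x))"
        unfolding gap_def by (intro continuous_intros continuous_on_compose2[OF g_cont] continuous_on_compose2[OF Dg_cont]) auto
      then show "(\<lambda>x :: 'a \<times> 'a. gap (fst x) (snd x)) \<in> borel_measurable borel" by (rule borel_measurable_continuous_onI)
      have "continuous_on UNIV (\<lambda>x :: 'a \<times> real. f (fst x, g (fst x) - snd x))"
        by (intro continuous_on_compose2[OF f(1)] continuous_intros continuous_on_compose2[OF g_cont]) auto
      then have [measurable]: "(\<lambda>x :: 'a \<times> real. f (fst x, g (fst x) - snd x)) \<in> borel_measurable borel"
        by (rule borel_measurable_continuous_onI)
      have [measurable]: "columns S \<times> {-a..S} \<in> sets borel"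
        by (intro borel_closed closed_Times closed_columns closed_atLeastAtMost)
      show "\<Phi> \<in> borel_measurable borel" unfolding \<Phi>_def by measurable
      show "H \<in> borel_measurable borel" "Z \<in> sets borel" "sets \<mu> = sets borel" "a \<ge> 0" by (fact H Z sets\<mu> a0)+
      show "emeasure \<mu> UNIV < \<infinity>" using mass by (auto intro: le_less_trans simp: power_less_top_ennreal)
      have ZU: "x \<in> U" if "x \<in> Z" for x
      proof -
        have "x \<in> cball x \<delta>" using \<delta> by simp
        then show ?thesis using Z(3)[OF that] by blast
      qed
      show "snd x \<le> g (fst x)" if "x \<in> Z" for x
        using in_K_iff[OF ZU[OF that]] that Z(2) by (auto simp: depth_def)
      fix u z assume uz: "(u, g u - ((cmod z)\<^sup>2 - a)) \<in> Z"
      define x where "x = (u, g u - ((cmod z)\<^sup>2 - a))"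
      have xZ: "x \<in> Z" using uz by (simp add: x_def)
      have xK: "x \<in> K" using Z(2) xZ by blast
      have cb: "cball x \<delta> \<subseteq> U" and bx: "bdist x < r\<^sub>0" using Z(3)[OF xZ] by blast+
      have bx\<delta>: "bdist x < \<delta>" using bx r\<^sub>0le \<delta> by simp
      have fx: "fst x = u" by (simp add: x_def)
      have zx: "(cmod z)\<^sup>2 = depth x + a" by (simp add: x_def depth_def)
      have "(L + 1) * bdist x \<le> (L + 1) * r\<^sub>0" using bx L0 by (intro mult_left_mono) auto
      then have Lb: "(L + 1) * bdist x \<le> \<delta> / 64" using r\<^sub>0 by simp
      have dx: "depth x \<le> \<delta> / 64" using depth_le_bdist[OF xK cb \<delta>(2) bx\<delta>] Lb by simp
      have "H x \<le> ennreal (m * \<eta>) * (\<integral>\<^sup>+y. ennreal \<bar>f (fst x + fst y,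
          g (fst x + fst y) - (gap (fst x) (fst y) + (cmod (z + snd y))\<^sup>2 - a))\<bar> *
          indicator (columns S \<times> {-a..S}) (fst x + fst y, gap (fst x) (fst y) + (cmod (z + snd y))\<^sup>2 - a) \<partial>\<mu>)"
      proof (rule H(2)[OF xZ])
        fix x' assume x': "x' \<in> K" "dist x x' \<le> \<epsilon> / n" "\<bar>sqrt (bdist x) - sqrt (bdist x')\<bar> \<le> \<epsilon> / n"
        have "bdist x < \<delta> / (16 * (L + 1))"
          by (rule less_le_trans[OF bx]) (use \<delta> L0 in \<open>simp add: r\<^sub>0_def frac_le\<close>)
        from depth_lip[OF xK x'(1) cb this x'(2) _ x'(3)] Lt
        have dl: "depth x' \<ge> 0" "\<bar>sqrt (depth x) - sqrt (depth x')\<bar> \<le> C * t" by (auto simp: t_def)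
        have nt: "norm (fst x' - fst x) \<le> t" using x'(2) dist_fst_le[of x x'] by (simp add: t_def dist_norm norm_minus_commute)
        show "ennreal \<bar>f x' - f x\<bar> \<le> ennreal (m * \<eta>) * (\<integral>\<^sup>+y. ennreal \<bar>f (fst x + fst y,
          g (fst x + fst y) - (gap (fst x) (fst y) + (cmod (z + snd y))\<^sup>2 - a))\<bar> *
          indicator (columns S \<times> {-a..S}) (fst x + fst y, gap (fst x) (fst y) + (cmod (z + snd y))\<^sup>2 - a) \<partial>\<mu>)"
        proof (rule local_oscillation_bound[OF f xK cb \<delta>(2) bx\<delta> x'(1) nt dl a_def zx _ _ _ _ sets\<mu> AE\<mu>])
          show "\<rho> = real DIM('a) * r" using k1 by (simp add: r_def k_def)
          show "\<rho> \<le> 1" using \<rho>s \<delta> by simp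
          show "(1 + L) * \<rho> + S + (L + 1) * bdist x \<le> \<delta>" using L\<rho> Lb \<delta> by (simp add: S_def)
          show "2 * B * \<rho>\<^sup>2 + 2 * depth x + 2 * a + 8 * r\<^sup>2 \<le> S"
          proof -
            have "B * \<rho> \<le> \<delta> / 64" using B\<rho> \<rho>0 by (simp add: algebra_simps)
            then have "(B * \<rho>) * \<rho> \<le> (\<delta> / 64) * 1" using \<rho>s \<delta> \<rho>0 B0 by (intro mult_mono) auto
            then have 1: "B * \<rho>\<^sup>2 \<le> \<delta> / 64" by (simp add: power2_eq_square mult.assoc)
            have "r * r \<le> (\<delta> / 64) * (1 / 64)" using r\<rho> \<rho>s \<delta> r by (intro mult_mono) auto
            then have 2: "8 * r\<^sup>2 \<le> \<delta> / 64" using \<delta> by (simp add: power2_eq_square)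
            show ?thesis using 1 2 dx a_small \<delta> unfolding S_def by linarith
          qed
        qed (use osc in \<open>auto simp: C3_def\<close>)
      qed
      then show "H (u, g u - ((cmod z)\<^sup>2 - a)) \<le> ennreal (m * \<eta>) *
          (\<integral>\<^sup>+y. \<Phi> (u + fst y, gap u (fst y) + (cmod (z + snd y))\<^sup>2 - a) \<partial>\<mu>)"
        unfolding fx by (simp add: x_def \<Phi>_def)
    qed
    also have "\<dots> \<le> ennreal (m * \<eta>) * 5 ^ m * (2 * (\<integral>\<^sup>+x\<in>K. ennreal \<bar>f x\<bar> \<partial>lborel))"
    proof (intro mult_mono mult_left_mono mass)
      show "(\<integral>\<^sup>+x. \<Phi> x \<partial>lborel) \<le> 2 * (\<integral>\<^sup>+x\<in>K. ennreal \<bar>f x\<bar> \<partial>lborel)"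
        unfolding \<Phi>_def using \<delta> by (intro nn_integral_columns_le[OF f _ a0 remez]) (simp add: S_def)
    qed auto
    also have "\<dots> = ennreal (C' * \<epsilon>) * (\<integral>\<^sup>+x\<in>K. ennreal \<bar>f x\<bar> \<partial>lborel)"
    proof -
      have "ennreal (m * \<eta>) * 5 ^ m * 2 = ennreal (m * \<eta> * 5 ^ m * 2)"
        using \<eta> by (simp add: ennreal_mult ennreal_power[symmetric])
      also have "m * \<eta> * 5 ^ m * 2 = C' * \<epsilon>" by (simp add: C'_def \<eta>_def)
      finally show ?thesis by (simp add: mult.assoc[symmetric])
    qed
    finally show "(\<integral>\<^sup>+x\<in>Z. H x \<partial>lborel)
        \<le> ennreal (C' * \<epsilon>) * (\<integral>\<^sup>+x\<in>K. ennreal \<bar>f x\<bar> \<partial>lborel)" .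
  qed
  with r\<^sub>0(1) show ?thesis by blast
qed

end

section \<open>Oscillation of polynomials on the whole domain\<close>

text \<open>Invariance of the integral follows from invariance of the unit ball:
  \<open>\<phi> (Q x)\<close> is smeared over a ball around \<open>Q x\<close>, the integrals are
  exchanged, and translations move \<open>Q\<close> onto the ball, which it preserves. The volume
  \<open>\<beta>\<close> of the ball cancels.\<close>

lemma nn_integral_orthogonal_transformation:
  fixes Q :: "'a::euclidean_space \<Rightarrow> 'a" and \<phi> :: "'a \<Rightarrow> ennreal"
  assumes Q: "orthogonal_transformation Q" and [measurable]: "\<phi> \<in> borel_measurable borel"
  shows "(\<integral>\<^sup>+x. \<phi> (Q x) \<partial>lborel) = (\<integral>\<^sup>+x. \<phi> x \<partial>lborel)"
proof -
  have lin: "linear Q" using Q by (rule orthogonal_transformation_linear)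
  have [measurable]: "Q \<in> borel_measurable borel"
    using lin by (intro borel_measurable_continuous_onI linear_continuous_on) (simp add: linear_conv_bounded_linear)
  define b :: "'a \<Rightarrow> ennreal" where "b = indicator (ball 0 1)"
  have [measurable]: "b \<in> borel_measurable borel"
    unfolding b_def by (rule borel_measurable_indicator) simp
  have b_minus: "b (x - y) = b (y - x)" for x y
    by (simp add: b_def indicator_def norm_minus_commute)
  have b_Q: "b (Q x) = b x" for x
    using Q by (simp add: b_def indicator_def orthogonal_transformation_norm)
  define \<beta> where "\<beta> = (\<integral>\<^sup>+x. b x \<partial>lborel)"
  have "\<beta> = emeasure lborel (ball (0::'a) 1)" by (simp add: \<beta>_def b_def)
  moreover have "unit_ball_vol (real DIM('a)) > 0" by (rule unit_ball_vol_pos) simp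
  ultimately have \<beta>: "\<beta> \<noteq> 0" "\<beta> \<noteq> top" by (simp_all add: emeasure_ball del: unit_ball_vol_pos)
  have "\<beta> * (\<integral>\<^sup>+x. \<phi> (Q x) \<partial>lborel) = (\<integral>\<^sup>+x. \<phi> (Q x) * \<beta> \<partial>lborel)"
    by (simp add: nn_integral_cmult mult.commute)
  also have "\<dots> = (\<integral>\<^sup>+x. \<integral>\<^sup>+y. \<phi> (Q x) * b (Q x - y) \<partial>lborel \<partial>lborel)"
  proof (rule nn_integral_cong)
    fix x
    have "(\<integral>\<^sup>+y. b (Q x - y) \<partial>lborel) = (\<integral>\<^sup>+y. b (y + - Q x) \<partial>lborel)" by (subst b_minus) simp
    also have "\<dots> = \<beta>" unfolding \<beta>_def by (rule nn_integral_lborel_translate) measurable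
    finally show "\<phi> (Q x) * \<beta> = (\<integral>\<^sup>+y. \<phi> (Q x) * b (Q x - y) \<partial>lborel)"
      by (simp add: nn_integral_cmult)
  qed
  also have "\<dots> = (\<integral>\<^sup>+y. \<integral>\<^sup>+x. \<phi> (Q x) * b (Q x - y) \<partial>lborel \<partial>lborel)"
    by (rule lborel_pair.Fubini') measurable
  also have "\<dots> = (\<integral>\<^sup>+y. \<integral>\<^sup>+x. \<phi> (Q x + y) * b x \<partial>lborel \<partial>lborel)"
  proof (rule nn_integral_cong)
    fix y
    obtain v where v: "Q v = y" using orthogonal_transformation_surj[OF Q] by (metis surjD)
    have "(\<integral>\<^sup>+x. \<phi> (Q x) * b (Q x - y) \<partial>lborel) = (\<integral>\<^sup>+x. \<phi> (Q (x + v)) * b (Q (x + v) - y) \<partial>lborel)"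
      by (rule nn_integral_lborel_translate[symmetric]) measurable
    then show "(\<integral>\<^sup>+x. \<phi> (Q x) * b (Q x - y) \<partial>lborel) = (\<integral>\<^sup>+x. \<phi> (Q x + y) * b x \<partial>lborel)"
      by (simp add: linear_add[OF lin] v b_Q)
  qed
  also have "\<dots> = (\<integral>\<^sup>+x. \<integral>\<^sup>+y. \<phi> (Q x + y) * b x \<partial>lborel \<partial>lborel)"
    by (rule lborel_pair.Fubini') measurable
  also have "\<dots> = (\<integral>\<^sup>+x. (\<integral>\<^sup>+y. \<phi> y \<partial>lborel) * b x \<partial>lborel)"
  proof (rule nn_integral_cong)
    fix x
    have "(\<integral>\<^sup>+y. \<phi> (Q x + y) * b x \<partial>lborel) = (\<integral>\<^sup>+y. \<phi> (y + Q x) \<partial>lborel) * b x"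
      by (subst nn_integral_multc) (auto simp: add.commute)
    also have "(\<integral>\<^sup>+y. \<phi> (y + Q x) \<partial>lborel) = (\<integral>\<^sup>+y. \<phi> y \<partial>lborel)"
      by (rule nn_integral_lborel_translate) measurable
    finally show "(\<integral>\<^sup>+y. \<phi> (Q x + y) * b x \<partial>lborel) = (\<integral>\<^sup>+y. \<phi> y \<partial>lborel) * b x" .
  qed
  also have "\<dots> = \<beta> * (\<integral>\<^sup>+y. \<phi> y \<partial>lborel)"
    unfolding \<beta>_def by (subst nn_integral_cmult) (auto simp: mult.commute)
  finally show ?thesis using \<beta> by (simp add: ennreal_mult_cancel_left)
qed

lemma quadratic_curve_poly_affine:
  fixes f :: "'b::real_vector \<Rightarrow> real" and P :: "'a::real_vector \<Rightarrow> 'b"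
  assumes "quadratic_curve_poly N f" "linear P"
  shows "quadratic_curve_poly N (\<lambda>x. f (P x + b))"
  unfolding quadratic_curve_poly_def
proof (intro allI)
  fix x y z
  have "P (x + t *\<^sub>R y + t\<^sup>2 *\<^sub>R z) + b = (P x + b) + t *\<^sub>R P y + t\<^sup>2 *\<^sub>R P z" for t
    by (simp add: linear_add[OF assms(2)] linear_scale[OF assms(2)] algebra_simps)
  then show "\<exists>p. degree p \<le> N \<and> (\<forall>t. f (P (x + t *\<^sub>R y + t\<^sup>2 *\<^sub>R z) + b) = poly p t)"
    using assms(1) unfolding quadratic_curve_poly_def by metis
qed

lemma coordinatewise_poly_translate_line:
  assumes "quadratic_curve_poly N f"
  shows "coordinatewise_poly N (\<lambda>y. f (x + y))"
  unfolding coordinatewise_poly_def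
proof (intro allI ballI)
  fix y b :: 'a
  obtain p where "degree p \<le> N" "\<And>t. f ((x + y) + t *\<^sub>R b + t\<^sup>2 *\<^sub>R 0) = poly p t"
    using assms unfolding quadratic_curve_poly_def by blast
  then show "\<exists>p. degree p \<le> N \<and> (\<forall>t. f (x + (y + t *\<^sub>R b)) = poly p t)"
    by (intro exI[of _ p]) (simp add: add.assoc)
qed

text \<open>Away from the boundary the averaging measure is placed around \<open>x\<close> itself.
  Its cube has half-side \<open>r\<^sub>0\<close> divided by the dimension and so stays in the ball
  of radius \<open>r\<^sub>0\<close>; translation invariance does the rest.\<close>

lemma interior_oscillation:
  fixes K :: "'a::euclidean_space set"
  assumes K: "closed K" and r\<^sub>0: "0 < r\<^sub>0"
  shows "\<exists>\<epsilon>\<^sub>0 C. oscillation_estimate K (\<lambda>t x x'. dist x x' \<le> t) {x. cball x r\<^sub>0 \<subseteq> K} \<epsilon>\<^sub>0 C"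
proof -
  define m where "m = DIM('a)"
  have m1: "m \<ge> 1" unfolding m_def using DIM_positive[where 'a='a] by linarith
  define r where "r = r\<^sub>0 / m"
  have r: "r > 0" using r\<^sub>0 m1 by (simp add: r_def)
  define C where "C = real m * (4 / r) * 5 ^ m"
  have "oscillation_estimate K (\<lambda>t x x'. dist x x' \<le> t) {x. cball x r\<^sub>0 \<subseteq> K} (r / 4) C"
    unfolding oscillation_estimate_def
  proof (intro conjI allI impI)
    show "r / 4 > 0" "C \<ge> 0" using r by (auto simp: C_def)
    fix n :: nat and \<epsilon> :: real and f :: "'a \<Rightarrow> real" and Z and H :: "'a \<Rightarrow> ennreal"
    assume n: "n \<ge> 1" and \<epsilon>: "0 < \<epsilon>" "\<epsilon> \<le> r / 4"
      and f: "continuous_on UNIV f" "quadratic_curve_poly (2 * n) f"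
      and Z[measurable]: "Z \<in> sets borel" and ZG: "Z \<subseteq> K \<inter> {x. cball x r\<^sub>0 \<subseteq> K}"
      and maj: "dominated_by_oscillation K (\<lambda>x x'. dist x x' \<le> \<epsilon> / n) f Z H"
    have ZK: "\<And>x. x \<in> Z \<Longrightarrow> cball x r\<^sub>0 \<subseteq> K" using ZG by blast
    have H[measurable]: "H \<in> borel_measurable borel"
      and HA: "\<And>x A. x \<in> Z \<Longrightarrow> (\<And>x'. x' \<in> K \<Longrightarrow> dist x x' \<le> \<epsilon> / n \<Longrightarrow> ennreal \<bar>f x' - f x\<bar> \<le> A) \<Longrightarrow> H x \<le> A"
      using maj unfolding dominated_by_oscillation_def by blast+
    define \<eta> where "\<eta> = 4 * \<epsilon> / r"
    have \<eta>: "0 < \<eta>" "\<eta> \<le> 1" using \<epsilon> r by (auto simp: \<eta>_def field_simps)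
    have N: "2 * n > 0" using n by simp
    have \<eta>t: "\<eta> * r / real (2 * (2 * n)) = \<epsilon> / n" using r n by (simp add: \<eta>_def field_simps)
    obtain \<mu> :: "'a measure" where avg: "sets \<mu> = sets borel"
      "emeasure \<mu> UNIV \<le> 5 ^ DIM('a)" "AE y in \<mu>. \<forall>b\<in>Basis. \<bar>y \<bullet> b\<bar> \<le> r"
      "\<And>F h. F \<in> borel_measurable borel \<Longrightarrow> coordinatewise_poly (2 * n) F \<Longrightarrow>
        \<forall>b\<in>Basis. \<bar>h \<bullet> b\<bar> \<le> \<eta> * r / (2 * (2 * n)) \<Longrightarrow>
        ennreal \<bar>F h - F 0\<bar> \<le> ennreal (DIM('a) * \<eta>) * (\<integral>\<^sup>+y. ennreal \<bar>F y\<bar> \<partial>\<mu>)"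
      by (rule averaging_measure[OF N r \<eta>]) (rule that, assumption+)
    note sets\<mu> = avg(1) and mass = avg(2)[folded m_def] and AE\<mu> = avg(3)
      and osc = avg(4)[unfolded \<eta>t, folded m_def]
    note [measurable_cong] = sets\<mu>
    have space\<mu>: "space \<mu> = UNIV" using sets_eq_imp_space_eq[OF sets\<mu>] by simp
    have "emeasure \<mu> UNIV < \<infinity>" using mass by (auto intro: le_less_trans simp: power_less_top_ennreal)
    then interpret \<mu>: finite_measure \<mu> by (intro finite_measureI) (simp add: space\<mu>)
    interpret P: pair_sigma_finite \<mu> "lborel :: 'a measure" ..
    have [measurable]: "f \<in> borel_measurable borel" "K \<in> sets borel"
      using f(1) K by (auto intro: borel_measurable_continuous_onI borel_closed)
    define \<Phi> where "\<Phi> x = ennreal \<bar>f x\<bar> * indicator K x" for x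
    have [measurable]: "\<Phi> \<in> borel_measurable borel" unfolding \<Phi>_def by measurable
    have "H x * indicator Z x \<le> ennreal (m * \<eta>) * (\<integral>\<^sup>+y. \<Phi> (x + y) \<partial>\<mu>)" for x
    proof (cases "x \<in> Z")
      case True
      have cont: "continuous_on UNIV (\<lambda>y. f (x + y))"
        by (intro continuous_on_compose2[OF f(1)] continuous_intros) auto
      have "H x \<le> ennreal (m * \<eta>) * (\<integral>\<^sup>+y. ennreal \<bar>f (x + y)\<bar> \<partial>\<mu>)"
      proof (rule HA[OF True])
        fix x' assume "x' \<in> K" and x': "dist x x' \<le> \<epsilon> / n"
        have "\<forall>b\<in>Basis. \<bar>(x' - x) \<bullet> b\<bar> \<le> \<epsilon> / n"
          using x' Basis_le_norm[of _ "x' - x"] by (force simp: dist_norm norm_minus_commute)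
        from osc[OF borel_measurable_continuous_onI[OF cont] coordinatewise_poly_translate_line[OF f(2)] this]
        show "ennreal \<bar>f x' - f x\<bar> \<le> ennreal (m * \<eta>) * (\<integral>\<^sup>+y. ennreal \<bar>f (x + y)\<bar> \<partial>\<mu>)" by simp
      qed
      also have "\<dots> \<le> ennreal (m * \<eta>) * (\<integral>\<^sup>+y. \<Phi> (x + y) \<partial>\<mu>)"
      proof (intro mult_left_mono nn_integral_mono_AE)
        show "AE y in \<mu>. ennreal \<bar>f (x + y)\<bar> \<le> \<Phi> (x + y)"
          using AE\<mu>
        proof eventually_elim
          case (elim y)
          have "norm y \<le> (\<Sum>b\<in>Basis. \<bar>y \<bullet> b\<bar>)" by (rule norm_le_l1)
          also have "\<dots> \<le> (\<Sum>b\<in>(Basis :: 'a set). r)" using elim by (intro sum_mono) auto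
          also have "\<dots> = r\<^sub>0" using m1 by (simp add: r_def m_def)
          finally have "x + y \<in> cball x r\<^sub>0" by (simp add: dist_norm)
          then show ?case using ZK[OF True] by (auto simp: \<Phi>_def)
        qed
      qed simp
      finally show ?thesis using True by simp
    qed simp
    then have "(\<integral>\<^sup>+x\<in>Z. H x \<partial>lborel) \<le> (\<integral>\<^sup>+x. ennreal (m * \<eta>) * (\<integral>\<^sup>+y. \<Phi> (x + y) \<partial>\<mu>) \<partial>lborel)"
      by (intro nn_integral_mono)
    also have "\<dots> = ennreal (m * \<eta>) * (\<integral>\<^sup>+x. \<integral>\<^sup>+y. \<Phi> (x + y) \<partial>\<mu> \<partial>lborel)"
      by (rule nn_integral_cmult) measurable
    also have "(\<integral>\<^sup>+x. \<integral>\<^sup>+y. \<Phi> (x + y) \<partial>\<mu> \<partial>lborel) = (\<integral>\<^sup>+y. \<integral>\<^sup>+x. \<Phi> (x + y) \<partial>lborel \<partial>\<mu>)"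
      by (rule P.Fubini') measurable
    also have "\<dots> = (\<integral>\<^sup>+y. (\<integral>\<^sup>+x. \<Phi> x \<partial>lborel) \<partial>\<mu>)"
      by (intro nn_integral_cong nn_integral_lborel_translate) measurable
    also have "\<dots> = (\<integral>\<^sup>+x. \<Phi> x \<partial>lborel) * emeasure \<mu> UNIV" by (simp add: space\<mu>)
    also have "ennreal (m * \<eta>) * ((\<integral>\<^sup>+x. \<Phi> x \<partial>lborel) * emeasure \<mu> UNIV)
        \<le> ennreal (m * \<eta>) * ((\<integral>\<^sup>+x. \<Phi> x \<partial>lborel) * 5 ^ m)"
      by (intro mult_left_mono mass) auto
    also have "\<dots> = ennreal (C * \<epsilon>) * (\<integral>\<^sup>+x. \<Phi> x \<partial>lborel)"
    proof -
      have "ennreal (m * \<eta>) * 5 ^ m = ennreal (m * \<eta> * 5 ^ m)"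
        using \<eta> by (simp add: ennreal_mult ennreal_power[symmetric])
      also have "m * \<eta> * 5 ^ m = C * \<epsilon>" by (simp add: C_def \<eta>_def)
      finally show ?thesis by (simp add: mult_ac)
    qed
    finally show "(\<integral>\<^sup>+x\<in>Z. H x \<partial>lborel)
        \<le> ennreal (C * \<epsilon>) * (\<integral>\<^sup>+x\<in>K. ennreal \<bar>f x\<bar> \<partial>lborel)" by (simp add: \<Phi>_def)
  qed
  then show ?thesis by blast
qed

section \<open>Transport of the chart estimate to the original coordinates\<close>

lemma infdist_isometry_image:
  assumes "\<And>x y. dist (T x) (T y) = dist x y"
  shows "infdist (T x) (T ` A) = infdist x A"
  by (simp add: infdist_def image_image assms)

lemma lipschitz_gradient_imp_lipschitz_on_cball:
  fixes g :: "'a::euclidean_space \<Rightarrow> real"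
  assumes D: "\<And>u. (g has_derivative (\<lambda>h. Dg u \<bullet> h)) (at u)"
    and lip: "\<And>u v. norm (Dg u - Dg v) \<le> B * norm (u - v)" and "B \<ge> 0"
    and "norm u \<le> R" "norm v \<le> R"
  shows "\<bar>g u - g v\<bar> \<le> (norm (Dg 0) + B * R) * norm (u - v)"
proof -
  have "norm (g u - g v) \<le> (norm (Dg 0) + B * R) * norm (u - v)"
  proof (rule differentiable_bound[of "cball 0 R" g "\<lambda>x h. Dg x \<bullet> h"])
    fix x :: 'a assume x: "x \<in> cball 0 R"
    show "(g has_derivative (\<bullet>) (Dg x)) (at x within cball 0 R)"
      using D by (rule has_derivative_at_withinI)
    show "onorm ((\<bullet>) (Dg x)) \<le> norm (Dg 0) + B * R"
    proof (rule onorm_le)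
      fix h :: 'a
      have "norm (Dg x) \<le> norm (Dg 0) + norm (Dg x - Dg 0)" by (rule norm_triangle_sub)
      also have "norm (Dg x - Dg 0) \<le> B * R"
        using lip[of x 0] x mult_left_mono[OF _ \<open>B \<ge> 0\<close>, of "norm x" R] by simp
      finally have "norm (Dg x) * norm h \<le> (norm (Dg 0) + B * R) * norm h" by (simp add: mult_right_mono)
      then show "norm (Dg x \<bullet> h) \<le> (norm (Dg 0) + B * R) * norm h"
        using Cauchy_Schwarz_ineq2[of "Dg x" h] by simp
    qed
  qed (use assms in auto)
  then show ?thesis by simp
qed


lemma cball_subset_of_infdist_frontier:
  fixes U :: "'a::euclidean_space set"
  assumes "x \<in> U" "infdist x (frontier U) > \<delta>"
  shows "cball x \<delta> \<subseteq> U"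
proof
  fix y assume "y \<in> cball x \<delta>"
  then show "y \<in> U" using infdist_frontier_le_dist[OF assms(1), of y] assms(2) by force
qed

text \<open>The coordinate map is an isometry, hence compatible with frontier, boundary distance,
  measure and quadratic curves; the estimate in chart coordinates is pulled back by its inverse
  \<open>S\<close>. Domination by the oscillation carries over because \<open>rho\<close> bounds
  both of its summands.\<close>

lemma boundary_chart_oscillation:
  fixes \<Omega> U :: "((real ^ 'd) \<times> real) set"
  assumes \<Omega>: "closed \<Omega>" "bounded \<Omega>" "frontier \<Omega> \<noteq> {}" and U: "open U"
    and T: "cartesian_coordinates T" and g: "C2_function g" "\<And>i k x. \<bar>partial i (partial k g) x\<bar> \<le> M"
    and graph: "\<Omega> \<inter> U = {x \<in> U. snd (T x) \<le> g (fst (T x))}"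
    and \<delta>: "0 < \<delta>" "\<delta> \<le> 1"
  shows "\<exists>r\<^sub>0>0. \<exists>\<epsilon>\<^sub>0 C. oscillation_estimate \<Omega> (\<lambda>t x x'. rho \<Omega> x x' \<le> t)
    {x. cball x \<delta> \<subseteq> U \<and> infdist x (frontier \<Omega>) < r\<^sub>0} \<epsilon>\<^sub>0 C"
proof -
  obtain Q b where Q: "orthogonal_transformation Q" and TQ: "T = (\<lambda>x. Q (x - b))"
    using T unfolding cartesian_coordinates_def by blast
  define P where "P = inv Q"
  have P: "orthogonal_transformation P" unfolding P_def using Q by (rule orthogonal_transformation_inv)
  have linQ: "linear Q" and linP: "linear P" using P Q by (simp_all add: orthogonal_transformation_linear)
  have QP: "Q (P y) = y" for y unfolding P_def using orthogonal_transformation_surj[OF Q] by (rule surj_f_inv_f)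
  have PQ: "P (Q x) = x" for x unfolding P_def using orthogonal_transformation_inj[OF Q] by (rule inv_f_f)
  define S where "S y = P y + b" for y
  have TS: "T (S y) = y" and ST: "S (T x) = x" for x y by (simp_all add: TQ S_def QP PQ)
  have dist_T: "dist (T x) (T y) = dist x y" for x y
    using orthogonal_transformation_norm[OF Q, of "x - y"] linear_diff[OF linQ, of "x - b" "y - b"]
    by (simp add: TQ dist_norm)
  have dist_S: "dist (S x) (S y) = dist x y" for x y
    using dist_T[of "S x" "S y"] by (simp add: TS)
  have imT: "T ` A = S -` A" for A
    using TS ST by (auto simp: image_iff) metis
  have contS: "continuous_on UNIV S"
    unfolding S_def using linP by (intro continuous_intros linear_continuous_on) (simp add: linear_conv_bounded_linear)
  have [measurable]: "S \<in> borel_measurable borel" using contS by (rule borel_measurable_continuous_onI)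
  have int_S: "(\<integral>\<^sup>+y. \<phi> (S y) \<partial>lborel) = (\<integral>\<^sup>+x. \<phi> x \<partial>lborel)"
    if [measurable]: "\<phi> \<in> borel_measurable borel" for \<phi> :: "(real ^ 'd) \<times> real \<Rightarrow> ennreal"
  proof -
    have "(\<integral>\<^sup>+y. \<phi> (S y) \<partial>lborel) = (\<integral>\<^sup>+y. \<phi> (y + b) \<partial>lborel)"
      unfolding S_def by (rule nn_integral_orthogonal_transformation[OF P, where \<phi>="\<lambda>y. \<phi> (y + b)"]) measurable
    also have "\<dots> = (\<integral>\<^sup>+y. \<phi> y \<partial>lborel)" by (rule nn_integral_lborel_translate) measurable
    finally show ?thesis .
  qed
  define K where "K = T ` \<Omega>"
  define V where "V = T ` U"
  have T_decomp: "T x = - Q b + Q x" for x using linear_diff[OF linQ, of x b] by (simp add: TQ)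
  have frontier_K: "frontier K = T ` frontier \<Omega>"
  proof -
    have "T ` A = (+) (- Q b) ` (Q ` A)" for A unfolding T_decomp image_image ..
    moreover have "frontier (Q ` \<Omega>) = Q ` frontier \<Omega>"
      unfolding frontier_def closure_injective_linear_image[OF linQ orthogonal_transformation_inj[OF Q], symmetric]
        interior_injective_linear_image[OF linQ orthogonal_transformation_inj[OF Q]]
      by (rule image_set_diff[OF orthogonal_transformation_inj[OF Q], symmetric])
    ultimately show ?thesis unfolding K_def by (simp only: frontier_translation)
  qed
  have infdist_K: "infdist (T x) (frontier K) = infdist x (frontier \<Omega>)" for x
    unfolding frontier_K using dist_T by (rule infdist_isometry_image)
  have closedK: "closed K" unfolding K_def imT using \<Omega>(1) contS by (rule closed_vimage)
  have boundedK: "bounded K"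
  proof -
    have "bounded (Q ` (\<lambda>x. x - b) ` \<Omega>)"
      using \<Omega>(2) linQ by (intro bounded_linear_image bounded_translation_minus) (simp_all add: linear_conv_bounded_linear)
    then show ?thesis by (simp add: K_def TQ image_image)
  qed
  obtain R where R0: "R > 0" "\<forall>x\<in>K. norm x \<le> R" using boundedK unfolding bounded_pos by blast
  then have R: "R > 0" "K \<subseteq> cball 0 R" by auto
  obtain Dg B where B: "B \<ge> 0" and Dg: "\<And>u. (g has_derivative (\<lambda>h. Dg u \<bullet> h)) (at u)"
    and lip: "\<And>u v. norm (Dg u - Dg v) \<le> B * norm (u - v)"
    using C2_function_gradient[OF g] by metis
  \<comment> \<open>\<open>R + 2\<close> is the radius of the ball on which the locale asks for a
    Lipschitz constant.\<close>
  define L where "L = norm (Dg 0) + B * (R + 2)"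
  interpret smooth_graph_domain K V g L B R Dg
  proof unfold_locales
    show "closed K" by (rule closedK)
    show "open V" unfolding V_def imT using U contS by (rule open_vimage)
    show "K \<inter> V = {x \<in> V. snd x \<le> g (fst x)}"
    proof -
      have "K \<inter> V = T ` (\<Omega> \<inter> U)" unfolding K_def V_def imT by auto
      also have "\<dots> = {x \<in> V. snd x \<le> g (fst x)}" unfolding graph V_def imT using TS by auto
      finally show ?thesis .
    qed
    show "K \<subseteq> cball 0 R" by (rule R)
    show "frontier K \<noteq> {}" using \<Omega>(3) by (simp add: frontier_K)
    show "L \<ge> 0" using B R by (simp add: L_def)
    show "B \<ge> 0" by (rule B)
    show "continuous_on UNIV g" using Dg by (auto intro!: continuous_at_imp_continuous_on has_derivative_continuous)
    show "\<bar>g u - g v\<bar> \<le> L * norm (u - v)" if "norm u \<le> R + 2" "norm v \<le> R + 2" for u v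
      unfolding L_def by (rule lipschitz_gradient_imp_lipschitz_on_cball[OF Dg lip B that])
    show "\<bar>(g (w + h) - g w) - (g (u + h) - g u)\<bar> \<le> B * norm (w - u) * norm h" for u w h
      by (rule lipschitz_gradient_second_difference[OF Dg lip])
    show "continuous_on UNIV Dg"
      by (rule lipschitz_on_continuous_on[of B]) (auto intro!: lipschitz_onI simp: dist_norm lip B)
    show "\<bar>g (u + h) - g u - Dg u \<bullet> h\<bar> \<le> B * (norm h)\<^sup>2" for u h
      by (rule lipschitz_gradient_taylor[OF Dg lip B])
  qed
  obtain r\<^sub>0 \<epsilon>\<^sub>0 C where r\<^sub>0: "r\<^sub>0 > 0" and chart: "oscillation_estimate K
      (\<lambda>t x x'. dist x x' \<le> t \<and> \<bar>sqrt (bdist x) - sqrt (bdist x')\<bar> \<le> t) {x. cball x \<delta> \<subseteq> V \<and> bdist x < r\<^sub>0} \<epsilon>\<^sub>0 C"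
    using chart_oscillation[OF \<delta>] by blast
  have "oscillation_estimate \<Omega> (\<lambda>t x x'. rho \<Omega> x x' \<le> t)
      {x. cball x \<delta> \<subseteq> U \<and> infdist x (frontier \<Omega>) < r\<^sub>0} \<epsilon>\<^sub>0 C"
    unfolding oscillation_estimate_def
  proof (intro conjI allI impI)
    show "\<epsilon>\<^sub>0 > 0" "C \<ge> 0" using chart by (simp_all add: oscillation_estimate_def)
    fix n :: nat and \<epsilon> and f :: "(real ^ 'd) \<times> real \<Rightarrow> real" and Z H
    assume n: "n \<ge> 1" and \<epsilon>: "0 < \<epsilon>" "\<epsilon> \<le> \<epsilon>\<^sub>0"
      and f: "continuous_on UNIV f" "quadratic_curve_poly (2 * n) f"
      and Z: "Z \<in> sets borel" "Z \<subseteq> \<Omega> \<inter> {x. cball x \<delta> \<subseteq> U \<and> infdist x (frontier \<Omega>) < r\<^sub>0}"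
      and maj: "dominated_by_oscillation \<Omega> (\<lambda>x x'. rho \<Omega> x x' \<le> \<epsilon> / n) f Z H"
    have H[measurable]: "H \<in> borel_measurable borel"
      and HA: "\<And>x A. x \<in> Z \<Longrightarrow> (\<And>x'. x' \<in> \<Omega> \<Longrightarrow> rho \<Omega> x x' \<le> \<epsilon> / n \<Longrightarrow> ennreal \<bar>f x' - f x\<bar> \<le> A) \<Longrightarrow> H x \<le> A"
      using maj unfolding dominated_by_oscillation_def by blast+
    note [measurable] = Z(1) borel_closed[OF \<Omega>(1)] borel_measurable_continuous_onI[OF f(1)]
    have "(\<integral>\<^sup>+y. H (S y) * indicator (S -` Z) y \<partial>lborel)
        \<le> ennreal (C * \<epsilon>) * (\<integral>\<^sup>+y. ennreal \<bar>f (S y)\<bar> * indicator K y \<partial>lborel)"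
    proof (rule oscillation_estimateD[OF chart n \<epsilon>])
      show "continuous_on UNIV (\<lambda>y. f (S y))"
        by (intro continuous_on_compose2[OF f(1)] contS) auto
      show "quadratic_curve_poly (2 * n) (\<lambda>y. f (S y))"
        unfolding S_def using f(2) linP by (rule quadratic_curve_poly_affine)
      show "S -` Z \<in> sets borel" using measurable_sets[of S borel borel Z] by simp
      have cb: "cball y \<delta> \<subseteq> V" if "S y \<in> Z" for y
      proof
        fix v assume "v \<in> cball y \<delta>"
        then have "S v \<in> cball (S y) \<delta>" by (simp add: dist_S)
        then have "S v \<in> U" using Z(2) that by blast
        then show "v \<in> V" unfolding V_def imT by simp
      qed
      show "S -` Z \<subseteq> K \<inter> {y. cball y \<delta> \<subseteq> V \<and> bdist y < r\<^sub>0}"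
      proof
        fix y assume "y \<in> S -` Z"
        then have y: "S y \<in> Z" by simp
        have "bdist y = infdist (S y) (frontier \<Omega>)" using infdist_K[of "S y"] by (simp add: TS)
        then have "S y \<in> \<Omega>" "bdist y < r\<^sub>0" using y Z(2) by auto
        then show "y \<in> K \<inter> {y. cball y \<delta> \<subseteq> V \<and> bdist y < r\<^sub>0}" using cb[OF y] by (simp add: K_def imT)
      qed
      show "dominated_by_oscillation K (\<lambda>y y'. dist y y' \<le> \<epsilon> / n \<and> \<bar>sqrt (bdist y) - sqrt (bdist y')\<bar> \<le> \<epsilon> / n)
          (\<lambda>y. f (S y)) (S -` Z) (\<lambda>y. H (S y))"
        unfolding dominated_by_oscillation_def
      proof (intro conjI ballI allI impI)
        show "(\<lambda>y. H (S y)) \<in> borel_measurable borel" by measurable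
        fix y A assume y: "y \<in> S -` Z"
          and A: "\<forall>y'\<in>K. dist y y' \<le> \<epsilon> / n \<and> \<bar>sqrt (bdist y) - sqrt (bdist y')\<bar> \<le> \<epsilon> / n \<longrightarrow>
            ennreal \<bar>f (S y') - f (S y)\<bar> \<le> A"
        show "H (S y) \<le> A"
        proof (rule HA)
          show "S y \<in> Z" using y by simp
          fix x' assume x': "x' \<in> \<Omega>" and rho: "rho \<Omega> (S y) x' \<le> \<epsilon> / n"
          have "dist (S y) x' \<le> \<epsilon> / n"
            "\<bar>sqrt (infdist (S y) (frontier \<Omega>)) - sqrt (infdist x' (frontier \<Omega>))\<bar> \<le> \<epsilon> / n"
            using rho norm_ge_zero[of "S y - x'"] unfolding rho_def dist_norm by linarith+
          then have "dist y (T x') \<le> \<epsilon> / n" "\<bar>sqrt (bdist y) - sqrt (bdist (T x'))\<bar> \<le> \<epsilon> / n"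
            using dist_S[of y "T x'"] infdist_K[of "S y"] infdist_K[of x'] by (simp_all add: ST TS)
          with A x' show "ennreal \<bar>f x' - f (S y)\<bar> \<le> A" by (force simp: K_def ST)
        qed
      qed
    qed
    also have "(\<integral>\<^sup>+y. ennreal \<bar>f (S y)\<bar> * indicator K y \<partial>lborel) = (\<integral>\<^sup>+x\<in>\<Omega>. ennreal \<bar>f x\<bar> \<partial>lborel)"
    proof -
      have "indicator K y = (indicator \<Omega> (S y) :: ennreal)" for y unfolding K_def imT by (simp add: indicator_def)
      then show ?thesis using int_S[of "\<lambda>x. ennreal \<bar>f x\<bar> * indicator \<Omega> x"] by simp
    qed
    also have "(\<integral>\<^sup>+y. H (S y) * indicator (S -` Z) y \<partial>lborel) = (\<integral>\<^sup>+x\<in>Z. H x \<partial>lborel)"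
      using int_S[of "\<lambda>x. H x * indicator Z x"] by (simp add: indicator_def)
    finally show "(\<integral>\<^sup>+x\<in>Z. H x \<partial>lborel)
        \<le> ennreal (C * \<epsilon>) * (\<integral>\<^sup>+x\<in>\<Omega>. ennreal \<bar>f x\<bar> \<partial>lborel)" .
  qed
  with r\<^sub>0 show ?thesis by blast
qed

section \<open>Polynomials along quadratic curves\<close>

definition poly_function :: "nat \<Rightarrow> (real \<Rightarrow> real) \<Rightarrow> bool" where
  "poly_function d h \<longleftrightarrow> (\<exists>p. degree p \<le> d \<and> (\<forall>t. h t = poly p t))"

lemma poly_function_const: "poly_function d (\<lambda>t. c)"
  unfolding poly_function_def by (intro exI[of _ "[:c:]"]) simp

lemma poly_function_mult:
  assumes "poly_function d h" "poly_function e k"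
  shows "poly_function (d + e) (\<lambda>t. h t * k t)"
proof -
  obtain p q where "degree p \<le> d" "\<forall>t. h t = poly p t" "degree q \<le> e" "\<forall>t. k t = poly q t"
    using assms unfolding poly_function_def by blast
  then show ?thesis unfolding poly_function_def
    by (intro exI[of _ "p * q"]) (auto intro: order.trans[OF degree_mult_le])
qed

lemma poly_function_power: "poly_function d h \<Longrightarrow> poly_function (d * k) (\<lambda>t. h t ^ k)"
proof (induction k)
  case 0
  then show ?case by (simp add: poly_function_const)
next
  case (Suc k)
  then show ?case using poly_function_mult[of d h "d * k" "\<lambda>t. h t ^ k"] by simp
qed

lemma poly_function_prod:
  assumes "finite A" "\<And>i. i \<in> A \<Longrightarrow> poly_function (d i) (h i)"
  shows "poly_function (\<Sum>i\<in>A. d i) (\<lambda>t. \<Prod>i\<in>A. h i t)"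
  using assms
proof (induction A rule: finite_induct)
  case empty
  then show ?case by (simp add: poly_function_const)
next
  case (insert i A)
  then show ?case using poly_function_mult[of "d i" "h i" "\<Sum>i\<in>A. d i" "\<lambda>t. \<Prod>i\<in>A. h i t"] by simp
qed

lemma poly_function_sum:
  assumes "finite A" "\<And>i. i \<in> A \<Longrightarrow> poly_function d (h i)"
  shows "poly_function d (\<lambda>t. \<Sum>i\<in>A. h i t)"
proof -
  have "\<forall>i\<in>A. \<exists>p. degree p \<le> d \<and> (\<forall>t. h i t = poly p t)"
    using assms(2) unfolding poly_function_def by blast
  then obtain p where p: "\<And>i. i \<in> A \<Longrightarrow> degree (p i) \<le> d \<and> (\<forall>t. h i t = poly (p i) t)" by metis
  then show ?thesis unfolding poly_function_def
    by (intro exI[of _ "\<Sum>i\<in>A. p i"]) (auto simp: poly_sum assms(1) intro!: degree_sum_le sum.cong)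
qed

lemma poly_function_mono: "poly_function d h \<Longrightarrow> d \<le> e \<Longrightarrow> poly_function e h"
  unfolding poly_function_def by (meson order.trans)

text \<open>Each coordinate of the curve is at most quadratic in \<open>t\<close>, so monomials at
  most double their degree.\<close>

lemma polynomial_quadratic_curve:
  fixes f :: "(real ^ 'd) \<times> real \<Rightarrow> real"
  assumes "polynomial_of_degree_le n f"
  shows "quadratic_curve_poly (2 * n) f"
  unfolding quadratic_curve_poly_def
proof (intro allI)
  fix x y z :: "(real ^ 'd) \<times> real"
  define \<gamma> where "\<gamma> t = x + t *\<^sub>R y + t\<^sup>2 *\<^sub>R z" for t :: real
  obtain a where a: "\<And>x. f x = (\<Sum>(\<alpha>, m)\<in>multi_indices n.
      a (\<alpha>, m) * ((\<Prod>i\<in>UNIV. (fst x $ i) ^ \<alpha> i) * snd x ^ m))"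
    using assms unfolding polynomial_of_degree_le_def by blast
  have quad: "poly_function 2 (\<lambda>t. b + t * c + t\<^sup>2 * e)" for b c e
    unfolding poly_function_def by (intro exI[of _ "[:b, c, e:]"]) (auto simp: power2_eq_square algebra_simps)
  have 1: "poly_function 2 (\<lambda>t. fst (\<gamma> t) $ i)" for i
    using quad[of "fst x $ i" "fst y $ i" "fst z $ i"] by (simp add: \<gamma>_def)
  have 2: "poly_function 2 (\<lambda>t. snd (\<gamma> t))"
    using quad[of "snd x" "snd y" "snd z"] by (simp add: \<gamma>_def)
  have "poly_function (2 * n) (\<lambda>t. \<Sum>k\<in>multi_indices n.
      a k * ((\<Prod>i\<in>UNIV. (fst (\<gamma> t) $ i) ^ fst k i) * snd (\<gamma> t) ^ snd k))"
  proof (rule poly_function_sum[OF finite_multi_indices])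
    fix k :: "('d \<Rightarrow> nat) \<times> nat" assume "k \<in> multi_indices n"
    then have "(\<Sum>i\<in>UNIV. fst k i) + snd k \<le> n" by (auto simp: multi_indices_def)
    moreover have "(\<Sum>i\<in>UNIV. 2 * fst k i) = 2 * (\<Sum>i\<in>UNIV. fst k i)" by (rule sum_distrib_left[symmetric])
    ultimately have deg: "0 + ((\<Sum>i\<in>UNIV. 2 * fst k i) + 2 * snd k) \<le> 2 * n" by linarith
    show "poly_function (2 * n) (\<lambda>t. a k * ((\<Prod>i\<in>UNIV. (fst (\<gamma> t) $ i) ^ fst k i) * snd (\<gamma> t) ^ snd k))"
      by (rule poly_function_mono[OF _ deg])
        (intro poly_function_mult poly_function_const poly_function_prod poly_function_power 1 2 finite)
  qed
  then have "poly_function (2 * n) (\<lambda>t. f (\<gamma> t))" unfolding a by (simp add: case_prod_beta)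
  then show "\<exists>p. degree p \<le> 2 * n \<and> (\<forall>t. f (x + t *\<^sub>R y + t\<^sup>2 *\<^sub>R z) = poly p t)"
    unfolding poly_function_def \<gamma>_def .
qed

lemma polynomial_continuous_on:
  "polynomial_of_degree_le n f \<Longrightarrow> continuous_on A f"
proof -
  assume "polynomial_of_degree_le n f"
  then obtain a where "\<And>x. f x = (\<Sum>(\<alpha>, m)\<in>multi_indices n. a (\<alpha>, m) * ((\<Prod>i\<in>UNIV. (fst x $ i) ^ \<alpha> i) * snd x ^ m))"
    unfolding polynomial_of_degree_le_def by blast
  then have a: "f = (\<lambda>x. \<Sum>k\<in>multi_indices n. a k * ((\<Prod>i\<in>UNIV. (fst x $ i) ^ fst k i) * snd x ^ snd k))"
    by (simp add: case_prod_beta fun_eq_iff)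
  show "continuous_on A f" unfolding a by (intro continuous_intros)
qed

lemma polynomial_add:
  assumes "polynomial_of_degree_le n f" "polynomial_of_degree_le n g"
  shows "polynomial_of_degree_le n (\<lambda>x. f x + g x)"
proof -
  obtain a b where "\<And>x. f x = (\<Sum>(\<alpha>, m)\<in>multi_indices n. a (\<alpha>, m) * ((\<Prod>i\<in>UNIV. (fst x $ i) ^ \<alpha> i) * snd x ^ m))"
    "\<And>x. g x = (\<Sum>(\<alpha>, m)\<in>multi_indices n. b (\<alpha>, m) * ((\<Prod>i\<in>UNIV. (fst x $ i) ^ \<alpha> i) * snd x ^ m))"
    using assms unfolding polynomial_of_degree_le_def by blast
  then show ?thesis unfolding polynomial_of_degree_le_def
    by (intro exI[of _ "\<lambda>k. a k + b k"]) (simp add: case_prod_beta sum.distrib[symmetric] algebra_simps)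
qed

lemma polynomial_scale:
  assumes "polynomial_of_degree_le n f"
  shows "polynomial_of_degree_le n (\<lambda>x. c * f x)"
proof -
  obtain a where "\<And>x. f x = (\<Sum>(\<alpha>, m)\<in>multi_indices n. a (\<alpha>, m) * ((\<Prod>i\<in>UNIV. (fst x $ i) ^ \<alpha> i) * snd x ^ m))"
    using assms unfolding polynomial_of_degree_le_def by blast
  then show ?thesis unfolding polynomial_of_degree_le_def
    by (intro exI[of _ "\<lambda>k. c * a k"]) (simp add: case_prod_beta sum_distrib_left mult.assoc)
qed

text \<open>The set splits into a part away from the boundary and one part near it for each chart.
  These parts may overlap, since only upper bounds are added; the constants are summed and the
  smallest threshold is taken.\<close>

lemma domain_oscillation:
  fixes \<Omega> :: "((real ^ 'd) \<times> real) set"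
  assumes \<Omega>: "closed \<Omega>" "bounded \<Omega>" "frontier \<Omega> \<noteq> {}" "C2_domain \<Omega>"
  shows "\<exists>\<epsilon>\<^sub>0 C. oscillation_estimate \<Omega> (\<lambda>t x x'. rho \<Omega> x x' \<le> t) UNIV \<epsilon>\<^sub>0 C"
proof -
  let ?near = "\<lambda>t x x'. rho \<Omega> x x' \<le> t"
  obtain \<delta>' M and J :: nat and U where \<delta>': "\<delta>' > 0" and U: "\<forall>j\<in>{1..J}. open (U j) \<and> connected (U j)"
    and cover: "\<forall>x\<in>\<Omega>. infdist x (frontier \<Omega>) < \<delta>' \<longrightarrow> (\<exists>j\<in>{1..J}. x \<in> U j \<and> infdist x (frontier (U j)) > \<delta>')"
    and charts: "\<forall>j\<in>{1..J}. \<exists>T f. cartesian_coordinates T \<and> C2_function f \<and>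
      (\<forall>i k x. \<bar>partial i (partial k f) x\<bar> \<le> M) \<and> \<Omega> \<inter> U j = {x \<in> U j. snd (T x) \<le> f (fst (T x))}"
    using \<Omega>(4) unfolding C2_domain_def by blast
  define \<delta> where "\<delta> = min \<delta>' 1"
  have \<delta>: "0 < \<delta>" "\<delta> \<le> 1" "\<delta> \<le> \<delta>'" using \<delta>' by (auto simp: \<delta>_def)
  define G where "G j r = {x. cball x \<delta> \<subseteq> U j \<and> infdist x (frontier \<Omega>) < r}" for j r
  have "\<exists>r>0. \<exists>e C. oscillation_estimate \<Omega> ?near (G j r) e C" if j: "j \<in> {1..J}" for j
  proof -
    obtain T g where T: "cartesian_coordinates T" "C2_function g"
      "\<And>i k x. \<bar>partial i (partial k g) x\<bar> \<le> M" "\<Omega> \<inter> U j = {x \<in> U j. snd (T x) \<le> g (fst (T x))}"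
      using charts j by blast
    have "open (U j)" using U j by blast
    from boundary_chart_oscillation[OF \<Omega>(1-3) this T \<delta>(1,2)] show ?thesis unfolding G_def .
  qed
  then obtain r e C where r: "\<And>j. j \<in> {1..J} \<Longrightarrow> r j > 0"
    and chart: "\<And>j. j \<in> {1..J} \<Longrightarrow> oscillation_estimate \<Omega> ?near (G j (r j)) (e j) (C j)"
    by metis
  have e: "e j > 0" and C0: "C j \<ge> 0" if "j \<in> {1..J}" for j
    using chart[OF that] by (simp_all add: oscillation_estimate_def)
  \<comment> \<open>Below \<open>\<delta>\<close> the covering property supplies a chart, and below
    \<open>r j\<close> the estimate of chart \<open>j\<close> holds.\<close>
  define r\<^sub>0 where "r\<^sub>0 = Min (insert \<delta> (r ` {1..J}))"
  have r\<^sub>0: "r\<^sub>0 > 0" "r\<^sub>0 \<le> \<delta>" "\<And>j. j \<in> {1..J} \<Longrightarrow> r\<^sub>0 \<le> r j"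
  proof -
    show "r\<^sub>0 > 0" unfolding r\<^sub>0_def using \<delta> r by auto
    show "r\<^sub>0 \<le> \<delta>" "\<And>j. j \<in> {1..J} \<Longrightarrow> r\<^sub>0 \<le> r j" unfolding r\<^sub>0_def by (rule Min_le; simp)+
  qed
  \<comment> \<open>Half of \<open>r\<^sub>0\<close>, because a closed ball is known to stay inside
    only if its radius is strictly below the boundary distance.\<close>
  obtain \<epsilon>\<^sub>i C\<^sub>i where "oscillation_estimate \<Omega> (\<lambda>t x x'. dist x x' \<le> t) {x. cball x (r\<^sub>0 / 2) \<subseteq> \<Omega>} \<epsilon>\<^sub>i C\<^sub>i"
    using interior_oscillation[OF \<Omega>(1), of "r\<^sub>0 / 2"] r\<^sub>0(1) by auto
  then have int: "oscillation_estimate \<Omega> ?near {x. cball x (r\<^sub>0 / 2) \<subseteq> \<Omega>} \<epsilon>\<^sub>i C\<^sub>i"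
  proof (rule oscillation_estimate_mono)
    show "dist x x' \<le> t" if "rho \<Omega> x x' \<le> t" for t x x' using that unfolding rho_def dist_norm by linarith
  qed
  have i: "\<epsilon>\<^sub>i > 0" "C\<^sub>i \<ge> 0" using int by (simp_all add: oscillation_estimate_def)
  define \<epsilon>\<^sub>0 where "\<epsilon>\<^sub>0 = Min (insert \<epsilon>\<^sub>i (e ` {1..J}))"
  define C\<^sub>0 where "C\<^sub>0 = C\<^sub>i + (\<Sum>j\<in>{1..J}. C j)"
  have \<epsilon>\<^sub>0: "\<epsilon>\<^sub>0 > 0" "\<epsilon>\<^sub>0 \<le> \<epsilon>\<^sub>i" "\<And>j. j \<in> {1..J} \<Longrightarrow> \<epsilon>\<^sub>0 \<le> e j"
  proof -
    show "\<epsilon>\<^sub>0 > 0" unfolding \<epsilon>\<^sub>0_def using i e by auto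
    show "\<epsilon>\<^sub>0 \<le> \<epsilon>\<^sub>i" "\<And>j. j \<in> {1..J} \<Longrightarrow> \<epsilon>\<^sub>0 \<le> e j" unfolding \<epsilon>\<^sub>0_def by (rule Min_le; simp)+
  qed
  have "oscillation_estimate \<Omega> ?near UNIV \<epsilon>\<^sub>0 C\<^sub>0"
    unfolding oscillation_estimate_def
  proof (intro conjI allI impI \<epsilon>\<^sub>0(1))
    show "C\<^sub>0 \<ge> 0" unfolding C\<^sub>0_def using i C0 by (intro add_nonneg_nonneg sum_nonneg) auto
    fix n :: nat and \<epsilon> f Y H
    assume n: "n \<ge> 1" and \<epsilon>: "0 < \<epsilon>" "\<epsilon> \<le> \<epsilon>\<^sub>0" and f: "continuous_on UNIV f" "quadratic_curve_poly (2 * n) f"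
      and Y[measurable]: "Y \<in> sets borel" and Y\<Omega>: "Y \<subseteq> \<Omega> \<inter> UNIV"
      and maj: "dominated_by_oscillation \<Omega> (?near (\<epsilon> / n)) f Y H"
    let ?I = "\<integral>\<^sup>+x\<in>\<Omega>. ennreal \<bar>f x\<bar> \<partial>lborel"
    have [measurable]: "H \<in> borel_measurable borel" using maj by (simp add: dominated_by_oscillation_def)
    have inf_meas[measurable]: "(\<lambda>x. infdist x A) \<in> borel_measurable borel" for A :: "((real ^ 'd) \<times> real) set"
      by (intro borel_measurable_continuous_onI continuous_intros)
    have maj': "dominated_by_oscillation \<Omega> (?near (\<epsilon> / n)) f Z H" if "Z \<subseteq> Y" for Z
      using maj that unfolding dominated_by_oscillation_def by blast
    define Z where "Z j = {x \<in> Y. infdist x (frontier \<Omega>) < r\<^sub>0 \<and> x \<in> U j \<and> \<delta>' < infdist x (frontier (U j))}" for j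
    define Z\<^sub>i where "Z\<^sub>i = {x \<in> Y. r\<^sub>0 \<le> infdist x (frontier \<Omega>)}"
    have Zb[measurable]: "Z j \<in> sets borel" if "j \<in> {1..J}" for j
    proof -
      have [measurable]: "U j \<in> sets borel" using U that by auto
      show ?thesis unfolding Z_def by measurable
    qed
    have Zib[measurable]: "Z\<^sub>i \<in> sets borel" unfolding Z\<^sub>i_def by measurable
    have "H x * indicator Y x \<le> H x * indicator Z\<^sub>i x + (\<Sum>j\<in>{1..J}. H x * indicator (Z j) x)" for x
    proof (cases "x \<in> Y \<and> x \<notin> Z\<^sub>i")
      case True
      then have "infdist x (frontier \<Omega>) < r\<^sub>0" by (auto simp: Z\<^sub>i_def)
      then obtain j where j: "j \<in> {1..J}" "x \<in> Z j"
        using cover True Y\<Omega> r\<^sub>0(2) \<delta>(3) by (force simp: Z_def)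
      then have "H x * indicator Y x \<le> H x * indicator (Z j) x" using True by simp
      also have "\<dots> \<le> (\<Sum>j\<in>{1..J}. H x * indicator (Z j) x)" using j(1) by (intro member_le_sum) auto
      finally show ?thesis using True by simp
    next
      case False
      then show ?thesis by (auto simp: indicator_def)
    qed
    then have "(\<integral>\<^sup>+x\<in>Y. H x \<partial>lborel)
        \<le> (\<integral>\<^sup>+x. H x * indicator Z\<^sub>i x + (\<Sum>j\<in>{1..J}. H x * indicator (Z j) x) \<partial>lborel)"
      by (intro nn_integral_mono)
    also have "\<dots> = (\<integral>\<^sup>+x\<in>Z\<^sub>i. H x \<partial>lborel) + (\<Sum>j\<in>{1..J}. \<integral>\<^sup>+x\<in>Z j. H x \<partial>lborel)"
    proof -
      have m: "(\<lambda>x. H x * indicator (Z j) x) \<in> borel_measurable lborel" if "j \<in> {1..J}" for j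
        using Zb[OF that] by measurable
      then have ms: "(\<lambda>x. \<Sum>j\<in>{1..J}. H x * indicator (Z j) x) \<in> borel_measurable lborel"
        by (intro borel_measurable_sum)
      have "(\<integral>\<^sup>+x. H x * indicator Z\<^sub>i x + (\<Sum>j\<in>{1..J}. H x * indicator (Z j) x) \<partial>lborel)
          = (\<integral>\<^sup>+x\<in>Z\<^sub>i. H x \<partial>lborel) + (\<integral>\<^sup>+x. (\<Sum>j\<in>{1..J}. H x * indicator (Z j) x) \<partial>lborel)"
        by (rule nn_integral_add[OF _ ms]) measurable
      also have "(\<integral>\<^sup>+x. (\<Sum>j\<in>{1..J}. H x * indicator (Z j) x) \<partial>lborel) = (\<Sum>j\<in>{1..J}. \<integral>\<^sup>+x\<in>Z j. H x \<partial>lborel)"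
        by (rule nn_integral_sum[OF m])
      finally show ?thesis .
    qed
    also have "\<dots> \<le> ennreal (C\<^sub>i * \<epsilon>) * ?I + (\<Sum>j\<in>{1..J}. ennreal (C j * \<epsilon>) * ?I)"
    proof (intro add_mono sum_mono)
      have "cball x (r\<^sub>0 / 2) \<subseteq> \<Omega>" if "x \<in> Z\<^sub>i" for x
        using that Y\<Omega> r\<^sub>0(1) by (intro cball_subset_of_infdist_frontier) (auto simp: Z\<^sub>i_def)
      moreover have "Z\<^sub>i \<subseteq> Y" by (auto simp: Z\<^sub>i_def)
      ultimately show "(\<integral>\<^sup>+x\<in>Z\<^sub>i. H x \<partial>lborel) \<le> ennreal (C\<^sub>i * \<epsilon>) * ?I"
        using \<epsilon> \<epsilon>\<^sub>0(2) Y\<Omega> by (intro oscillation_estimateD[OF int n \<epsilon>(1) _ f Zib] maj') auto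
    next
      fix j assume j: "j \<in> {1..J}"
      have "Z j \<subseteq> G j (r j)"
      proof
        fix x assume x: "x \<in> Z j"
        have "cball x \<delta>' \<subseteq> U j" using x by (intro cball_subset_of_infdist_frontier) (auto simp: Z_def)
        moreover have "infdist x (frontier \<Omega>) < r j" using x r\<^sub>0(3)[OF j] by (auto simp: Z_def)
        ultimately show "x \<in> G j (r j)" using \<delta>(3) by (auto simp: G_def)
      qed
      moreover have "Z j \<subseteq> Y" by (auto simp: Z_def)
      ultimately show "(\<integral>\<^sup>+x\<in>Z j. H x \<partial>lborel) \<le> ennreal (C j * \<epsilon>) * ?I"
        using \<epsilon> \<epsilon>\<^sub>0(3)[OF j] Y\<Omega> by (intro oscillation_estimateD[OF chart[OF j] n \<epsilon>(1) _ f Zb[OF j]] maj') auto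
    qed
    also have "\<dots> = ennreal (C\<^sub>0 * \<epsilon>) * ?I"
    proof -
      have "(\<Sum>j\<in>{1..J}. ennreal (C j * \<epsilon>)) = ennreal (\<Sum>j\<in>{1..J}. C j * \<epsilon>)"
        using C0 \<epsilon> by (intro sum_ennreal) auto
      moreover have "ennreal (C\<^sub>i * \<epsilon>) + ennreal (\<Sum>j\<in>{1..J}. C j * \<epsilon>) = ennreal (C\<^sub>0 * \<epsilon>)"
        unfolding C\<^sub>0_def distrib_right sum_distrib_right[symmetric] using i C0 \<epsilon>
        by (intro ennreal_plus[symmetric]) (auto intro!: mult_nonneg_nonneg sum_nonneg)
      ultimately show ?thesis by (simp add: distrib_right[symmetric] sum_distrib_right[symmetric])
    qed
    finally show "(\<integral>\<^sup>+x\<in>Y. H x \<partial>lborel) \<le> ennreal (C\<^sub>0 * \<epsilon>) * ?I" .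
  qed
  then show ?thesis by blast
qed

section \<open>Cubature formulas\<close>

text \<open>Packing: the balls of radius \<open>s / 2\<close> around the points are disjoint and lie
  in a ball of radius \<open>R + s / 2\<close>, so volumes can be compared.\<close>

lemma separated_card_bound:
  fixes A :: "'a::euclidean_space set"
  assumes s: "s > 0" and A: "A \<subseteq> cball c R" "R \<ge> 0" and sep: "\<And>x y. x \<in> A \<Longrightarrow> y \<in> A \<Longrightarrow> x \<noteq> y \<Longrightarrow> s \<le> dist x y"
  shows "finite A \<and> card A \<le> nat \<lfloor>((2 * R + s) / s) ^ DIM('a)\<rfloor>"
proof (rule finite_if_finite_subsets_card_bdd)
  fix B assume B: "B \<subseteq> A" "finite B"
  define v where "v = unit_ball_vol (real DIM('a))"
  have v: "v > 0" by (simp add: v_def)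
  have "disjoint_family_on (\<lambda>x. ball x (s / 2)) B"
    unfolding disjoint_family_on_def
  proof (intro ballI impI)
    fix x y assume "x \<in> B" "y \<in> B" "x \<noteq> y"
    then have "s \<le> dist x y" using B(1) by (intro sep) auto
    then show "ball x (s / 2) \<inter> ball y (s / 2) = {}"
    proof (intro equals0I)
      fix z assume "z \<in> ball x (s / 2) \<inter> ball y (s / 2)"
      then have "dist x z < s / 2" "dist y z < s / 2" by simp_all
      then show False using \<open>s \<le> dist x y\<close> dist_triangle2[of x y z] by simp
    qed
  qed
  then have "(\<Sum>x\<in>B. emeasure lborel (ball x (s / 2))) = emeasure lborel (\<Union>x\<in>B. ball x (s / 2))"
    using B(2) by (intro sum_emeasure) auto
  also have "\<dots> \<le> emeasure lborel (ball c (R + s / 2))"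
  proof (rule emeasure_mono)
    show "(\<Union>x\<in>B. ball x (s / 2)) \<subseteq> ball c (R + s / 2)"
    proof
      fix z assume "z \<in> (\<Union>x\<in>B. ball x (s / 2))"
      then obtain x where "x \<in> B" "dist x z < s / 2" by auto
      moreover from this have "dist c x \<le> R" using A B by auto
      ultimately show "z \<in> ball c (R + s / 2)" using dist_triangle[of c z x] by simp
    qed
  qed simp
  finally have "ennreal (real (card B) * (v * (s / 2) ^ DIM('a))) \<le> ennreal (v * (R + s / 2) ^ DIM('a))"
    using s A(2) v by (simp add: emeasure_ball v_def ennreal_of_nat_eq_real_of_nat ennreal_mult[symmetric])
  then have "real (card B) * (v * (s / 2) ^ DIM('a)) \<le> v * (R + s / 2) ^ DIM('a)"
    using v s A(2) by (subst (asm) ennreal_le_iff) auto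
  then have "real (card B) * (s / 2) ^ DIM('a) \<le> (R + s / 2) ^ DIM('a)"
    using v by (simp add: mult.left_commute)
  then have "real (card B) \<le> (R + s / 2) ^ DIM('a) / (s / 2) ^ DIM('a)"
    using s by (simp add: pos_le_divide_eq)
  also have "\<dots> = ((R + s / 2) / (s / 2)) ^ DIM('a)" by (simp only: power_divide)
  also have "(R + s / 2) / (s / 2) = (2 * R + s) / s" using s by (simp add: field_simps)
  finally show "card B \<le> nat \<lfloor>((2 * R + s) / s) ^ DIM('a)\<rfloor>" by (simp add: le_nat_floor)
qed

text \<open>The functions \<open>p \<xi>\<close> form a partition of unity on
  \<open>\<Omega>\<close>. The error of the weights \<open>\<mu> \<xi>\<close> is therefore an
  average of differences \<open>f x - f \<xi>\<close> over nodes whose sets contain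
  \<open>x\<close>, which \<open>osc\<close> controls, and the bounded multiplicity
  \<open>n\<^sub>0\<close> keeps \<open>\<mu> \<xi>\<close> comparable to the volume of
  \<open>U \<xi>\<close>.\<close>

lemma cubature_of_averages:
  fixes \<Omega> \<Lambda> :: "'a::euclidean_space set" and U :: "'a \<Rightarrow> 'a set" and P :: "('a \<Rightarrow> real) set"
  assumes \<Omega>: "compact \<Omega>" and \<Lambda>: "finite \<Lambda>" "\<Lambda> \<subseteq> \<Omega>"
    and U: "\<And>\<xi>. \<xi> \<in> \<Lambda> \<Longrightarrow> closed (U \<xi>)" "\<And>\<xi>. \<xi> \<in> \<Lambda> \<Longrightarrow> U \<xi> \<subseteq> \<Omega>" "\<And>\<xi>. \<xi> \<in> \<Lambda> \<Longrightarrow> measure lborel (U \<xi>) > 0"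
    and cover: "\<And>x. x \<in> \<Omega> \<Longrightarrow> \<exists>\<xi>\<in>\<Lambda>. x \<in> U \<xi>"
    and card: "\<And>x. x \<in> \<Omega> \<Longrightarrow> card {\<xi> \<in> \<Lambda>. x \<in> U \<xi>} \<le> n\<^sub>0"
    and P: "\<And>f. f \<in> P \<Longrightarrow> continuous_on UNIV f" "\<And>f g. f \<in> P \<Longrightarrow> g \<in> P \<Longrightarrow> (\<lambda>x. f x + g x) \<in> P"
      "\<And>f c. f \<in> P \<Longrightarrow> (\<lambda>x. c * f x) \<in> P"
    and osc: "\<And>f H. f \<in> P \<Longrightarrow> H \<in> borel_measurable borel \<Longrightarrow>
      (\<And>x A. x \<in> \<Omega> \<Longrightarrow> (\<And>\<xi>. \<xi> \<in> \<Lambda> \<Longrightarrow> x \<in> U \<xi> \<Longrightarrow> ennreal \<bar>f \<xi> - f x\<bar> \<le> A) \<Longrightarrow> H x \<le> A) \<Longrightarrow>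
      (\<integral>\<^sup>+x\<in>\<Omega>. H x \<partial>lborel) \<le> ennreal (1 / 3) * (\<integral>\<^sup>+x\<in>\<Omega>. ennreal \<bar>f x\<bar> \<partial>lborel)"
  shows "\<exists>w. (\<forall>\<xi>\<in>\<Lambda>. w \<xi> > 0 \<and> measure lborel (U \<xi>) / (2 * real n\<^sub>0) \<le> w \<xi> \<and> w \<xi> \<le> 2 * measure lborel (U \<xi>)) \<and>
    (\<forall>f\<in>P. (LINT x|lborel. indicator \<Omega> x * f x) = (\<Sum>\<xi>\<in>\<Lambda>. w \<xi> * f \<xi>))"
proof -
  have [measurable]: "\<Omega> \<in> sets borel" using \<Omega> by (simp add: borel_closed compact_imp_closed)
  have Ub[measurable]: "U \<xi> \<in> sets borel" if "\<xi> \<in> \<Lambda>" for \<xi> using U(1)[OF that] by (rule borel_closed)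
  define \<nu> where "\<nu> x = (\<Sum>\<xi>\<in>\<Lambda>. indicator (U \<xi>) x :: real)" for x
  have \<nu>_card: "\<nu> x = real (card {\<xi> \<in> \<Lambda>. x \<in> U \<xi>})" for x
    using \<Lambda>(1) by (simp add: \<nu>_def indicator_def sum.If_cases Int_def)
  have \<nu>1: "1 \<le> \<nu> x" if "x \<in> \<Omega>" for x
  proof -
    have "{\<xi> \<in> \<Lambda>. x \<in> U \<xi>} \<noteq> {}" using cover[OF that] by blast
    then have "card {\<xi> \<in> \<Lambda>. x \<in> U \<xi>} \<ge> 1" using \<Lambda>(1) by (simp add: Suc_le_eq card_gt_0_iff)
    then show ?thesis by (simp add: \<nu>_card)
  qed
  have \<nu>n: "\<nu> x \<le> real n\<^sub>0" if "x \<in> \<Omega>" for x using card[OF that] by (simp add: \<nu>_card)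
  have [measurable]: "\<nu> \<in> borel_measurable borel" unfolding \<nu>_def by (intro borel_measurable_sum) measurable
  define p where "p \<xi> x = indicator (U \<xi>) x / \<nu> x" for \<xi> x
  have p_meas[measurable]: "p \<xi> \<in> borel_measurable borel" if "\<xi> \<in> \<Lambda>" for \<xi>
    using Ub[OF that] unfolding p_def by measurable
  have p0: "0 \<le> p \<xi> x" if "\<xi> \<in> \<Lambda>" for \<xi> x
    unfolding p_def \<nu>_def by (intro divide_nonneg_nonneg sum_nonneg) auto
  have p_out: "p \<xi> x = 0" if "\<xi> \<in> \<Lambda>" "x \<notin> U \<xi>" for \<xi> x using that by (simp add: p_def)
  have p_le: "p \<xi> x \<le> indicator (U \<xi>) x" if "\<xi> \<in> \<Lambda>" for \<xi> x
    using \<nu>1[of x] U(2)[OF that] by (auto simp: p_def indicator_def divide_le_eq)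
  have p_ge: "indicator (U \<xi>) x / real n\<^sub>0 \<le> p \<xi> x" if "\<xi> \<in> \<Lambda>" for \<xi> x
    using \<nu>1[of x] \<nu>n[of x] U(2)[OF that] by (auto simp: p_def indicator_def frac_le)
  have p_sum: "(\<Sum>\<xi>\<in>\<Lambda>. p \<xi> x) = indicator \<Omega> x" for x
  proof (cases "x \<in> \<Omega>")
    case True
    have "(\<Sum>\<xi>\<in>\<Lambda>. p \<xi> x) = (\<Sum>\<xi>\<in>\<Lambda>. indicator (U \<xi>) x) / \<nu> x" by (simp only: p_def sum_divide_distrib)
    also have "\<dots> = \<nu> x / \<nu> x" by (simp only: \<nu>_def)
    finally show ?thesis using True \<nu>1[OF True] by simp
  next
    case False
    then have "p \<xi> x = 0" if "\<xi> \<in> \<Lambda>" for \<xi> using U(2)[OF that] p_out[OF that] by blast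
    then show ?thesis using False by simp
  qed
  have int_\<Omega>: "integrable lborel (\<lambda>x. indicator \<Omega> x * f x)" if "continuous_on UNIV f" for f :: "'a \<Rightarrow> real"
    using borel_integrable_compact[OF \<Omega> continuous_on_subset[OF that]] by simp
  have int_p: "integrable lborel (\<lambda>x. p \<xi> x * f x)" if \<xi>: "\<xi> \<in> \<Lambda>" and f: "continuous_on UNIV f" for \<xi> and f :: "'a \<Rightarrow> real"
  proof (rule Bochner_Integration.integrable_bound[OF int_\<Omega>[OF f]])
    have [measurable]: "f \<in> borel_measurable borel" using f by (rule borel_measurable_continuous_onI)
    show "(\<lambda>x. p \<xi> x * f x) \<in> borel_measurable lborel" using p_meas[OF \<xi>] by measurable
    have "\<bar>p \<xi> x * f x\<bar> \<le> \<bar>indicator \<Omega> x * f x\<bar>" for x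
    proof -
      have "p \<xi> x \<le> indicator \<Omega> x"
        using U(2)[OF \<xi>] by (intro order.trans[OF p_le[OF \<xi>]]) (auto simp: indicator_def)
      then show ?thesis using p0[OF \<xi>, of x] by (simp add: abs_mult mult_right_mono)
    qed
    then show "AE x in lborel. norm (p \<xi> x * f x) \<le> norm (indicator \<Omega> x * f x)" by simp
  qed
  define \<mu> where "\<mu> \<xi> = (LINT x|lborel. p \<xi> x)" for \<xi>
  have int_p1: "integrable lborel (p \<xi>)" if "\<xi> \<in> \<Lambda>" for \<xi> using int_p[OF that, of "\<lambda>_. 1"] by simp
  have U_fin: "emeasure lborel (U \<xi>) < \<infinity>" if "\<xi> \<in> \<Lambda>" for \<xi>
  proof -
    have "bounded (U \<xi>)" using U(2)[OF that] \<Omega> compact_imp_bounded bounded_subset by blast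
    then show ?thesis by (rule emeasure_bounded_finite)
  qed
  have int_ind: "integrable lborel (indicator (U \<xi>) :: 'a \<Rightarrow> real)" if "\<xi> \<in> \<Lambda>" for \<xi>
    using U_fin[OF that] Ub[OF that] by (intro integrable_real_indicator) auto
  have \<mu>_le: "\<mu> \<xi> \<le> measure lborel (U \<xi>)" if "\<xi> \<in> \<Lambda>" for \<xi>
  proof -
    have "\<mu> \<xi> \<le> (LINT x|lborel. indicator (U \<xi>) x)"
      unfolding \<mu>_def by (intro integral_mono int_p1 int_ind p_le that)
    then show ?thesis by simp
  qed
  have \<mu>_ge: "measure lborel (U \<xi>) / real n\<^sub>0 \<le> \<mu> \<xi>" if "\<xi> \<in> \<Lambda>" for \<xi>
  proof -
    have "(LINT x|lborel. indicator (U \<xi>) x / real n\<^sub>0) \<le> \<mu> \<xi>"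
      unfolding \<mu>_def by (intro integral_mono int_p1 integrable_divide int_ind p_ge that)
    then show ?thesis by simp
  qed
  have n0: "n\<^sub>0 \<ge> 1" if "\<xi> \<in> \<Lambda>" for \<xi>
    using \<nu>1[of \<xi>] \<nu>n[of \<xi>] that \<Lambda>(2) by (auto simp: subset_iff)
  have \<mu>_pos: "\<mu> \<xi> > 0" if "\<xi> \<in> \<Lambda>" for \<xi>
    using \<mu>_ge[OF that] U(3)[OF that] n0[OF that] by (intro less_le_trans[OF _ \<mu>_ge[OF that]]) simp
  have defect: "\<bar>(LINT x|lborel. indicator \<Omega> x * f x) - (\<Sum>\<xi>\<in>\<Lambda>. \<mu> \<xi> * f \<xi>)\<bar> \<le> (\<Sum>\<xi>\<in>\<Lambda>. \<mu> \<xi> / 2 * \<bar>f \<xi>\<bar>)"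
    if f: "f \<in> P" for f
  proof -
    note fc = P(1)[OF f]
    have [measurable]: "f \<in> borel_measurable borel" using fc by (rule borel_measurable_continuous_onI)
    \<comment> \<open>On \<open>\<Omega>\<close> this is a convex combination of the differences,
      hence below every common bound of them, as \<open>osc\<close> demands.\<close>
    define h where "h x = (\<Sum>\<xi>\<in>\<Lambda>. p \<xi> x * \<bar>f \<xi> - f x\<bar>)" for x
    have h_int: "integrable lborel h"
      unfolding h_def by (intro Bochner_Integration.integrable_sum int_p continuous_intros fc)
    have h0: "0 \<le> h x" for x unfolding h_def by (intro sum_nonneg mult_nonneg_nonneg p0) auto
    define I where "I = (LINT x|lborel. indicator \<Omega> x * \<bar>f x\<bar>)"
    have I_int: "integrable lborel (\<lambda>x. indicator \<Omega> x * \<bar>f x\<bar>)" by (intro int_\<Omega> continuous_intros fc)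
    have nI: "(\<integral>\<^sup>+x\<in>\<Omega>. ennreal \<bar>f x\<bar> \<partial>lborel) = ennreal I"
    proof -
      have "(\<integral>\<^sup>+x\<in>\<Omega>. ennreal \<bar>f x\<bar> \<partial>lborel) = (\<integral>\<^sup>+x. ennreal (indicator \<Omega> x * \<bar>f x\<bar>) \<partial>lborel)"
        by (intro nn_integral_cong) (auto simp: indicator_def)
      then show ?thesis unfolding I_def using I_int by (subst (asm) nn_integral_eq_integral) auto
    qed
    have I0: "I \<ge> 0" unfolding I_def by (intro integral_nonneg_AE) auto
    have nh: "(\<integral>\<^sup>+x. ennreal (h x) * indicator \<Omega> x \<partial>lborel) = ennreal (LINT x|lborel. h x)"
    proof -
      have "h x = 0" if "x \<notin> \<Omega>" for x
        unfolding h_def using that U(2) p_out by (intro sum.neutral) (metis mult_zero_left subsetD)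
      then have "(\<integral>\<^sup>+x. ennreal (h x) * indicator \<Omega> x \<partial>lborel) = (\<integral>\<^sup>+x. ennreal (h x) \<partial>lborel)"
        by (intro nn_integral_cong) (auto simp: indicator_def)
      then show ?thesis using h_int h0 by (simp add: nn_integral_eq_integral)
    qed
    have "(\<integral>\<^sup>+x. ennreal (h x) * indicator \<Omega> x \<partial>lborel) \<le> ennreal (1 / 3) * (\<integral>\<^sup>+x\<in>\<Omega>. ennreal \<bar>f x\<bar> \<partial>lborel)"
    proof (rule osc[OF f])
      have "h \<in> borel_measurable lborel" using h_int by (rule borel_measurable_integrable)
      then show "(\<lambda>x. ennreal (h x)) \<in> borel_measurable borel" by simp
      fix x A assume x: "x \<in> \<Omega>" and A: "\<And>\<xi>. \<xi> \<in> \<Lambda> \<Longrightarrow> x \<in> U \<xi> \<Longrightarrow> ennreal \<bar>f \<xi> - f x\<bar> \<le> A"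
      have "ennreal (h x) = (\<Sum>\<xi>\<in>\<Lambda>. ennreal (p \<xi> x * \<bar>f \<xi> - f x\<bar>))"
        unfolding h_def by (intro sum_ennreal[symmetric] mult_nonneg_nonneg p0) auto
      also have "\<dots> \<le> (\<Sum>\<xi>\<in>\<Lambda>. ennreal (p \<xi> x) * A)"
      proof (intro sum_mono)
        fix \<xi> assume \<xi>: "\<xi> \<in> \<Lambda>"
        show "ennreal (p \<xi> x * \<bar>f \<xi> - f x\<bar>) \<le> ennreal (p \<xi> x) * A"
        proof (cases "x \<in> U \<xi>")
          case True
          then show ?thesis using A[OF \<xi> True] p0[OF \<xi>] by (simp add: ennreal_mult mult_left_mono)
        qed (simp add: p_out \<xi>)
      qed
      also have "\<dots> = ennreal (\<Sum>\<xi>\<in>\<Lambda>. p \<xi> x) * A"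
        unfolding sum_distrib_right[symmetric] using p0 by (subst sum_ennreal) auto
      also have "\<dots> = A" using x by (simp add: p_sum)
      finally show "ennreal (h x) \<le> A" .
    qed
    then have "ennreal (LINT x|lborel. h x) \<le> ennreal (I / 3)"
      unfolding nh nI using I0 by (simp add: ennreal_mult[symmetric])
    then have h_le: "(LINT x|lborel. h x) \<le> I / 3" using I0 by (simp add: ennreal_le_iff)
    have split: "(LINT x|lborel. indicator \<Omega> x * k x) - (\<Sum>\<xi>\<in>\<Lambda>. \<mu> \<xi> * k \<xi>)
        = (LINT x|lborel. (\<Sum>\<xi>\<in>\<Lambda>. p \<xi> x * (k x - k \<xi>)))" if k: "continuous_on UNIV k" for k :: "'a \<Rightarrow> real"
    proof -
      have "(LINT x|lborel. (\<Sum>\<xi>\<in>\<Lambda>. p \<xi> x * (k x - k \<xi>)))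
          = (LINT x|lborel. indicator \<Omega> x * k x - (\<Sum>\<xi>\<in>\<Lambda>. p \<xi> x * k \<xi>))"
        unfolding p_sum[symmetric] sum_distrib_right sum_subtractf[symmetric] by (simp add: right_diff_distrib)
      also have "\<dots> = (LINT x|lborel. indicator \<Omega> x * k x) - (LINT x|lborel. (\<Sum>\<xi>\<in>\<Lambda>. p \<xi> x * k \<xi>))"
        by (intro Bochner_Integration.integral_diff int_\<Omega> k Bochner_Integration.integrable_sum int_p continuous_on_const)
      also have "(LINT x|lborel. (\<Sum>\<xi>\<in>\<Lambda>. p \<xi> x * k \<xi>)) = (\<Sum>\<xi>\<in>\<Lambda>. \<mu> \<xi> * k \<xi>)"
        by (subst Bochner_Integration.integral_sum) (auto simp: \<mu>_def int_p1)
      finally show ?thesis by simp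
    qed
    \<comment> \<open>Stated for any \<open>k\<close> that varies no more than \<open>f\<close>,
      because it is used for \<open>f\<close> and for \<open>\<bar>f\<bar>\<close> with the same
      \<open>h\<close>.\<close>
    have bound: "\<bar>(LINT x|lborel. indicator \<Omega> x * k x) - (\<Sum>\<xi>\<in>\<Lambda>. \<mu> \<xi> * k \<xi>)\<bar> \<le> I / 3"
      if k: "continuous_on UNIV k" and kf: "\<And>x y. \<bar>k x - k y\<bar> \<le> \<bar>f x - f y\<bar>" for k :: "'a \<Rightarrow> real"
    proof -
      have ki: "integrable lborel (\<lambda>x. \<Sum>\<xi>\<in>\<Lambda>. p \<xi> x * (k x - k \<xi>))"
        by (intro Bochner_Integration.integrable_sum int_p continuous_intros k)
      have "\<bar>LINT x|lborel. (\<Sum>\<xi>\<in>\<Lambda>. p \<xi> x * (k x - k \<xi>))\<bar> \<le> (LINT x|lborel. \<bar>\<Sum>\<xi>\<in>\<Lambda>. p \<xi> x * (k x - k \<xi>)\<bar>)"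
        by (rule integral_abs_bound)
      also have "\<dots> \<le> (LINT x|lborel. h x)"
      proof (intro integral_mono integrable_abs ki h_int)
        fix x
        have "\<bar>\<Sum>\<xi>\<in>\<Lambda>. p \<xi> x * (k x - k \<xi>)\<bar> \<le> (\<Sum>\<xi>\<in>\<Lambda>. \<bar>p \<xi> x * (k x - k \<xi>)\<bar>)" by (rule sum_abs)
        also have "\<dots> \<le> h x" unfolding h_def
        proof (intro sum_mono)
          fix \<xi> assume "\<xi> \<in> \<Lambda>"
          then show "\<bar>p \<xi> x * (k x - k \<xi>)\<bar> \<le> p \<xi> x * \<bar>f \<xi> - f x\<bar>"
            using kf[of x \<xi>] p0[of \<xi> x] by (simp add: abs_mult abs_minus_commute mult_left_mono)
        qed
        finally show "\<bar>\<Sum>\<xi>\<in>\<Lambda>. p \<xi> x * (k x - k \<xi>)\<bar> \<le> h x" .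
      qed
      finally show ?thesis using h_le unfolding split[OF k] by simp
    qed
    have b1: "\<bar>(LINT x|lborel. indicator \<Omega> x * f x) - (\<Sum>\<xi>\<in>\<Lambda>. \<mu> \<xi> * f \<xi>)\<bar> \<le> I / 3"
      by (rule bound[OF fc]) simp
    have "\<bar>I - (\<Sum>\<xi>\<in>\<Lambda>. \<mu> \<xi> * \<bar>f \<xi>\<bar>)\<bar> \<le> I / 3"
      unfolding I_def by (fold I_def, rule bound[of "\<lambda>x. \<bar>f x\<bar>", folded I_def]) (auto intro!: continuous_intros fc)
    \<comment> \<open>By \<open>bound\<close> for the absolute value, the weighted sum of
      \<open>\<bar>f \<xi>\<bar>\<close> is at least \<open>2 / 3 * I\<close>. Hence the choice of
      one third: the error \<open>I / 3\<close> is at most half of that sum, and a correction of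
      this size cannot destroy positivity.\<close>
    then have "I / 3 \<le> (\<Sum>\<xi>\<in>\<Lambda>. \<mu> \<xi> * \<bar>f \<xi>\<bar>) / 2" by linarith
    also have "\<dots> = (\<Sum>\<xi>\<in>\<Lambda>. \<mu> \<xi> / 2 * \<bar>f \<xi>\<bar>)" by (simp add: sum_divide_distrib)
    finally show ?thesis using b1 by simp
  qed
  \<comment> \<open>Each function of \<open>P\<close> is paired with its cubature error; a
    representation of this error by coefficients of size at most \<open>\<mu> \<xi> / 2\<close> is
    the correction to be added.\<close>
  define V where "V = (\<lambda>f. (f, (LINT x|lborel. indicator \<Omega> x * f x) - (\<Sum>\<xi>\<in>\<Lambda>. \<mu> \<xi> * f \<xi>))) ` P"
  have "\<exists>a. (\<forall>\<xi>\<in>\<Lambda>. \<bar>a \<xi>\<bar> \<le> \<mu> \<xi> / 2) \<and> (\<forall>(v, l)\<in>V. l = (\<Sum>\<xi>\<in>\<Lambda>. a \<xi> * v \<xi>))"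
  proof (rule bounded_functional_coefficients[OF \<Lambda>(1)])
    show "0 \<le> \<mu> \<xi> / 2" if "\<xi> \<in> \<Lambda>" for \<xi> using \<mu>_pos[OF that] by simp
    show "((\<lambda>x. v x + v' x), l + l') \<in> V" if "(v, l) \<in> V" "(v', l') \<in> V" for v l v' l'
    proof -
      from that have v: "v \<in> P" "v' \<in> P" and l: "l = (LINT x|lborel. indicator \<Omega> x * v x) - (\<Sum>\<xi>\<in>\<Lambda>. \<mu> \<xi> * v \<xi>)"
        "l' = (LINT x|lborel. indicator \<Omega> x * v' x) - (\<Sum>\<xi>\<in>\<Lambda>. \<mu> \<xi> * v' \<xi>)" by (auto simp: V_def)
      have "(LINT x|lborel. indicator \<Omega> x * (v x + v' x)) = (LINT x|lborel. indicator \<Omega> x * v x) + (LINT x|lborel. indicator \<Omega> x * v' x)"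
        unfolding distrib_left by (intro Bochner_Integration.integral_add int_\<Omega> P(1) v)
      then have "l + l' = (LINT x|lborel. indicator \<Omega> x * (v x + v' x)) - (\<Sum>\<xi>\<in>\<Lambda>. \<mu> \<xi> * (v \<xi> + v' \<xi>))"
        unfolding l by (simp add: distrib_left sum.distrib)
      then show ?thesis unfolding V_def using P(2)[OF v] by (intro image_eqI[where x="\<lambda>x. v x + v' x"]) auto
    qed
    show "((\<lambda>x. c * v x), c * l) \<in> V" if "(v, l) \<in> V" for c v l
    proof -
      from that have v: "v \<in> P" and l: "l = (LINT x|lborel. indicator \<Omega> x * v x) - (\<Sum>\<xi>\<in>\<Lambda>. \<mu> \<xi> * v \<xi>)"
        by (auto simp: V_def)
      have "c * l = (LINT x|lborel. indicator \<Omega> x * (c * v x)) - (\<Sum>\<xi>\<in>\<Lambda>. \<mu> \<xi> * (c * v \<xi>))"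
        unfolding l by (simp add: right_diff_distrib sum_distrib_left mult.left_commute[of _ c])
      then show ?thesis unfolding V_def using P(3)[OF v] by (intro image_eqI[where x="\<lambda>x. c * v x"]) auto
    qed
    show "l \<le> (\<Sum>\<xi>\<in>\<Lambda>. \<mu> \<xi> / 2 * \<bar>v \<xi>\<bar>)" if "(v, l) \<in> V" for v l
      using that defect unfolding V_def by force
  qed
  then obtain a where a: "\<And>\<xi>. \<xi> \<in> \<Lambda> \<Longrightarrow> \<bar>a \<xi>\<bar> \<le> \<mu> \<xi> / 2"
    "\<And>f. f \<in> P \<Longrightarrow> (LINT x|lborel. indicator \<Omega> x * f x) - (\<Sum>\<xi>\<in>\<Lambda>. \<mu> \<xi> * f \<xi>) = (\<Sum>\<xi>\<in>\<Lambda>. a \<xi> * f \<xi>)"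
    unfolding V_def by auto
  show ?thesis
  proof (intro exI[of _ "\<lambda>\<xi>. \<mu> \<xi> + a \<xi>"] conjI ballI)
    fix \<xi> assume \<xi>: "\<xi> \<in> \<Lambda>"
    have half: "\<mu> \<xi> / 2 \<le> \<mu> \<xi> + a \<xi>" "\<mu> \<xi> + a \<xi> \<le> 3 / 2 * \<mu> \<xi>" using a(1)[OF \<xi>] by (auto simp: abs_le_iff)
    show "0 < \<mu> \<xi> + a \<xi>" using half \<mu>_pos[OF \<xi>] by linarith
    have "measure lborel (U \<xi>) / (2 * real n\<^sub>0) = measure lborel (U \<xi>) / real n\<^sub>0 / 2" by simp
    also have "\<dots> \<le> \<mu> \<xi> / 2" using \<mu>_ge[OF \<xi>] by (rule divide_right_mono) simp
    finally show "measure lborel (U \<xi>) / (2 * real n\<^sub>0) \<le> \<mu> \<xi> + a \<xi>" using half by linarith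
    show "\<mu> \<xi> + a \<xi> \<le> 2 * measure lborel (U \<xi>)" using half \<mu>_le[OF \<xi>] \<mu>_pos[OF \<xi>] by linarith
  next
    fix f assume "f \<in> P"
    from a(2)[OF this] show "(LINT x|lborel. indicator \<Omega> x * f x) = (\<Sum>\<xi>\<in>\<Lambda>. (\<mu> \<xi> + a \<xi>) * f \<xi>)"
      by (simp add: distrib_right sum.distrib)
  qed
qed

section \<open>The boundary-adapted metric and its balls\<close>

lemma rho_embedding:
  fixes \<Omega> :: "((real ^ 'd) \<times> real) set"
  defines "E \<equiv> \<lambda>x. (x, sqrt (infdist x (frontier \<Omega>)))"
  shows "dist (E x) (E y) \<le> rho \<Omega> x y" "rho \<Omega> x y \<le> 2 * dist (E x) (E y)"
proof -
  have "dist (E x) (E y) \<le> dist x y + dist (sqrt (infdist x (frontier \<Omega>))) (sqrt (infdist y (frontier \<Omega>)))"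
    unfolding E_def dist_Pair_Pair by (rule sqrt_sum_squares_le_sum) auto
  then show "dist (E x) (E y) \<le> rho \<Omega> x y" by (simp add: rho_def dist_norm)
  show "rho \<Omega> x y \<le> 2 * dist (E x) (E y)"
    using dist_fst_le[of "E x" "E y"] dist_snd_le[of "E x" "E y"] by (simp add: rho_def E_def dist_norm)
qed

lemma rho_commute: "rho \<Omega> x y = rho \<Omega> y x"
  by (simp add: rho_def norm_minus_commute abs_minus_commute)

lemma rho_self: "rho \<Omega> x x = 0"
  by (simp add: rho_def)

lemma continuous_on_rho: "continuous_on A (rho \<Omega> x)"
  unfolding rho_def by (intro continuous_intros)

lemma maximal_separated_set_near:
  assumes "maximal_separated_set X \<rho> \<epsilon> \<Lambda>" "x \<in> X"
  obtains \<xi> where "\<xi> \<in> \<Lambda>" "\<rho> x \<xi> < \<epsilon>"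
proof -
  have "(INF \<omega>\<in>\<Lambda>. ereal (\<rho> x \<omega>)) < ereal \<epsilon>" using assms by (simp add: maximal_separated_set_def)
  then obtain \<xi> where "\<xi> \<in> \<Lambda>" "ereal (\<rho> x \<xi>) < ereal \<epsilon>" unfolding INF_less_iff by blast
  then show thesis using that by simp
qed

text \<open>A neighbourhood of \<open>\<xi>\<close> in the metric is open by continuity and meets
  \<open>D\<close> because \<open>\<xi>\<close> lies in its closure; so the ball contains a
  Euclidean one.\<close>

lemma measure_rho_ball_pos:
  fixes D :: "((real ^ 'd) \<times> real) set"
  assumes "open D" "bounded D" "\<xi> \<in> closure D" "t > 0"
  shows "measure lborel (rho_ball (closure D) \<xi> t) > 0"
proof -
  let ?r = "rho (closure D) \<xi>"
  have "open (?r -` {..<t})" by (intro open_vimage continuous_on_rho open_lessThan)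
  moreover have "\<xi> \<in> ?r -` {..<t}" using assms(4) by (simp add: rho_self)
  ultimately have "D \<inter> ?r -` {..<t} \<noteq> {}"
    using assms(3) open_Int_closure_eq_empty[of "?r -` {..<t}" D] by blast
  then obtain x where x: "x \<in> D \<inter> ?r -` {..<t}" by blast
  have "open (D \<inter> ?r -` {..<t})" using assms(1) \<open>open (?r -` {..<t})\<close> by blast
  then obtain e where e: "e > 0" "ball x e \<subseteq> D \<inter> ?r -` {..<t}" using x open_contains_ball by meson
  have sub: "ball x e \<subseteq> rho_ball (closure D) \<xi> t"
    using e(2) closure_subset[of D] by (auto simp: rho_ball_def)
  have "closed (rho_ball (closure D) \<xi> t)"
  proof -
    have "rho_ball (closure D) \<xi> t = closure D \<inter> ?r -` {..t}" by (auto simp: rho_ball_def)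
    then show ?thesis by (simp only:) (intro closed_Int closed_closure closed_vimage closed_atMost continuous_on_rho)
  qed
  moreover have "bounded (rho_ball (closure D) \<xi> t)"
    using assms(2) by (rule bounded_subset[OF bounded_closure]) (auto simp: rho_ball_def)
  ultimately have fm: "rho_ball (closure D) \<xi> t \<in> fmeasurable lborel"
    using emeasure_bounded_finite by (intro fmeasurableI) (auto intro: borel_closed)
  have "0 < measure lborel (ball x e)" using e(1) by (simp add: content_ball)
  also have "\<dots> \<le> measure lborel (rho_ball (closure D) \<xi> t)"
    using sub fm by (intro measure_mono_fmeasurable) auto
  finally show ?thesis .
qed

theorem theorem2p12:
  fixes \<Omega> D :: "((real ^ 'd) \<times> real) set"
  assumes "open D" and "connected D" and "bounded D" and "D \<noteq> {}"
    and "\<Omega> = closure D" and "C2_domain \<Omega>"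
  shows "\<exists>\<epsilon>\<^sub>0::real. 0 < \<epsilon>\<^sub>0 \<and> \<epsilon>\<^sub>0 < 1 \<and>
    (\<forall>\<epsilon>::real. 0 < \<epsilon> \<and> \<epsilon> < \<epsilon>\<^sub>0 \<longrightarrow>
      (\<exists>c::real. c \<ge> 1 \<and>
        (\<forall>(n::nat) \<Lambda>. n \<ge> 1 \<and> maximal_separated_set \<Omega> (rho \<Omega>) (\<epsilon> / real n) \<Lambda> \<longrightarrow>
          (\<exists>w. (\<forall>\<xi>\<in>\<Lambda>. w \<xi> > 0) \<and>
            (\<forall>\<xi>\<in>\<Lambda>.
               inverse c * measure lebesgue (rho_ball \<Omega> \<xi> (\<epsilon> / real n)) \<le> w \<xi> \<and>
               w \<xi> \<le> c * measure lebesgue (rho_ball \<Omega> \<xi> (\<epsilon> / real n))) \<and>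
            (\<forall>f. polynomial_of_degree_le n f \<longrightarrow>
               (LINT \<eta>:\<Omega>|lebesgue. f \<eta>) = (\<Sum>\<xi>\<in>\<Lambda>. w \<xi> * f \<xi>))))))"
proof -
  have closed: "closed \<Omega>" and bdd: "bounded \<Omega>" using assms(3,5) by (auto intro: bounded_closure)
  then have compact: "compact \<Omega>" by (simp add: compact_eq_bounded_closed)
  have "\<Omega> \<noteq> {}" "\<Omega> \<noteq> UNIV" using assms(4,5) bdd not_bounded_UNIV closure_subset[of D] by auto
  then have fr: "frontier \<Omega> \<noteq> {}" by (simp add: frontier_eq_empty)
  \<comment> \<open>The embedding distorts the metric by at most a factor 2, so nodes separated by
    \<open>t\<close> have images separated by \<open>t / 2\<close>. Packing those within
    \<open>t\<close> of a point gives \<open>(2 * t + t / 2) / (t / 2) = 5\<close> to the power of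
    the dimension of the target space.\<close>
  define n\<^sub>0 :: nat where "n\<^sub>0 = 5 ^ DIM(((real ^ 'd) \<times> real) \<times> real)"
  \<comment> \<open>\<open>c\<close> covers the factors 2 and \<open>2 * n\<^sub>0\<close> of
    \<open>cubature_of_averages\<close> and depends on the dimension alone.\<close>
  define c where "c = max 2 (2 * real n\<^sub>0)"
  obtain \<epsilon>\<^sub>1 C where osc: "oscillation_estimate \<Omega> (\<lambda>t x x'. rho \<Omega> x x' \<le> t) UNIV \<epsilon>\<^sub>1 C"
    using domain_oscillation[OF closed bdd fr assms(6)] by blast
  then have \<epsilon>\<^sub>1: "0 < \<epsilon>\<^sub>1" and C: "0 \<le> C" by (simp_all add: oscillation_estimate_def)
  \<comment> \<open>The second entry secures \<open>C * \<epsilon> \<le> 1 / 3\<close>;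
    \<open>C + 1\<close> in place of \<open>C\<close> excludes a zero denominator and keeps the
    threshold below 1.\<close>
  define \<epsilon>\<^sub>0 where "\<epsilon>\<^sub>0 = min \<epsilon>\<^sub>1 (1 / (3 * (C + 1)))"
  have \<epsilon>\<^sub>0: "0 < \<epsilon>\<^sub>0" "\<epsilon>\<^sub>0 < 1" using \<epsilon>\<^sub>1 C by (auto simp: \<epsilon>\<^sub>0_def min_less_iff_disj)
  have main: "\<exists>w. (\<forall>\<xi>\<in>\<Lambda>. w \<xi> > 0) \<and>
          (\<forall>\<xi>\<in>\<Lambda>.
             inverse c * measure lebesgue (rho_ball \<Omega> \<xi> (\<epsilon> / real n)) \<le> w \<xi> \<and>
             w \<xi> \<le> c * measure lebesgue (rho_ball \<Omega> \<xi> (\<epsilon> / real n))) \<and>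
          (\<forall>f. polynomial_of_degree_le n f \<longrightarrow>
             (LINT \<eta>:\<Omega>|lebesgue. f \<eta>) = (\<Sum>\<xi>\<in>\<Lambda>. w \<xi> * f \<xi>))"
    if \<epsilon>: "0 < \<epsilon>" "\<epsilon> < \<epsilon>\<^sub>0" and n: "n \<ge> 1" and max: "maximal_separated_set \<Omega> (rho \<Omega>) (\<epsilon> / real n) \<Lambda>"
    for \<epsilon> n \<Lambda>
  proof -
    define t where "t = \<epsilon> / n"
    have t: "t > 0" using \<epsilon> n by (simp add: t_def)
    have \<Lambda>\<Omega>: "\<Lambda> \<subseteq> \<Omega>" and sep: "\<And>x y. x \<in> \<Lambda> \<Longrightarrow> y \<in> \<Lambda> \<Longrightarrow> x \<noteq> y \<Longrightarrow> t \<le> rho \<Omega> x y"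
      using max by (auto simp: maximal_separated_set_def separated_set_def t_def)
    define E where "E x = (x, sqrt (infdist x (frontier \<Omega>)))" for x
    have E_le: "dist (E x) (E y) \<le> rho \<Omega> x y" "rho \<Omega> x y \<le> 2 * dist (E x) (E y)" for x y
      using rho_embedding[where \<Omega>=\<Omega>] unfolding E_def by blast+
    have injE: "inj_on E A" for A by (auto simp: inj_on_def E_def)
    have E_sep: "t / 2 \<le> dist x y" if "x \<in> E ` \<Lambda>" "y \<in> E ` \<Lambda>" "x \<noteq> y" for x y
    proof -
      from that obtain x' y' where xy: "x = E x'" "y = E y'" "x' \<in> \<Lambda>" "y' \<in> \<Lambda>" by blast
      with that have "x' \<noteq> y'" by auto
      with sep[OF xy(3,4)] E_le(2)[of x' y'] show ?thesis by (simp add: xy)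
    qed
    \<comment> \<open>Finiteness of \<open>\<Lambda>\<close> is again a packing argument: its image
      is separated and lies in a compact set.\<close>
    have "compact (E ` \<Omega>)" unfolding E_def
      by (intro compact_continuous_image compact continuous_intros)
    then have "bounded (E ` \<Lambda>)" using \<Lambda>\<Omega> by (meson bounded_subset compact_imp_bounded image_mono)
    then obtain R where R: "R > 0" "\<forall>x\<in>E ` \<Lambda>. norm x \<le> R" unfolding bounded_pos by blast
    have "finite (E ` \<Lambda>)"
    proof (rule separated_card_bound[THEN conjunct1])
      show "t / 2 > 0" "R \<ge> 0" "E ` \<Lambda> \<subseteq> cball 0 R" using t R by auto
    qed (rule E_sep)
    then have fin: "finite \<Lambda>" using injE by (rule finite_imageD)
    define U where "U \<xi> = rho_ball \<Omega> \<xi> t" for \<xi>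
    have closedU: "closed (U \<xi>)" for \<xi>
    proof -
      have "U \<xi> = \<Omega> \<inter> rho \<Omega> \<xi> -` {..t}" by (auto simp: U_def rho_ball_def)
      then show ?thesis by (simp only:) (intro closed_Int closed closed_vimage closed_atMost continuous_on_rho)
    qed
    have "\<exists>w. (\<forall>\<xi>\<in>\<Lambda>. w \<xi> > 0 \<and> measure lborel (U \<xi>) / (2 * real n\<^sub>0) \<le> w \<xi> \<and> w \<xi> \<le> 2 * measure lborel (U \<xi>)) \<and>
      (\<forall>f\<in>{f. polynomial_of_degree_le n f}. (LINT x|lborel. indicator \<Omega> x * f x) = (\<Sum>\<xi>\<in>\<Lambda>. w \<xi> * f \<xi>))"
    proof (rule cubature_of_averages[OF compact fin \<Lambda>\<Omega> closedU])
      show "U \<xi> \<subseteq> \<Omega>" for \<xi> by (auto simp: U_def rho_ball_def)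
      show "measure lborel (U \<xi>) > 0" if "\<xi> \<in> \<Lambda>" for \<xi>
        unfolding U_def assms(5) using assms(1,3) t that \<Lambda>\<Omega> assms(5) by (intro measure_rho_ball_pos) auto
      show "\<exists>\<xi>\<in>\<Lambda>. x \<in> U \<xi>" if "x \<in> \<Omega>" for x
        using maximal_separated_set_near[OF max that] that
        by (metis (no_types, lifting) U_def rho_ball_def rho_commute t_def mem_Collect_eq less_imp_le)
      show "card {\<xi> \<in> \<Lambda>. x \<in> U \<xi>} \<le> n\<^sub>0" if "x \<in> \<Omega>" for x
      proof -
        have "E ` {\<xi> \<in> \<Lambda>. x \<in> U \<xi>} \<subseteq> cball (E x) t"
        proof
          fix y assume "y \<in> E ` {\<xi> \<in> \<Lambda>. x \<in> U \<xi>}"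
          then obtain \<xi> where "y = E \<xi>" "rho \<Omega> \<xi> x \<le> t" by (auto simp: U_def rho_ball_def)
          then show "y \<in> cball (E x) t" using E_le(1)[of \<xi> x] by (simp add: dist_commute)
        qed
        then have "card (E ` {\<xi> \<in> \<Lambda>. x \<in> U \<xi>}) \<le> nat \<lfloor>((2 * t + t / 2) / (t / 2)) ^ DIM(((real ^ 'd) \<times> real) \<times> real)\<rfloor>"
        proof (intro separated_card_bound[THEN conjunct2])
          show "t / 2 \<le> dist y z" if "y \<in> E ` {\<xi> \<in> \<Lambda>. x \<in> U \<xi>}" "z \<in> E ` {\<xi> \<in> \<Lambda>. x \<in> U \<xi>}" "y \<noteq> z" for y z
            by (rule E_sep) (use that in blast)+
        qed (use t in auto)
        also have "(2 * t + t / 2) / (t / 2) = 5" using t by (simp add: field_simps)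
        also have "(5::real) ^ DIM(((real ^ 'd) \<times> real) \<times> real) = real n\<^sub>0" by (simp add: n\<^sub>0_def)
        finally show ?thesis using card_image[OF injE, of "{\<xi> \<in> \<Lambda>. x \<in> U \<xi>}"] by simp
      qed
    next
      fix f H assume "f \<in> {f. polynomial_of_degree_le n f}" and H: "H \<in> borel_measurable borel"
        and HA: "\<And>x A. x \<in> \<Omega> \<Longrightarrow> (\<And>\<xi>. \<xi> \<in> \<Lambda> \<Longrightarrow> x \<in> U \<xi> \<Longrightarrow> ennreal \<bar>f \<xi> - f x\<bar> \<le> A) \<Longrightarrow> H x \<le> A"
      then have f: "polynomial_of_degree_le n f" by simp
      have "dominated_by_oscillation \<Omega> (\<lambda>x x'. rho \<Omega> x x' \<le> \<epsilon> / n) f \<Omega> H"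
        unfolding dominated_by_oscillation_def
      proof (intro conjI H ballI allI impI)
        fix x A assume x: "x \<in> \<Omega>" and A: "\<forall>x'\<in>\<Omega>. rho \<Omega> x x' \<le> \<epsilon> / n \<longrightarrow> ennreal \<bar>f x' - f x\<bar> \<le> A"
        show "H x \<le> A"
        proof (rule HA[OF x])
          fix \<xi> assume "\<xi> \<in> \<Lambda>" "x \<in> U \<xi>"
          then have "\<xi> \<in> \<Omega>" "rho \<Omega> x \<xi> \<le> \<epsilon> / n"
            using \<Lambda>\<Omega> by (auto simp: U_def rho_ball_def rho_commute[of \<Omega> x] t_def)
          then show "ennreal \<bar>f \<xi> - f x\<bar> \<le> A" using A by blast
        qed
      qed
      from oscillation_estimateD[OF osc n \<epsilon>(1) _ polynomial_continuous_on[OF f] polynomial_quadratic_curve[OF f]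
        borel_closed[OF closed] _ this]
      have "(\<integral>\<^sup>+x\<in>\<Omega>. H x \<partial>lborel) \<le> ennreal (C * \<epsilon>) * (\<integral>\<^sup>+x\<in>\<Omega>. ennreal \<bar>f x\<bar> \<partial>lborel)"
        using \<epsilon> by (simp add: \<epsilon>\<^sub>0_def)
      also have "\<dots> \<le> ennreal (1 / 3) * (\<integral>\<^sup>+x\<in>\<Omega>. ennreal \<bar>f x\<bar> \<partial>lborel)"
      proof (intro mult_right_mono ennreal_leI)
        have "C * \<epsilon> \<le> (C + 1) * (1 / (3 * (C + 1)))" using \<epsilon> C by (intro mult_mono) (auto simp: \<epsilon>\<^sub>0_def)
        also have "\<dots> = 1 / 3" using C by simp
        finally show "C * \<epsilon> \<le> 1 / 3" .
      qed simp
      finally show "(\<integral>\<^sup>+x\<in>\<Omega>. H x \<partial>lborel) \<le> ennreal (1 / 3) * (\<integral>\<^sup>+x\<in>\<Omega>. ennreal \<bar>f x\<bar> \<partial>lborel)" .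
    qed (auto intro: polynomial_continuous_on polynomial_add polynomial_scale)
    then obtain w where w: "\<And>\<xi>. \<xi> \<in> \<Lambda> \<Longrightarrow> w \<xi> > 0 \<and> measure lborel (U \<xi>) / (2 * real n\<^sub>0) \<le> w \<xi> \<and> w \<xi> \<le> 2 * measure lborel (U \<xi>)"
      "\<And>f. polynomial_of_degree_le n f \<Longrightarrow> (LINT x|lborel. indicator \<Omega> x * f x) = (\<Sum>\<xi>\<in>\<Lambda>. w \<xi> * f \<xi>)"
      by blast
    have mU: "measure lebesgue (rho_ball \<Omega> \<xi> (\<epsilon> / n)) = measure lborel (U \<xi>)" for \<xi>
      using borel_closed[OF closedU] by (simp add: U_def t_def measure_completion)
    show ?thesis
    proof (intro exI[of _ w] conjI ballI allI impI)
      fix \<xi> assume \<xi>: "\<xi> \<in> \<Lambda>"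
      show "0 < w \<xi>" using w(1)[OF \<xi>] by blast
      have "n\<^sub>0 \<ge> 1" unfolding n\<^sub>0_def by simp
      then have "inverse c \<le> 1 / (2 * real n\<^sub>0)" unfolding c_def by (simp add: inverse_eq_divide frac_le)
      then have "inverse c * measure lborel (U \<xi>) \<le> 1 / (2 * real n\<^sub>0) * measure lborel (U \<xi>)"
        by (rule mult_right_mono) simp
      then show "inverse c * measure lebesgue (rho_ball \<Omega> \<xi> (\<epsilon> / n)) \<le> w \<xi>"
        unfolding mU using w(1)[OF \<xi>] by simp
      have "2 * measure lborel (U \<xi>) \<le> c * measure lborel (U \<xi>)"
        by (rule mult_right_mono) (auto simp: c_def)
      then show "w \<xi> \<le> c * measure lebesgue (rho_ball \<Omega> \<xi> (\<epsilon> / n))"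
        unfolding mU using w(1)[OF \<xi>] by linarith
    next
      fix f :: "(real ^ 'd) \<times> real \<Rightarrow> real" assume f: "polynomial_of_degree_le n f"
      have "(\<lambda>x. indicator \<Omega> x * f x) \<in> borel_measurable lborel"
        using borel_closed[OF closed] borel_measurable_continuous_onI[OF polynomial_continuous_on[OF f]] by measurable
      then have "(LINT \<eta>:\<Omega>|lebesgue. f \<eta>) = (LINT x|lborel. indicator \<Omega> x * f x)"
        unfolding set_lebesgue_integral_def by (simp add: integral_completion)
      then show "(LINT \<eta>:\<Omega>|lebesgue. f \<eta>) = (\<Sum>\<xi>\<in>\<Lambda>. w \<xi> * f \<xi>)" using w(2)[OF f] by simp
    qed
  qed
  show ?thesis
  proof (rule exI[of _ \<epsilon>\<^sub>0], intro conjI \<epsilon>\<^sub>0 allI impI, rule exI[of _ c], intro conjI allI impI)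
    show "c \<ge> 1" by (simp add: c_def)
  qed (use main in blast)
qed

end
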